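(* If $1 \leq s \leq p$ are natural numbers and $\gamma \in [0,1]$, then the minimax separation rate satisfies $$\varepsilon^*(p,s,\gamma)^2 \asymp \begin{cases} (1-\gamma)s\log\left(1+\frac{p}{s^2}\right) & \text{if } s<\sqrt{p},\\ (1-\gamma)\sqrt{p} + \left[\frac{(1-\gamma)p^{3/2}}{p-s} \wedge (1-\gamma+\gamma p)\right] & \text{if } \sqrt{p}\leq s\leq p-\sqrt{p},\\ (1-\gamma)\sqrt{p} + \left[(1-\gamma)p\log\left(1+\frac{p}{(p-s)^2}\right)\wedge(1-\gamma+\gamma p)\right] & \text{if } p-\sqrt{p}<s\leq p.\end{cases}$$
   Context: Notation: $a\wedge b=\min(a,b)$; $\|\cdot\|$ is the Euclidean norm; $\|\theta\|_0$ is the number of nonzero coordinates; $I_p$ is the identity matrix; $\mathbf{1}_p\in\mathbb{R}^p$ is the all-ones vector. For $\theta\in\mathbb{R}^p$ and $\gamma\in[0,1]$, $P_{\theta,\gamma}$ denotes the distribution $N(\theta,(1-\gamma)I_p+\gamma\mathbf{1}_p\mathbf{1}_p^\intercal)$ of the observation $X\in\mathbb{R}^p$ (equivalently $X_i=\theta_i+\sqrt{\gamma}W+\sqrt{1-\gamma}Z_i$ with $W,Z_1,\dots,Z_p$ i.i.d. $N(0,1)$). For $\varepsilon>0$ let $\Theta(p,s,\varepsilon)=\{\theta\in\mathbb{R}^p:\|\theta\|\geq\varepsilon,\ \|\theta\|_0\leq s\}$. The minimax testing risk for $H_0:\theta=0$ against $H_1:\theta\in\Theta(p,s,\varepsilon)$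 is $$\mathcal{R}(\varepsilon)=\inf_{\varphi}\Big\{P_{0,\gamma}\{\varphi=1\}+\sup_{\theta\in\Theta(p,s,\varepsilon)}P_{\theta,\gamma}\{\varphi=0\}\Big\},$$ the infimum being over all measurable $\varphi:\mathbb{R}^p\to\{0,1\}$. Definition: $\varepsilon^*=\varepsilon^*(p,s,\gamma)$ is the minimax separation rate if (i) for every $\eta\in(0,1)$ there is $C_\eta>0$ depending only on $\eta$ such that $C>C_\eta$ implies $\mathcal{R}(C\varepsilon^* )\leq\eta$; and (ii) for every $\eta\in(0,1)$ there is $c_\eta>0$ depending only on $\eta$ such that $0<c<c_\eta$ implies $\mathcal{R}(c\varepsilon^* )\geq1-\eta$. The constants do not depend on $(p,s,\gamma)$. The rate is unique only up to multiplication by universal constants, and $a\asymp b$ means $c\,b\leq a\leq C\,b$ with universal constants $c,C>0$; thus the assertion $(\varepsilon^* )^2\asymp\psi^2$ means that $\psi$ satisfies (i) and (ii) in place of $\varepsilon^*$. Convention for a degenerate rate: that the rate equals $0$ (which happens for $\gamma=1$, $s<p$) means $\mathcal{R}(\varepsilon)=0$ for every $\varepsilon>0$. Convention for $s=p$: the expression $(1-\gamma)p\log(1+p/(p-s)^2)$ is read as $+\infty$ (also when $\gamma=1$), so that the minimum equals $1-\gamma+\gamma p$. If more than one case applies (only $p=2$, $s=1$), the first applicable one is used. *)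

theory Defs
  imports "HOL-Probability.Probability"
begin

text \<open>The dimension \<open>p\<close> varies inside the statement (the constants must not depend on it), so
  a vector of \<open>\<real>\<^sup>p\<close> is an extensional function on \<open>{..<p}\<close>.\<close>

abbreviation Rvec :: "nat \<Rightarrow> (nat \<Rightarrow> real) measure" where
  "Rvec p \<equiv> PiM {..<p} (\<lambda>_. borel)"

text \<open>The law \<open>N(\<theta>, (1 - \<gamma>) I + \<gamma> 1 1\<^sup>T)\<close>, as the law of
  \<open>X\<^sub>i = \<theta>\<^sub>i + sqrt \<gamma> W + sqrt (1 - \<gamma>) Z\<^sub>i\<close> with \<open>W, Z\<^sub>1, \<dots>, Z\<^sub>p\<close> i.i.d. standard normal; this
  covers the degenerate case \<open>\<gamma> = 1\<close>. Its characteristic function is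
  computed in \<open>char_obs_law\<close> below.\<close>

definition obs_law :: "nat \<Rightarrow> real \<Rightarrow> (nat \<Rightarrow> real) \<Rightarrow> (nat \<Rightarrow> real) measure" where
  "obs_law p \<gamma> \<theta> =
     distr (std_normal_distribution \<Otimes>\<^sub>M PiM {..<p} (\<lambda>_. std_normal_distribution)) (Rvec p)
       (\<lambda>(w, z). \<lambda>i\<in>{..<p}. \<theta> i + sqrt \<gamma> * w + sqrt (1 - \<gamma>) * z i)"

definition l0_norm :: "nat \<Rightarrow> (nat \<Rightarrow> real) \<Rightarrow> nat" where
  "l0_norm p \<theta> = card {i \<in> {..<p}. \<theta> i \<noteq> 0}"

definition sparse_alt :: "nat \<Rightarrow> nat \<Rightarrow> real \<Rightarrow> (nat \<Rightarrow> real) set" where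
  "sparse_alt p s \<epsilon> = {\<theta> \<in> space (Rvec p). L2_set \<theta> {..<p} \<ge> \<epsilon> \<and> l0_norm p \<theta> \<le> s}"

definition tests :: "nat \<Rightarrow> ((nat \<Rightarrow> real) \<Rightarrow> nat) set" where
  "tests p = Rvec p \<rightarrow>\<^sub>M count_space {0, 1}"

text \<open>The infimum and supremum are taken in \<open>real\<close>. For \<open>1 \<le> s \<le> p\<close> the index sets are nonempty
  and all values lie in \<open>[0, 2]\<close>, so these are the actual infimum and supremum.\<close>

definition minimax_risk :: "nat \<Rightarrow> nat \<Rightarrow> real \<Rightarrow> real \<Rightarrow> real" where
  "minimax_risk p s \<gamma> \<epsilon> =
     (INF \<phi>\<in>tests p.
        measure (obs_law p \<gamma> (\<lambda>i\<in>{..<p}. 0)) {x \<in> space (Rvec p). \<phi> x = 1}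
        + (SUP \<theta>\<in>sparse_alt p s \<epsilon>.
             measure (obs_law p \<gamma> \<theta>) {x \<in> space (Rvec p). \<phi> x = 0}))"

text \<open>\<open>r\<close> is a minimax separation rate on the set \<open>D\<close> of parameter triples \<open>(p, s, \<gamma>)\<close>, with
  constants uniform over \<open>D\<close>. Where \<open>r\<close> vanishes, \<open>C * r\<close> is not an admissible
  separation, and the requirement is that the risk is \<open>0\<close> at every positive
  separation.\<close>

definition minimax_separation_rate ::
    "(nat \<times> nat \<times> real) set \<Rightarrow> (nat \<Rightarrow> nat \<Rightarrow> real \<Rightarrow> real) \<Rightarrow> bool" where
  "minimax_separation_rate D r \<longleftrightarrow>
     (\<forall>(p, s, \<gamma>)\<in>D. r p s \<gamma> \<ge> 0) \<and>
     (\<forall>\<eta>\<in>{0<..<1}. \<exists>C\<^sub>\<eta>>0. \<forall>(p, s, \<gamma>)\<in>D. r p s \<gamma> > 0 \<longrightarrow>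
        (\<forall>C>C\<^sub>\<eta>. minimax_risk p s \<gamma> (C * r p s \<gamma>) \<le> \<eta>)) \<and>
     (\<forall>\<eta>\<in>{0<..<1}. \<exists>c\<^sub>\<eta>>0. \<forall>(p, s, \<gamma>)\<in>D. r p s \<gamma> > 0 \<longrightarrow>
        (\<forall>c. 0 < c \<and> c < c\<^sub>\<eta> \<longrightarrow> minimax_risk p s \<gamma> (c * r p s \<gamma>) \<ge> 1 - \<eta>)) \<and>
     (\<forall>(p, s, \<gamma>)\<in>D. r p s \<gamma> = 0 \<longrightarrow> (\<forall>\<epsilon>>0. minimax_risk p s \<gamma> \<epsilon> = 0))"

text \<open>For \<open>s = p\<close> the logarithmic term stands for \<open>+\<infinity>\<close>, hence the minimum for its second
  argument; \<open>x / 0 = 0\<close> would give the wrong value.\<close>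

definition rate_sq :: "nat \<Rightarrow> nat \<Rightarrow> real \<Rightarrow> real" where
  "rate_sq p s \<gamma> =
     (if real s < sqrt (real p) then
        (1 - \<gamma>) * real s * ln (1 + real p / (real s)\<^sup>2)
      else if real s \<le> real p - sqrt (real p) then
        (1 - \<gamma>) * sqrt (real p)
        + min ((1 - \<gamma>) * real p powr (3/2) / (real p - real s)) (1 - \<gamma> + \<gamma> * real p)
      else
        (1 - \<gamma>) * sqrt (real p)
        + (if s = p then 1 - \<gamma> + \<gamma> * real p
           else min ((1 - \<gamma>) * real p * ln (1 + real p / (real p - real s)\<^sup>2))
                    (1 - \<gamma> + \<gamma> * real p)))"

lemma char_obs_law:
  fixes t \<theta> :: "nat \<Rightarrow> real"
  assumes "0 \<le> \<gamma>" "\<gamma> \<le> 1"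
  shows "(\<integral>x. iexp (\<Sum>i<p. t i * x i) \<partial>obs_law p \<gamma> \<theta>) =
     iexp (\<Sum>i<p. t i * \<theta> i) *
     complex_of_real (exp (- (\<Sum>i<p. \<Sum>j<p.
       t i * t j * ((1 - \<gamma>) * (if i = j then 1 else 0) + \<gamma>)) / 2))"
proof -
  let ?N = std_normal_distribution
  let ?Z = "PiM {..<p} (\<lambda>_. ?N)"
  let ?T = "\<Sum>i<p. t i"
  interpret N: real_distribution ?N by (rule real_dist_normal_dist)
  interpret NN: product_prob_space "\<lambda>_. ?N" "{..<p}" ..
  interpret NP: pair_prob_space ?N ?Z ..
  have ch: "(\<integral>x. iexp (a * x) \<partial>?N) = complex_of_real (exp (- (a\<^sup>2) / 2))" for a
    using fun_cong[OF char_std_normal_distribution, of a] by (simp add: char_def)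
  have meas: "(\<lambda>(w, z). \<lambda>i\<in>{..<p}. \<theta> i + sqrt \<gamma> * w + sqrt (1 - \<gamma>) * z i)
      \<in> ?N \<Otimes>\<^sub>M ?Z \<rightarrow>\<^sub>M Rvec p"
    by measurable
  have split: "(\<Sum>i<p. t i * (\<theta> i + sqrt \<gamma> * w + sqrt (1 - \<gamma>) * z i))
      = (\<Sum>i<p. t i * \<theta> i) + (sqrt \<gamma> * ?T) * w + (\<Sum>i<p. (sqrt (1 - \<gamma>) * t i) * z i)" for w z
    by (simp add: algebra_simps sum.distrib sum_distrib_left sum_distrib_right)
  have "(\<integral>x. iexp (\<Sum>i<p. t i * x i) \<partial>obs_law p \<gamma> \<theta>) =
      (\<integral>y. iexp (\<Sum>i<p. t i * (\<theta> i + sqrt \<gamma> * fst y + sqrt (1 - \<gamma>) * snd y i)) \<partial>(?N \<Otimes>\<^sub>M ?Z))"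
    unfolding obs_law_def
    by (subst integral_distr[OF meas]) (measurable, simp add: case_prod_beta)
  also have "\<dots> = (\<integral>y. iexp (\<Sum>i<p. t i * \<theta> i) * (iexp ((sqrt \<gamma> * ?T) * fst y) *
        (\<Prod>i<p. iexp ((sqrt (1 - \<gamma>) * t i) * snd y i))) \<partial>(?N \<Otimes>\<^sub>M ?Z))"
    unfolding split
    by (simp add: exp_sum[symmetric] exp_add[symmetric] ring_distribs sum_distrib_left add.assoc)
  also have "\<dots> = iexp (\<Sum>i<p. t i * \<theta> i) * (\<integral>y. iexp ((sqrt \<gamma> * ?T) * fst y) *
        (\<Prod>i<p. iexp ((sqrt (1 - \<gamma>) * t i) * snd y i)) \<partial>(?N \<Otimes>\<^sub>M ?Z))"
    by simp
  also have "(\<integral>y. iexp ((sqrt \<gamma> * ?T) * fst y) *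
        (\<Prod>i<p. iexp ((sqrt (1 - \<gamma>) * t i) * snd y i)) \<partial>(?N \<Otimes>\<^sub>M ?Z)) =
      (\<integral>w. \<integral>z. iexp ((sqrt \<gamma> * ?T) * w) * (\<Prod>i<p. iexp ((sqrt (1 - \<gamma>) * t i) * z i)) \<partial>?Z \<partial>?N)"
    by (subst NP.integral_fst'[symmetric])
       (auto intro!: NP.P.integrable_const_bound[where B = 1] simp: norm_mult prod_norm[symmetric])
  also have "\<dots> = (\<integral>w. iexp ((sqrt \<gamma> * ?T) * w) \<partial>?N) *
      (\<integral>z. (\<Prod>i<p. iexp ((sqrt (1 - \<gamma>) * t i) * z i)) \<partial>?Z)"
    by simp
  also have "(\<integral>z. (\<Prod>i<p. iexp ((sqrt (1 - \<gamma>) * t i) * z i)) \<partial>?Z) =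
      (\<Prod>i<p. \<integral>x. iexp ((sqrt (1 - \<gamma>) * t i) * x) \<partial>?N)"
    by (rule NN.product_integral_prod) (auto intro!: N.integrable_const_bound[where B = 1])
  also have "(\<integral>w. iexp ((sqrt \<gamma> * ?T) * w) \<partial>?N) * \<dots> =
      complex_of_real (exp (- (\<gamma> * ?T\<^sup>2 + (\<Sum>i<p. (1 - \<gamma>) * (t i)\<^sup>2)) / 2))"
  proof -
    have "exp (- ((sqrt \<gamma> * ?T)\<^sup>2) / 2) * (\<Prod>i<p. exp (- ((sqrt (1 - \<gamma>) * t i)\<^sup>2) / 2)) =
        exp (- (\<gamma> * ?T\<^sup>2 + (\<Sum>i<p. (1 - \<gamma>) * (t i)\<^sup>2)) / 2)"
      using assms
      by (simp add: exp_sum[symmetric] exp_add[symmetric] power_mult_distrib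
            sum_negf sum_divide_distrib[symmetric] add_divide_distrib)
    then show ?thesis
      unfolding ch by (simp only: of_real_mult[symmetric] of_real_prod[symmetric])
  qed
  also have "\<gamma> * ?T\<^sup>2 + (\<Sum>i<p. (1 - \<gamma>) * (t i)\<^sup>2) =
      (\<Sum>i<p. \<Sum>j<p. t i * t j * ((1 - \<gamma>) * (if i = j then 1 else 0) + \<gamma>))"
  proof -
    have "(\<Sum>j<p. t i * t j * ((1 - \<gamma>) * (if i = j then 1 else 0) + \<gamma>))
        = (1 - \<gamma>) * (t i)\<^sup>2 + \<gamma> * t i * ?T" if "i < p" for i
    proof -
      have "(\<Sum>j<p. t i * t j * ((1 - \<gamma>) * (if i = j then 1 else 0) + \<gamma>))
          = (\<Sum>j<p. (if i = j then (1 - \<gamma>) * (t i)\<^sup>2 else 0) + \<gamma> * t i * t j)"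
        by (intro sum.cong refl) (auto simp: algebra_simps power2_eq_square)
      then show ?thesis using that by (simp add: sum.distrib sum_distrib_left)
    qed
    moreover have "(\<Sum>i<p. \<gamma> * t i * ?T) = \<gamma> * ?T\<^sup>2"
      by (simp add: power2_eq_square mult.assoc flip: sum_distrib_left sum_distrib_right)
    ultimately show ?thesis by (simp add: sum.distrib)
  qed
  finally show ?thesis by simp
qed

end

theory Submission
  imports Defs
begin

text \<open>
  \<^bold>\<open>Upper bounds.\<close> Write \<open>v\<close> for the deviation of \<open>\<theta>\<close> from its coordinate mean \<open>m\<close>, so that
  \<open>\<parallel>\<theta>\<parallel>\<^sup>2 = \<parallel>v\<parallel>\<^sup>2 + p m\<^sup>2\<close>. Centering the observation at its own mean cancels the common factor
  \<open>W\<close>, and three rejection regions cover all cases.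
  \<^item> The centered sum of squares detects \<open>v\<close> as soon as \<open>\<parallel>v\<parallel>\<^sup>2\<close> is a large multiple of
    \<open>(1 - \<gamma>) sqrt p\<close> (\<open>chisq_alt\<close>). At sparsity \<open>s\<close> one has \<open>\<parallel>v\<parallel>\<^sup>2 \<ge> (1 - s/p) \<parallel>\<theta>\<parallel>\<^sup>2\<close>, which explains the
    term \<open>p\<^bsup>3/2\<^esup> / (p - s)\<close>.
  \<^item> The mean of the observation detects \<open>m\<close> as soon as \<open>p m\<^sup>2\<close> is a large multiple of
    \<open>1 - \<gamma> + \<gamma> p\<close> (\<open>mean_alt\<close>).
  \<^item> For \<open>k\<^sup>2 \<le> p\<close> let \<open>\<lambda>\<^sup>2 = ln (1 + p/k\<^sup>2)\<close>. The statistic \<open>\<Sum> cosh (\<lambda> (X\<^sub>i - mean X) / sqrt (1 - \<gamma>))\<close> detects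
    \<open>v\<close> when at most \<open>k\<close> coordinates carry an energy that is a large multiple of
    \<open>(1 - \<gamma>) k \<lambda>\<^sup>2\<close> (\<open>cosh_alt\<close>). For \<open>s\<close> below \<open>sqrt p\<close> these are the nonzero coordinates,
    with \<open>k = s\<close>. For \<open>s\<close> above \<open>p - sqrt p\<close> they are the \<^emph>\<open>zero\<close> coordinates, with \<open>k = p - s\<close>: unless
    the first region already detects \<open>\<theta>\<close>, almost all of \<open>\<parallel>\<theta>\<parallel>\<^sup>2\<close> is in \<open>p m\<^sup>2\<close>, and after centering a
    zero becomes a coordinate of size \<open>\<bar>m\<bar>\<close>.

  The null fluctuations of the cosh statistic are of order \<open>sqrt p \<cdot> p/k\<^sup>2\<close>, by Chebyshev. Under an
  alternative its variance may be too large for Chebyshev. Hence only the coordinates with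
  \<open>\<lambda> \<bar>v\<^sub>i\<bar> \<le> sqrt (1 - \<gamma>)\<close> outside the \<open>k\<close> special ones are treated so; the special ones contribute
  through the fact that with high probability most of their weight sits on indices with a bounded
  noise (\<open>weight_tail\<close>), and the rest is nonnegative and is dropped.

  \<^bold>\<open>Lower bounds.\<close> For a finite uniform prior \<open>\<theta>\<^sub>j = \<theta>\<^sub>0 + sqrt \<gamma> h\<^sub>j 1 + sqrt (1 - \<gamma>) u\<^sub>j\<close>, the Cameron-Martin
  formula for the pair \<open>(W, Z)\<close> and Cauchy-Schwarz bound the total variation distance between
  \<open>\<theta>\<^sub>0\<close> and the mixture by the square root of the average of \<open>exp (h\<^sub>j h\<^sub>k + \<langle>u\<^sub>j, u\<^sub>k\<rangle>) - 1\<close> over all pairs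
  (\<open>obs_law_mixture_le\<close>). A shift of all coordinates may thus be paid for in \<open>W\<close> or in \<open>Z\<close>,
  whichever is cheaper, so a shift by \<open>m\<close> is invisible while \<open>p m\<^sup>2\<close> is a small
  multiple of \<open>1 - \<gamma> + \<gamma> p\<close> (\<open>shift_split\<close>). The priors choose one coordinate in
  each of \<open>n\<close> disjoint blocks of length \<open>q\<close>, independently and uniformly, so the number of common
  choices of two draws is binomial and its exponential moments are explicit
  (\<open>avg_exp_block_vec\<close>). Putting the signal on the chosen coordinates gives the sparse rate
  (\<open>minimax_risk_ge_sparse\<close>). Putting it on all coordinates except the chosen ones
  gives the second summand of the rate (\<open>minimax_risk_ge_hidden\<close>): the constant part of this vector is absorbed
  as such a shift, and the remainder is a centered block vector.
\<close>

section \<open>Likelihood ratios of Gaussian shifts\<close>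

text \<open>The laws of \<open>Z\<close> and of \<open>(W, Z)\<close>.\<close>

abbreviation gauss_vec :: "nat \<Rightarrow> (nat \<Rightarrow> real) measure" where
  "gauss_vec p \<equiv> PiM {..<p} (\<lambda>_. std_normal_distribution)"

abbreviation gauss_pair :: "nat \<Rightarrow> (real \<times> (nat \<Rightarrow> real)) measure" where
  "gauss_pair p \<equiv> std_normal_distribution \<Otimes>\<^sub>M gauss_vec p"

lemma prob_space_std_normal: "prob_space std_normal_distribution"
  using real_dist_normal_dist by (simp add: real_distribution_def)

lemma prob_space_gauss_vec: "prob_space (gauss_vec p)"
  by (intro prob_space_PiM prob_space_std_normal)

lemma prob_space_gauss_pair: "prob_space (gauss_pair p)"
  by (intro prob_space_pair prob_space_std_normal prob_space_gauss_vec)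

lemma
  shows integrable_exp_std_normal: "integrable std_normal_distribution (\<lambda>x. exp (t * x))"
    and integral_exp_std_normal: "(\<integral>x. exp (t * x) \<partial>std_normal_distribution) = exp (t\<^sup>2 / 2)"
proof -
  have eq: "std_normal_density x * exp (t * x) = exp (t\<^sup>2 / 2) * normal_density t 1 x" for x
    by (simp add: normal_density_def exp_add[symmetric] power2_eq_square field_simps)
  have *: "has_bochner_integral lborel (\<lambda>x. std_normal_density x * exp (t * x)) (exp (t\<^sup>2 / 2) * 1)"
    unfolding eq
    by (intro has_bochner_integral_mult_right)
       (auto simp: has_bochner_integral_iff)
  show "integrable std_normal_distribution (\<lambda>x. exp (t * x))"
    using * by (subst integrable_real_density) (auto simp: has_bochner_integral_iff)
  show "(\<integral>x. exp (t * x) \<partial>std_normal_distribution) = exp (t\<^sup>2 / 2)"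
    using * by (subst integral_real_density) (auto simp: has_bochner_integral_iff)
qed

text \<open>The density of \<open>N(u, 1)\<close> with respect to \<open>N(0, 1)\<close>.\<close>

definition shift_density :: "real \<Rightarrow> real \<Rightarrow> real" where
  "shift_density u x = exp (u * x - u\<^sup>2 / 2)"

lemma shift_density_nonneg [simp]: "0 \<le> shift_density u x"
  by (simp add: shift_density_def)

lemma shift_density_measurable [measurable]: "shift_density u \<in> borel_measurable borel"
  unfolding shift_density_def[abs_def] by measurable

lemma distr_std_normal_shift:
  "distr std_normal_distribution borel (\<lambda>x. x + u) =
     density std_normal_distribution (\<lambda>x. ennreal (shift_density u x))"
proof -
  interpret prob_space std_normal_distribution by (rule prob_space_std_normal)
  have D: "distributed std_normal_distribution lborel (\<lambda>x. x) std_normal_density"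
    by (auto simp: distributed_def distr_id2 intro!: distr_id2[symmetric] )
  have "distributed std_normal_distribution lborel (\<lambda>x. u + 1 * x) (normal_density (u + 1 * 0) (\<bar>1\<bar> * 1))"
    by (rule normal_density_affine[OF D]) auto
  then have "distr std_normal_distribution lborel (\<lambda>x. x + u) = density lborel (normal_density u 1)"
    by (simp add: distributed_def add.commute)
  also have "\<dots> = density lborel (\<lambda>x. ennreal (std_normal_density x) * ennreal (shift_density u x))"
    by (intro density_cong) (auto simp: ennreal_mult[symmetric] normal_density_def shift_density_def
        exp_add[symmetric] power2_eq_square field_simps)
  also have "\<dots> = density std_normal_distribution (\<lambda>x. ennreal (shift_density u x))"
    by (subst density_density_eq) auto
  finally show ?thesis
    by (metis distr_cong sets_lborel)
qed

lemma
  shows integrable_shift_density_mult: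
      "integrable std_normal_distribution (\<lambda>x. shift_density u x * shift_density v x)"
    and integral_shift_density_mult:
      "(\<integral>x. shift_density u x * shift_density v x \<partial>std_normal_distribution) = exp (u * v)"
proof -
  have eq: "shift_density u x * shift_density v x
      = exp (- (u\<^sup>2 + v\<^sup>2) / 2) * exp ((u + v) * x)" for x
    by (simp add: shift_density_def exp_add[symmetric] field_simps)
  show "integrable std_normal_distribution (\<lambda>x. shift_density u x * shift_density v x)"
    unfolding eq by (intro integrable_mult_right integrable_exp_std_normal)
  show "(\<integral>x. shift_density u x * shift_density v x \<partial>std_normal_distribution) = exp (u * v)"
    unfolding eq integral_mult_right_zero integral_exp_std_normal
    by (simp add: exp_add[symmetric] power2_eq_square field_simps)
qed

lemma shift_density_0 [simp]: "shift_density 0 x = 1"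
  by (simp add: shift_density_def)

lemma
  shows integrable_shift_density: "integrable std_normal_distribution (shift_density u)"
    and integral_shift_density: "(\<integral>x. shift_density u x \<partial>std_normal_distribution) = 1"
  using integrable_shift_density_mult[of u 0] integral_shift_density_mult[of u 0] by simp_all

lemma prob_space_density_shift:
  "prob_space (density std_normal_distribution (\<lambda>x. ennreal (shift_density u x)))"
  unfolding distr_std_normal_shift[symmetric]
  by (intro prob_space.prob_space_distr prob_space_std_normal) auto

text \<open>The Cameron-Martin formula for the standard Gaussian vector; both sides are identified with the
  product of the shifted marginals.\<close>

lemma distr_gauss_vec_shift:
  "distr (gauss_vec p) (Rvec p) (\<lambda>z. \<lambda>i\<in>{..<p}. z i + u i) =
     density (gauss_vec p) (\<lambda>z. ennreal (\<Prod>i<p. shift_density (u i) (z i)))"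
proof -
  let ?N = std_normal_distribution
  let ?D = "\<lambda>i. density ?N (\<lambda>x. ennreal (shift_density (u i) x))"
  interpret N: product_prob_space "\<lambda>_. ?N" "{..<p}"
    by (intro product_prob_spaceI prob_space_std_normal)
  interpret D: product_prob_space ?D "{..<p}"
    by (intro product_prob_spaceI prob_space_density_shift)
  have 1: "distr (gauss_vec p) (Rvec p) (\<lambda>z. \<lambda>i\<in>{..<p}. z i + u i) = PiM {..<p} ?D"
  proof (rule D.PiM_eqI)
    fix A assume A: "\<And>i. i \<in> {..<p} \<Longrightarrow> A i \<in> sets (?D i)"
    then have A' [measurable]: "\<And>i. i \<in> {..<p} \<Longrightarrow> A i \<in> sets borel" by simp
    have B: "(\<lambda>x. x + u i) -` A i \<in> sets borel" if "i < p" for i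
      using measurable_sets[of "\<lambda>x. x + u i" borel borel "A i"] A' that by simp
    have "(\<lambda>z. \<lambda>i\<in>{..<p}. z i + u i) -` Pi\<^sub>E {..<p} A \<inter> space (gauss_vec p)
        = Pi\<^sub>E {..<p} (\<lambda>i. (\<lambda>x. x + u i) -` A i)"
      by (auto simp: space_PiM PiE_iff)
    then have "emeasure (distr (gauss_vec p) (Rvec p) (\<lambda>z. \<lambda>i\<in>{..<p}. z i + u i)) (Pi\<^sub>E {..<p} A)
        = emeasure (gauss_vec p) (Pi\<^sub>E {..<p} (\<lambda>i. (\<lambda>x. x + u i) -` A i))"
      by (subst emeasure_distr) (auto intro!: sets_PiM_I_finite A')
    also have "\<dots> = (\<Prod>i<p. emeasure ?N ((\<lambda>x. x + u i) -` A i))"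
      using B by (subst N.emeasure_PiM) auto
    also have "\<dots> = (\<Prod>i<p. emeasure (?D i) (A i))"
    proof (intro prod.cong refl)
      fix i assume "i \<in> {..<p}"
      then show "emeasure ?N ((\<lambda>x. x + u i) -` A i) = emeasure (?D i) (A i)"
        using A' unfolding distr_std_normal_shift[symmetric]
        by (subst emeasure_distr) auto
    qed
    finally show "emeasure (distr (gauss_vec p) (Rvec p) (\<lambda>z. \<lambda>i\<in>{..<p}. z i + u i)) (Pi\<^sub>E {..<p} A)
        = (\<Prod>i<p. emeasure (?D i) (A i))" .
  qed (auto cong: sets_PiM_cong)
  have 2: "density (gauss_vec p) (\<lambda>z. ennreal (\<Prod>i<p. shift_density (u i) (z i))) = PiM {..<p} ?D"
  proof (rule D.PiM_eqI)
    fix A assume A: "\<And>i. i \<in> {..<p} \<Longrightarrow> A i \<in> sets (?D i)"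
    then have A' [measurable]: "\<And>i. i \<in> {..<p} \<Longrightarrow> A i \<in> sets borel" by simp
    have "emeasure (density (gauss_vec p) (\<lambda>z. ennreal (\<Prod>i<p. shift_density (u i) (z i)))) (Pi\<^sub>E {..<p} A)
        = (\<integral>\<^sup>+z. ennreal (\<Prod>i<p. shift_density (u i) (z i)) * indicator (Pi\<^sub>E {..<p} A) z \<partial>gauss_vec p)"
      using A by (intro emeasure_density) (auto intro!: sets_PiM_I_finite)
    also have "\<dots> = (\<integral>\<^sup>+z. (\<Prod>i<p. ennreal (shift_density (u i) (z i)) * indicator (A i) (z i)) \<partial>gauss_vec p)"
    proof (intro nn_integral_cong)
      fix z assume z: "z \<in> space (gauss_vec p)"
      have "(\<Prod>i<p. ennreal (shift_density (u i) (z i)) * indicator (A i) (z i))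
          = ennreal (\<Prod>i<p. shift_density (u i) (z i)) * (\<Prod>i<p. indicator (A i) (z i))"
        by (simp add: prod.distrib prod_ennreal)
      also have "(\<Prod>i<p. indicator (A i) (z i)) = (indicator (Pi\<^sub>E {..<p} A) z :: ennreal)"
      proof (cases "z \<in> Pi\<^sub>E {..<p} A")
        case True
        then show ?thesis by (auto simp: PiE_iff intro!: prod.neutral)
      next
        case False
        then obtain i where i: "i < p" "z i \<notin> A i"
          using z by (auto simp: space_PiM PiE_iff)
        have "(\<Prod>i<p. indicator (A i) (z i)) = (0::ennreal)"
          using i by (intro prod_zero bexI[of _ i]) auto
        then show ?thesis using False by simp
      qed
      finally show "ennreal (\<Prod>i<p. shift_density (u i) (z i)) * indicator (Pi\<^sub>E {..<p} A) z
          = (\<Prod>i<p. ennreal (shift_density (u i) (z i)) * indicator (A i) (z i))" by simp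
    qed
    also have "\<dots> = (\<Prod>i<p. \<integral>\<^sup>+x. ennreal (shift_density (u i) x) * indicator (A i) x \<partial>?N)"
      by (rule N.product_nn_integral_prod) auto
    also have "\<dots> = (\<Prod>i<p. emeasure (?D i) (A i))"
      using A by (intro prod.cong refl) (subst emeasure_density, auto)
    finally show "emeasure (density (gauss_vec p) (\<lambda>z. ennreal (\<Prod>i<p. shift_density (u i) (z i)))) (Pi\<^sub>E {..<p} A)
        = (\<Prod>i<p. emeasure (?D i) (A i))" .
  qed (auto cong: sets_PiM_cong)
  show ?thesis using 1 2 by simp
qed

lemma
  fixes u v :: "nat \<Rightarrow> real"
  shows integrable_vec_shift_density_mult: "integrable (gauss_vec p)
      (\<lambda>z. (\<Prod>i<p. shift_density (u i) (z i)) * (\<Prod>i<p. shift_density (v i) (z i)))"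
    and integral_vec_shift_density_mult:
      "(\<integral>z. (\<Prod>i<p. shift_density (u i) (z i)) * (\<Prod>i<p. shift_density (v i) (z i)) \<partial>gauss_vec p)
         = exp (\<Sum>i<p. u i * v i)"
proof -
  interpret N: product_prob_space "\<lambda>_. std_normal_distribution" "{..<p}"
    by (intro product_prob_spaceI prob_space_std_normal)
  show "integrable (gauss_vec p)
      (\<lambda>z. (\<Prod>i<p. shift_density (u i) (z i)) * (\<Prod>i<p. shift_density (v i) (z i)))"
    unfolding prod.distrib[symmetric]
    by (rule N.product_integrable_prod) (auto intro: integrable_shift_density_mult)
  show "(\<integral>z. (\<Prod>i<p. shift_density (u i) (z i)) * (\<Prod>i<p. shift_density (v i) (z i)) \<partial>gauss_vec p)
         = exp (\<Sum>i<p. u i * v i)"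
    unfolding prod.distrib[symmetric]
    by (subst N.product_integral_prod)
       (auto intro: integrable_shift_density_mult simp: integral_shift_density_mult exp_sum)
qed

text \<open>The density of \<open>(W + h, Z + u)\<close> with respect to \<open>(W, Z)\<close>.\<close>

definition pair_density :: "nat \<Rightarrow> real \<Rightarrow> (nat \<Rightarrow> real) \<Rightarrow> real \<times> (nat \<Rightarrow> real) \<Rightarrow> real" where
  "pair_density p h u y = shift_density h (fst y) * (\<Prod>i<p. shift_density (u i) (snd y i))"

lemma pair_density_nonneg [simp]: "0 \<le> pair_density p h u y"
  by (simp add: pair_density_def prod_nonneg)

lemma pair_density_measurable [measurable]:
  "pair_density p h u \<in> borel_measurable (gauss_pair p)"
  unfolding pair_density_def[abs_def] by measurable

lemma distr_gauss_pair_shift: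
  "distr (gauss_pair p) (borel \<Otimes>\<^sub>M Rvec p) (\<lambda>(w, z). (w + h, \<lambda>i\<in>{..<p}. z i + u i)) =
     density (gauss_pair p) (\<lambda>y. ennreal (pair_density p h u y))"
proof -
  interpret D: prob_space "distr (gauss_vec p) (Rvec p) (\<lambda>z. \<lambda>i\<in>{..<p}. z i + u i)"
    by (intro prob_space.prob_space_distr prob_space_gauss_vec) auto
  interpret Z: prob_space "gauss_vec p" by (rule prob_space_gauss_vec)
  have "distr (gauss_pair p) (borel \<Otimes>\<^sub>M Rvec p) (\<lambda>(w, z). (w + h, \<lambda>i\<in>{..<p}. z i + u i))
      = distr std_normal_distribution borel (\<lambda>w. w + h) \<Otimes>\<^sub>M
        distr (gauss_vec p) (Rvec p) (\<lambda>z. \<lambda>i\<in>{..<p}. z i + u i)"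
    by (rule pair_measure_distr[symmetric]) (auto intro: D.sigma_finite_measure)
  also have "\<dots> = density (gauss_pair p) (\<lambda>(w, z). ennreal (shift_density h w) * ennreal (\<Prod>i<p. shift_density (u i) (z i)))"
    using D.sigma_finite_measure_axioms unfolding distr_std_normal_shift distr_gauss_vec_shift
    by (intro pair_measure_density) (auto intro: Z.sigma_finite_measure_axioms)
  also have "\<dots> = density (gauss_pair p) (\<lambda>y. ennreal (pair_density p h u y))"
    by (intro arg_cong[where f = "density _"] ext)
       (auto simp: pair_density_def ennreal_mult prod_nonneg split: prod.split)
  finally show ?thesis .
qed

lemma
  shows integrable_pair_density_mult:
      "integrable (gauss_pair p) (\<lambda>y. pair_density p h u y * pair_density p k v y)"
    and integral_pair_density_mult:
      "(\<integral>y. pair_density p h u y * pair_density p k v y \<partial>gauss_pair p)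
         = exp (h * k + (\<Sum>i<p. u i * v i))"
proof -
  interpret W: prob_space std_normal_distribution by (rule prob_space_std_normal)
  interpret Z: prob_space "gauss_vec p" by (rule prob_space_gauss_vec)
  interpret P: pair_sigma_finite std_normal_distribution "gauss_vec p" ..
  have eq: "pair_density p h u y * pair_density p k v y =
     (shift_density h (fst y) * shift_density k (fst y)) *
     ((\<Prod>i<p. shift_density (u i) (snd y i)) * (\<Prod>i<p. shift_density (v i) (snd y i)))" for y
    by (simp add: pair_density_def)
  show I: "integrable (gauss_pair p) (\<lambda>y. pair_density p h u y * pair_density p k v y)"
    unfolding eq
    by (rule P.Fubini_integrable)
       (auto simp: abs_mult abs_prod integral_vec_shift_density_mult
         intro!: integrable_shift_density_mult integrable_vec_shift_density_mult)
  show "(\<integral>y. pair_density p h u y * pair_density p k v y \<partial>gauss_pair p)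
         = exp (h * k + (\<Sum>i<p. u i * v i))"
    using I unfolding eq
    by (subst P.integral_fst'[symmetric])
       (auto simp: integral_shift_density_mult integral_vec_shift_density_mult exp_add)
qed

lemma pair_density_0 [simp]: "pair_density p 0 (\<lambda>_. 0) y = 1"
  by (simp add: pair_density_def)

lemma
  shows integrable_pair_density: "integrable (gauss_pair p) (pair_density p h u)"
    and integral_pair_density: "(\<integral>y. pair_density p h u y \<partial>gauss_pair p) = 1"
  using integrable_pair_density_mult[of p h u 0 "\<lambda>_. 0"]
    integral_pair_density_mult[of p h u 0 "\<lambda>_. 0"] by simp_all

text \<open>The observation as a function of \<open>(W, Z)\<close>.\<close>

definition obs_map :: "nat \<Rightarrow> real \<Rightarrow> (nat \<Rightarrow> real) \<Rightarrow> real \<times> (nat \<Rightarrow> real) \<Rightarrow> nat \<Rightarrow> real" where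
  "obs_map p \<gamma> \<theta> = (\<lambda>(w, z). \<lambda>i\<in>{..<p}. \<theta> i + sqrt \<gamma> * w + sqrt (1 - \<gamma>) * z i)"

lemma obs_map_measurable [measurable]:
  "obs_map p \<gamma> \<theta> \<in> borel \<Otimes>\<^sub>M Rvec p \<rightarrow>\<^sub>M Rvec p"
  unfolding obs_map_def by measurable

lemma sets_gauss_pair [measurable_cong]: "sets (gauss_pair p) = sets (borel \<Otimes>\<^sub>M Rvec p)"
  by (intro sets_pair_measure_cong sets_PiM_cong) auto

lemma obs_law_eq_distr: "obs_law p \<gamma> \<theta> = distr (gauss_pair p) (Rvec p) (obs_map p \<gamma> \<theta>)"
  by (simp add: obs_law_def obs_map_def)

lemma measure_obs_law:
  assumes "A \<in> sets (Rvec p)"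
  shows "measure (obs_law p \<gamma> \<theta>) A = measure (gauss_pair p) {y \<in> space (gauss_pair p). obs_map p \<gamma> \<theta> y \<in> A}"
  unfolding obs_law_eq_distr using assms
  by (subst measure_distr) (auto intro!: arg_cong[where f = "measure _"])

lemma prob_space_obs_law: "prob_space (obs_law p \<gamma> \<theta>)"
  unfolding obs_law_eq_distr
  by (intro prob_space.prob_space_distr prob_space_gauss_pair) measurable

text \<open>A translation of the signal that is split into a part \<open>h\<close> absorbed by \<open>W\<close> and a part \<open>u\<close> absorbed
  by \<open>Z\<close> amounts to a change of density on the space of \<open>(W, Z)\<close>.\<close>

lemma measure_obs_law_shift:
  assumes A [measurable]: "A \<in> sets (Rvec p)"
    and \<theta>: "\<And>i. i < p \<Longrightarrow> \<theta> i = \<theta>\<^sub>0 i + sqrt \<gamma> * h + sqrt (1 - \<gamma>) * u i"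
  shows "measure (obs_law p \<gamma> \<theta>) A =
     (\<integral>y. indicator {y \<in> space (gauss_pair p). obs_map p \<gamma> \<theta>\<^sub>0 y \<in> A} y * pair_density p h u y \<partial>gauss_pair p)"
proof -
  let ?T = "\<lambda>(w, z). (w + h, \<lambda>i\<in>{..<p}. z i + u i)"
  let ?B = "{y \<in> space (gauss_pair p). obs_map p \<gamma> \<theta>\<^sub>0 y \<in> A}"
  have sp: "space (gauss_pair p) = space (borel \<Otimes>\<^sub>M Rvec p)"
    by (simp add: space_pair_measure space_PiM)
  have B: "?B \<in> sets (gauss_pair p)" by measurable
  have T: "?T \<in> gauss_pair p \<rightarrow>\<^sub>M borel \<Otimes>\<^sub>M Rvec p" by measurable
  have eq: "obs_map p \<gamma> \<theta> y = obs_map p \<gamma> \<theta>\<^sub>0 (?T y)" for y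
    by (auto simp: obs_map_def \<theta> algebra_simps split: prod.split)
  have "measure (obs_law p \<gamma> \<theta>) A = measure (gauss_pair p) (?T -` ?B \<inter> space (gauss_pair p))"
    unfolding measure_obs_law[OF A]
    using measurable_space[OF T] sp
    by (intro arg_cong[where f = "measure _"]) (auto simp: eq)
  also have "\<dots> = measure (distr (gauss_pair p) (borel \<Otimes>\<^sub>M Rvec p) ?T) ?B"
    using B unfolding sets_gauss_pair by (intro measure_distr[symmetric] T)
  also have "\<dots> = measure (density (gauss_pair p) (\<lambda>y. ennreal (pair_density p h u y))) ?B"
    by (simp only: distr_gauss_pair_shift)
  also have "\<dots> = (\<integral>y. indicator ?B y * pair_density p h u y \<partial>gauss_pair p)"
  proof -
    have "emeasure (density (gauss_pair p) (\<lambda>y. ennreal (pair_density p h u y))) ?B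
        = (\<integral>\<^sup>+y. ennreal (indicator ?B y * pair_density p h u y) \<partial>gauss_pair p)"
      using B by (subst emeasure_density) (auto intro!: nn_integral_cong split: split_indicator)
    also have "\<dots> = ennreal (\<integral>y. indicator ?B y * pair_density p h u y \<partial>gauss_pair p)"
      using B by (intro nn_integral_eq_integral integrable_mult_indicator[where 'b=real, simplified]
          integrable_pair_density) auto
    finally show ?thesis
      by (simp add: measure_def)
  qed
  finally show ?thesis .
qed

text \<open>The second-moment bound for mixtures: the right-hand side is the \<open>L\<^sup>2\<close> distance between \<open>1\<close> and the
  average of the densities \<open>L j\<close>.\<close>

lemma (in prob_space) prob_diff_mixture_le:
  fixes L :: "'j \<Rightarrow> 'a \<Rightarrow> real"
  assumes J: "finite J" "J \<noteq> {}" and A: "A \<in> events"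
    and L1: "\<And>j. j \<in> J \<Longrightarrow> integrable M (L j)" "\<And>j. j \<in> J \<Longrightarrow> expectation (L j) = 1"
    and L2: "\<And>j k. j \<in> J \<Longrightarrow> k \<in> J \<Longrightarrow> integrable M (\<lambda>x. L j x * L k x)"
  shows "prob A - (\<Sum>j\<in>J. expectation (\<lambda>x. indicator A x * L j x)) / card J
    \<le> sqrt ((\<Sum>j\<in>J. \<Sum>k\<in>J. expectation (\<lambda>x. L j x * L k x)) / (card J)\<^sup>2 - 1)"
proof -
  define m where "m = real (card J)"
  have m: "m > 0" using J by (simp add: m_def card_gt_0_iff)
  define D where "D x = 1 - (\<Sum>j\<in>J. L j x) / m" for x
  have Dint: "integrable M D"
    unfolding D_def[abs_def] using L1 by auto
  have D2: "(D x)\<^sup>2 = 1 - 2 * (\<Sum>j\<in>J. L j x) / m + (\<Sum>j\<in>J. \<Sum>k\<in>J. L j x * L k x) / m\<^sup>2" for x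
    using m by (simp add: D_def power2_eq_square sum_product field_simps)
  have D2int: "integrable M (\<lambda>x. (D x)\<^sup>2)"
    unfolding D2 using L1 L2 by (intro Bochner_Integration.integrable_add Bochner_Integration.integrable_diff) auto
  have D2exp: "expectation (\<lambda>x. (D x)\<^sup>2) = (\<Sum>j\<in>J. \<Sum>k\<in>J. expectation (\<lambda>x. L j x * L k x)) / m\<^sup>2 - 1"
  proof -
    have "expectation (\<lambda>x. (D x)\<^sup>2) = 1 - 2 * (\<Sum>j\<in>J. expectation (L j)) / m
        + (\<Sum>j\<in>J. \<Sum>k\<in>J. expectation (\<lambda>x. L j x * L k x)) / m\<^sup>2"
      unfolding D2 using L1 L2
      by (subst Bochner_Integration.integral_add, simp_all add: prob_space)
    moreover have "(\<Sum>j\<in>J. expectation (L j)) = m" using L1 by (simp add: m_def)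
    ultimately show ?thesis using m by simp
  qed
  have LA: "integrable M (\<lambda>x. indicator A x * L j x)" if "j \<in> J" for j
    using integrable_mult_indicator[OF A L1(1)[OF that]] by simp
  have DA: "integrable M (\<lambda>x. indicator A x * D x)"
    using integrable_mult_indicator[OF A Dint] by simp
  have "prob A - (\<Sum>j\<in>J. expectation (\<lambda>x. indicator A x * L j x)) / m
      = expectation (\<lambda>x. indicator A x * D x)"
  proof -
    have "indicator A x * D x = indicator A x - (\<Sum>j\<in>J. indicator A x * L j x) / m" for x
      by (simp add: D_def algebra_simps sum_distrib_left)
    moreover have "integrable M (\<lambda>x. (\<Sum>j\<in>J. indicator A x * L j x) / m)"
      using LA by auto
    moreover have "integrable M (indicator A :: 'a \<Rightarrow> real)"
      using A by (intro integrable_real_indicator) (auto simp: emeasure_eq_measure)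
    ultimately show ?thesis using LA A
      by (simp add: Bochner_Integration.integral_diff Bochner_Integration.integral_sum)
  qed
  also have "\<dots> \<le> expectation (\<lambda>x. \<bar>D x\<bar>)"
    using DA Dint by (intro integral_mono) (auto split: split_indicator)
  also have "\<dots> \<le> sqrt (expectation (\<lambda>x. (D x)\<^sup>2))"
  proof (rule real_le_rsqrt)
    have "0 \<le> variance (\<lambda>x. \<bar>D x\<bar>)" by (rule variance_positive)
    also have "\<dots> = expectation (\<lambda>x. \<bar>D x\<bar>\<^sup>2) - (expectation (\<lambda>x. \<bar>D x\<bar>))\<^sup>2"
      using Dint D2int by (intro variance_eq) auto
    finally show "(expectation (\<lambda>x. \<bar>D x\<bar>))\<^sup>2 \<le> expectation (\<lambda>x. (D x)\<^sup>2)" by simp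
  qed
  finally show ?thesis by (simp add: D2exp m_def)
qed

lemma obs_law_mixture_le:
  assumes J: "finite J" "J \<noteq> {}" and A: "A \<in> sets (Rvec p)"
    and \<theta>: "\<And>j i. j \<in> J \<Longrightarrow> i < p \<Longrightarrow> \<theta> j i = \<theta>\<^sub>0 i + sqrt \<gamma> * h j + sqrt (1 - \<gamma>) * u j i"
  shows "measure (obs_law p \<gamma> \<theta>\<^sub>0) A - (\<Sum>j\<in>J. measure (obs_law p \<gamma> (\<theta> j)) A) / card J
    \<le> sqrt ((\<Sum>j\<in>J. \<Sum>k\<in>J. exp (h j * h k + (\<Sum>i<p. u j i * u k i))) / (card J)\<^sup>2 - 1)"
proof -
  interpret prob_space "gauss_pair p" by (rule prob_space_gauss_pair)
  let ?B = "{y \<in> space (gauss_pair p). obs_map p \<gamma> \<theta>\<^sub>0 y \<in> A}"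
  note A[measurable]
  have B: "?B \<in> sets (gauss_pair p)" by measurable
  have "prob ?B - (\<Sum>j\<in>J. expectation (\<lambda>x. indicator ?B x * pair_density p (h j) (u j) x)) / card J
    \<le> sqrt ((\<Sum>j\<in>J. \<Sum>k\<in>J. expectation (\<lambda>x. pair_density p (h j) (u j) x * pair_density p (h k) (u k) x)) / (card J)\<^sup>2 - 1)"
    by (rule prob_diff_mixture_le[OF J B])
       (simp_all add: integrable_pair_density integral_pair_density integrable_pair_density_mult)
  moreover have "(\<Sum>j\<in>J. measure (obs_law p \<gamma> (\<theta> j)) A) =
      (\<Sum>j\<in>J. expectation (\<lambda>x. indicator ?B x * pair_density p (h j) (u j) x))"
    by (intro sum.cong refl measure_obs_law_shift[OF A] \<theta>)
  ultimately show ?thesis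
    by (simp add: measure_obs_law[OF A] integral_pair_density_mult)
qed

section \<open>Block priors\<close>

text \<open>The first \<open>n * q\<close> coordinates are cut into \<open>n\<close> blocks of length \<open>q\<close>. The choice \<open>j\<close> marks the
  coordinate \<open>j b\<close> in block \<open>b\<close>, and the vector is the indicator of the marked coordinates minus the constant
  \<open>\<beta>\<close> on the blocks. The coordinates outside the blocks are \<open>0\<close>. The two uses are \<open>\<beta> = 0\<close> and \<open>\<beta> = 1 / q\<close>;
  the latter makes every block sum vanish, whether or not \<open>q * n = p\<close>.\<close>

definition block_vec :: "nat \<Rightarrow> nat \<Rightarrow> real \<Rightarrow> (nat \<Rightarrow> nat) \<Rightarrow> nat \<Rightarrow> real" where
  "block_vec n q \<beta> j i = (if i < n * q then of_bool (j (i div q) = i mod q) - \<beta> else 0)"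

lemma sum_blocks:
  fixes f :: "nat \<Rightarrow> real"
  assumes "0 < q" "n * q \<le> p" "\<And>i. n * q \<le> i \<Longrightarrow> f i = 0"
  shows "(\<Sum>i<p. f i) = (\<Sum>b<n. \<Sum>t<q. f (b * q + t))"
proof -
  have "(\<Sum>i<p. f i) = (\<Sum>i<n * q. f i)"
    using assms by (intro sum.mono_neutral_right) auto
  also have "\<dots> = (\<Sum>b<n. sum f {b * q..<b * q + q})"
    by (rule sum.nat_group[symmetric])
  also have "\<dots> = (\<Sum>b<n. \<Sum>t<q. f (b * q + t))"
  proof (rule sum.cong[OF refl])
    show "sum f {b * q..<b * q + q} = (\<Sum>t<q. f (b * q + t))" for b
      by (rule sum.reindex_bij_witness[where i = "\<lambda>t. b * q + t" and j = "\<lambda>i. i - b * q"]) auto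
  qed
  finally show ?thesis .
qed

lemma block_vec_at:
  assumes "b < n" "t < q"
  shows "block_vec n q \<beta> j (b * q + t) = of_bool (j b = t) - \<beta>"
proof -
  have "b * q + t < n * q"
  proof -
    have "b * q + t < (b + 1) * q" using assms by simp
    also have "\<dots> \<le> n * q" using assms by (intro mult_le_mono1) simp
    finally show ?thesis .
  qed
  then show ?thesis using assms by (simp add: block_vec_def)
qed

lemma sum_block_vec:
  assumes "0 < q" "n * q \<le> p" "j \<in> {..<n} \<rightarrow>\<^sub>E {..<q}"
  shows "(\<Sum>i<p. block_vec n q \<beta> j i) = n * (1 - q * \<beta>)"
proof -
  have "(\<Sum>i<p. block_vec n q \<beta> j i) = (\<Sum>b<n. \<Sum>t<q. block_vec n q \<beta> j (b * q + t))"
    using assms by (intro sum_blocks) (auto simp: block_vec_def)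
  also have "\<dots> = (\<Sum>b<n. 1 - q * \<beta>)"
  proof (intro sum.cong refl)
    fix b assume b: "b \<in> {..<n}"
    then have "j b < q" using assms by auto
    have "(\<Sum>t<q. block_vec n q \<beta> j (b * q + t)) = (\<Sum>t<q. of_bool (j b = t) - \<beta>)"
      using b by (intro sum.cong refl) (simp add: block_vec_at)
    also have "\<dots> = 1 - q * \<beta>"
      using \<open>j b < q\<close> by (simp add: sum_subtractf of_bool_def)
    finally show "(\<Sum>t<q. block_vec n q \<beta> j (b * q + t)) = 1 - q * \<beta>" .
  qed
  finally show ?thesis by simp
qed

lemma inner_block_vec:
  assumes "0 < q" "n * q \<le> p" "j \<in> {..<n} \<rightarrow>\<^sub>E {..<q}" "k \<in> {..<n} \<rightarrow>\<^sub>E {..<q}"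
  shows "(\<Sum>i<p. block_vec n q \<beta> j i * block_vec n q \<beta> k i) =
    (\<Sum>b<n. of_bool (j b = k b) - (2 * \<beta> - q * \<beta>\<^sup>2))"
proof -
  have "(\<Sum>i<p. block_vec n q \<beta> j i * block_vec n q \<beta> k i)
      = (\<Sum>b<n. \<Sum>t<q. block_vec n q \<beta> j (b * q + t) * block_vec n q \<beta> k (b * q + t))"
    using assms by (intro sum_blocks) (auto simp: block_vec_def)
  also have "\<dots> = (\<Sum>b<n. of_bool (j b = k b) - (2 * \<beta> - q * \<beta>\<^sup>2))"
  proof (intro sum.cong refl)
    fix b assume b: "b \<in> {..<n}"
    then have "j b < q" "k b < q" using assms by auto
    have "(\<Sum>t<q. block_vec n q \<beta> j (b * q + t) * block_vec n q \<beta> k (b * q + t))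
       = (\<Sum>t<q. of_bool (j b = t) * of_bool (k b = t) - \<beta> * of_bool (j b = t) - \<beta> * of_bool (k b = t) + \<beta>\<^sup>2)"
    proof (intro sum.cong refl)
      fix t assume t: "t \<in> {..<q}"
      show "block_vec n q \<beta> j (b * q + t) * block_vec n q \<beta> k (b * q + t)
        = of_bool (j b = t) * of_bool (k b = t) - \<beta> * of_bool (j b = t) - \<beta> * of_bool (k b = t) + \<beta>\<^sup>2"
        using b t unfolding block_vec_at[of b n t q, OF b[unfolded lessThan_iff] t[unfolded lessThan_iff]]
        by (simp add: power2_eq_square algebra_simps)
    qed
    also have "\<dots> = (\<Sum>t<q. of_bool (j b = t) * of_bool (k b = t)) - \<beta> * (\<Sum>t<q. of_bool (j b = t))
        - \<beta> * (\<Sum>t<q. of_bool (k b = t)) + q * \<beta>\<^sup>2"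
      by (simp add: sum.distrib sum_subtractf sum_distrib_left)
    also have "(\<Sum>t<q. of_bool (j b = t)) = (1::real)"
      using \<open>j b < q\<close> by (simp add: of_bool_def)
    also have "(\<Sum>t<q. of_bool (k b = t)) = (1::real)"
      using \<open>k b < q\<close> by (simp add: of_bool_def)
    also have "(\<Sum>t<q. of_bool (j b = t) * of_bool (k b = t)) = (\<Sum>t<q. if j b = t then of_bool (k b = j b) else (0::real))"
      by (intro sum.cong) auto
    also have "\<dots> = of_bool (j b = k b)"
      using \<open>j b < q\<close> by (simp add: eq_commute)
    finally show "(\<Sum>t<q. block_vec n q \<beta> j (b * q + t) * block_vec n q \<beta> k (b * q + t))
       = of_bool (j b = k b) - (2 * \<beta> - q * \<beta>\<^sup>2)" by (simp add: algebra_simps)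
  qed
  finally show ?thesis .
qed

text \<open>For two independent uniform choices the inner product is, up to a constant, binomial with parameters
  \<open>n\<close> and \<open>1 / q\<close>; this is its moment generating function, with \<open>1 + y \<le> exp y\<close> applied in each block.\<close>

lemma avg_exp_block_vec:
  fixes x c \<beta> :: real
  assumes "0 < q" "n * q \<le> p"
  defines "J \<equiv> {..<n} \<rightarrow>\<^sub>E {..<q}"
  shows "(\<Sum>j\<in>J. \<Sum>k\<in>J. exp (c + x * (\<Sum>i<p. block_vec n q \<beta> j i * block_vec n q \<beta> k i))) / (card J)\<^sup>2
    \<le> exp (c + n * ((exp x - 1) / q - x * (2 * \<beta> - q * \<beta>\<^sup>2)))"
proof -
  define \<beta>' where "\<beta>' = 2 * \<beta> - q * \<beta>\<^sup>2"
  have cJ: "real (card J) = real q ^ n"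
    by (simp add: J_def card_PiE)
  have q: "real q > 0" using assms by simp
  have inner: "(\<Sum>j\<in>J. exp (x * (\<Sum>i<p. block_vec n q \<beta> j i * block_vec n q \<beta> k i)))
      = (exp (- x * \<beta>') * (exp x + q - 1)) ^ n" if k: "k \<in> J" for k
  proof -
    have "(\<Sum>j\<in>J. exp (x * (\<Sum>i<p. block_vec n q \<beta> j i * block_vec n q \<beta> k i)))
        = (\<Sum>j\<in>J. \<Prod>b<n. exp (x * (of_bool (j b = k b) - \<beta>')))"
      using k assms
      by (intro sum.cong refl) (simp add: inner_block_vec \<beta>'_def sum_distrib_left exp_sum)
    also have "\<dots> = (\<Prod>b<n. \<Sum>t<q. exp (x * (of_bool (t = k b) - \<beta>')))"
      unfolding J_def by (rule prod_sum_PiE[symmetric]) auto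
    also have "\<dots> = (\<Prod>b<n. exp (- x * \<beta>') * (exp x + q - 1))"
    proof (intro prod.cong refl)
      fix b assume "b \<in> {..<n}"
      then have kb: "k b < q" using k by (auto simp: J_def)
      have "(\<Sum>t<q. exp (x * (of_bool (t = k b) - \<beta>')))
          = (\<Sum>t<q. exp (- x * \<beta>') + (if t = k b then exp (- x * \<beta>') * (exp x - 1) else 0))"
        by (intro sum.cong refl) (auto simp: algebra_simps exp_add exp_diff exp_minus divide_inverse)
      also have "\<dots> = exp (- x * \<beta>') * (exp x + q - 1)"
        using kb by (simp add: sum.distrib algebra_simps)
      finally show "(\<Sum>t<q. exp (x * (of_bool (t = k b) - \<beta>'))) = exp (- x * \<beta>') * (exp x + q - 1)" .
    qed
    finally show ?thesis by simp
  qed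
  have "(\<Sum>j\<in>J. \<Sum>k\<in>J. exp (c + x * (\<Sum>i<p. block_vec n q \<beta> j i * block_vec n q \<beta> k i)))
      = exp c * (\<Sum>k\<in>J. \<Sum>j\<in>J. exp (x * (\<Sum>i<p. block_vec n q \<beta> j i * block_vec n q \<beta> k i)))"
    by (subst sum.swap) (simp add: exp_add sum_distrib_left)
  also have "\<dots> = exp c * (q ^ n * (exp (- x * \<beta>') * (exp x + q - 1)) ^ n)"
    by (simp add: inner cJ)
  finally have "(\<Sum>j\<in>J. \<Sum>k\<in>J. exp (c + x * (\<Sum>i<p. block_vec n q \<beta> j i * block_vec n q \<beta> k i))) / (card J)\<^sup>2
      = exp c * ((exp (- x * \<beta>') * (exp x + q - 1)) / q) ^ n"
    using q by (simp add: cJ power2_eq_square power_divide)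
  also have "(exp (- x * \<beta>') * (exp x + q - 1)) / q = exp (- x * \<beta>') * (1 + (exp x - 1) / q)"
    using q by (simp add: field_simps)
  also have "exp c * (exp (- x * \<beta>') * (1 + (exp x - 1) / q)) ^ n
      \<le> exp c * (exp (- x * \<beta>') * exp ((exp x - 1) / q)) ^ n"
  proof -
    have "1 \<le> real q" using assms(1) by simp
    then have "0 \<le> 1 + (exp x - 1) / q"
      using exp_gt_zero[of x] by (simp add: field_simps add_increasing2)
    then show ?thesis
      by (intro mult_left_mono power_mono exp_ge_add_one_self) auto
  qed
  also have "\<dots> = exp (c + n * ((exp x - 1) / q - x * \<beta>'))"
    by (simp add: exp_add[symmetric] exp_of_nat_mult[symmetric] algebra_simps)
  finally show ?thesis by (simp add: \<beta>'_def)
qed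

text \<open>The worst case over the alternative dominates the average over any finite family in it.\<close>

lemma minimax_risk_ge:
  assumes J: "finite J" "J \<noteq> {}"
    and \<theta>: "\<And>j. j \<in> J \<Longrightarrow> \<theta> j \<in> sparse_alt p s \<epsilon>"
    and d: "\<And>A. A \<in> sets (Rvec p) \<Longrightarrow>
      measure (obs_law p \<gamma> (\<lambda>i\<in>{..<p}. 0)) A - (\<Sum>j\<in>J. measure (obs_law p \<gamma> (\<theta> j)) A) / card J \<le> d"
  shows "1 - d \<le> minimax_risk p s \<gamma> \<epsilon>"
  unfolding minimax_risk_def
proof (rule cINF_greatest)
  have "(\<lambda>_. 0) \<in> tests p" by (simp add: tests_def)
  then show "tests p \<noteq> {}" by blast
next
  fix \<phi> assume \<phi>: "\<phi> \<in> tests p"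
  let ?A = "{x \<in> space (Rvec p). \<phi> x = 0}"
  have m [measurable]: "\<phi> \<in> Rvec p \<rightarrow>\<^sub>M count_space {0, 1}" using \<phi> by (simp add: tests_def)
  have A: "?A \<in> sets (Rvec p)" by measurable
  interpret P: prob_space "obs_law p \<gamma> \<theta>'" for \<theta>' by (rule prob_space_obs_law)
  have sp: "space (obs_law p \<gamma> \<theta>') = space (Rvec p)" "sets (obs_law p \<gamma> \<theta>') = sets (Rvec p)" for \<theta>'
    by (simp_all add: obs_law_def)
  have "{x \<in> space (Rvec p). \<phi> x = 1} = space (Rvec p) - ?A"
    using measurable_space[OF m] by fastforce
  then have 0: "measure (obs_law p \<gamma> (\<lambda>i\<in>{..<p}. 0)) {x \<in> space (Rvec p). \<phi> x = 1}
      = 1 - measure (obs_law p \<gamma> (\<lambda>i\<in>{..<p}. 0)) ?A"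
    using P.prob_compl[of ?A] A by (simp add: sp)
  let ?S = "SUP \<theta>\<in>sparse_alt p s \<epsilon>. measure (obs_law p \<gamma> \<theta>) ?A"
  have "measure (obs_law p \<gamma> (\<theta> j)) ?A \<le> ?S" if "j \<in> J" for j
    by (intro cSUP_upper \<theta> that bdd_aboveI[of _ 1]) auto
  then have "(\<Sum>j\<in>J. measure (obs_law p \<gamma> (\<theta> j)) ?A) \<le> card J * ?S"
    using sum_bounded_above[of J "\<lambda>j. measure (obs_law p \<gamma> (\<theta> j)) ?A" ?S] by simp
  then have "(\<Sum>j\<in>J. measure (obs_law p \<gamma> (\<theta> j)) ?A) / card J \<le> ?S"
    using J by (simp add: field_simps card_gt_0_iff)
  with d[OF A] 0 show "1 - d \<le> measure (obs_law p \<gamma> (\<lambda>i\<in>{..<p}. 0)) {x \<in> space (Rvec p). \<phi> x = 1} + ?S"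
    by simp
qed

text \<open>The priors used below: a deterministic shift by \<open>h\<close> in \<open>W\<close> and \<open>g\<close> in every coordinate of \<open>Z\<close>, plus a
  block vector. If \<open>g \<noteq> 0\<close> the block vectors are required to be centered, so that no cross terms appear.\<close>

lemma minimax_risk_ge_block_prior:
  fixes h g \<alpha> \<beta> :: real
  assumes q: "0 < q" "n * q \<le> p" and g: "g = 0 \<or> q * \<beta> = 1"
    and \<gamma>: "0 \<le> \<gamma>" "\<gamma> \<le> 1"
    and alt: "\<And>j. j \<in> {..<n} \<rightarrow>\<^sub>E {..<q} \<Longrightarrow>
      (\<lambda>i\<in>{..<p}. sqrt \<gamma> * h + sqrt (1 - \<gamma>) * (g + \<alpha> * block_vec n q \<beta> j i)) \<in> sparse_alt p s \<epsilon>"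
    and D: "h\<^sup>2 + p * g\<^sup>2 + n * ((exp (\<alpha>\<^sup>2) - 1) / q - \<alpha>\<^sup>2 * (2 * \<beta> - q * \<beta>\<^sup>2)) \<le> D"
  shows "1 - sqrt (exp D - 1) \<le> minimax_risk p s \<gamma> \<epsilon>"
proof (rule minimax_risk_ge[OF _ _ alt])
  let ?J = "{..<n} \<rightarrow>\<^sub>E {..<q}"
  show "finite ?J" by (intro finite_PiE) auto
  show "?J \<noteq> {}" using q by (simp add: PiE_eq_empty_iff lessThan_empty_iff)
  fix A assume A: "A \<in> sets (Rvec p)"
  let ?u = "\<lambda>j i. g + \<alpha> * block_vec n q \<beta> j i"
  have eq: "(\<Sum>j\<in>?J. \<Sum>k\<in>?J. exp (h * h + (\<Sum>i<p. ?u j i * ?u k i)))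
      = (\<Sum>j\<in>?J. \<Sum>k\<in>?J. exp ((h\<^sup>2 + p * g\<^sup>2) + \<alpha>\<^sup>2 * (\<Sum>i<p. block_vec n q \<beta> j i * block_vec n q \<beta> k i)))"
  proof (intro sum.cong refl)
    fix j k assume jk: "j \<in> ?J" "k \<in> ?J"
    have "(\<Sum>i<p. ?u j i * ?u k i) = p * g\<^sup>2 + g * \<alpha> * (\<Sum>i<p. block_vec n q \<beta> j i)
        + g * \<alpha> * (\<Sum>i<p. block_vec n q \<beta> k i)
        + \<alpha>\<^sup>2 * (\<Sum>i<p. block_vec n q \<beta> j i * block_vec n q \<beta> k i)"
      by (simp add: sum_distrib_left sum.distrib[symmetric] algebra_simps power2_eq_square
            flip: sum_distrib_left) (simp add: sum.distrib sum_distrib_left algebra_simps)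
    also have "\<dots> = p * g\<^sup>2 + \<alpha>\<^sup>2 * (\<Sum>i<p. block_vec n q \<beta> j i * block_vec n q \<beta> k i)"
      using g jk q by (auto simp: sum_block_vec)
    finally show "exp (h * h + (\<Sum>i<p. ?u j i * ?u k i)) = exp ((h\<^sup>2 + p * g\<^sup>2) + \<alpha>\<^sup>2 * (\<Sum>i<p. block_vec n q \<beta> j i * block_vec n q \<beta> k i))"
      by (simp add: power2_eq_square)
  qed
  have "measure (obs_law p \<gamma> (\<lambda>i\<in>{..<p}. 0)) A -
      (\<Sum>j\<in>?J. measure (obs_law p \<gamma> (\<lambda>i\<in>{..<p}. sqrt \<gamma> * h + sqrt (1 - \<gamma>) * ?u j i)) A) / card ?J
    \<le> sqrt ((\<Sum>j\<in>?J. \<Sum>k\<in>?J. exp (h * h + (\<Sum>i<p. ?u j i * ?u k i))) / (card ?J)\<^sup>2 - 1)"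
    using \<open>finite ?J\<close> \<open>?J \<noteq> {}\<close> A
    by (rule obs_law_mixture_le[where h = "\<lambda>_. h"]) simp
  also have "\<dots> \<le> sqrt (exp D - 1)"
    unfolding eq using avg_exp_block_vec[OF q, of "h\<^sup>2 + p * g\<^sup>2" "\<alpha>\<^sup>2" \<beta>] D
    by (intro real_sqrt_le_mono diff_right_mono) (simp, meson exp_le_cancel_iff order_trans)
  finally show "measure (obs_law p \<gamma> (\<lambda>i\<in>{..<p}. 0)) A -
      (\<Sum>j\<in>?J. measure (obs_law p \<gamma> (\<lambda>i\<in>{..<p}. sqrt \<gamma> * h + sqrt (1 - \<gamma>) * ?u j i)) A) / card ?J
    \<le> sqrt (exp D - 1)" .
qed

section \<open>Lower bounds on the minimax risk\<close>

lemma exp_le_of_le_mult_ln: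
  fixes x c L :: real
  assumes "0 \<le> c" "c \<le> 1" "0 \<le> L" "x \<le> c * ln (1 + L)"
  shows "exp x - 1 \<le> c * L"
proof -
  have "exp x \<le> exp ((1 - c) *\<^sub>R 0 + c *\<^sub>R ln (1 + L))" using assms by simp
  also have "\<dots> \<le> (1 - c) * exp 0 + c * exp (ln (1 + L))"
    by (rule convex_onD[OF exp_convex]) (use assms in auto)
  also have "\<dots> = 1 + c * L" using assms by (simp add: algebra_simps)
  finally show ?thesis by simp
qed

lemma inverse_div_le:
  fixes n p :: nat
  assumes "1 \<le> n" "n \<le> p"
  shows "0 < p div n" "n * (p div n) \<le> p" "1 / real (p div n) \<le> 2 * real n / real p"
proof -
  show q: "0 < p div n" using assms by (simp add: div_greater_zero_iff)
  show "n * (p div n) \<le> p" by simp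
  have "p < n * (p div n) + n"
    using assms mod_less_divisor[of n p] mult_div_mod_eq[of n p] by linarith
  also have "\<dots> \<le> 2 * n * (p div n)" using q by (cases "p div n") auto
  finally have "real p \<le> 2 * real n * real (p div n)"
    by (metis less_imp_le of_nat_le_iff of_nat_mult of_nat_numeral)
  then show "1 / real (p div n) \<le> 2 * real n / real p"
    using q assms by (simp add: field_simps)
qed

lemma sparse_altI:
  assumes "\<epsilon>\<^sup>2 \<le> (\<Sum>i<p. (\<theta> i)\<^sup>2)" "card {i \<in> {..<p}. \<theta> i \<noteq> 0} \<le> s"
  shows "(\<lambda>i\<in>{..<p}. \<theta> i) \<in> sparse_alt p s \<epsilon>"
proof -
  have "{i \<in> {..<p}. (\<lambda>i\<in>{..<p}. \<theta> i) i \<noteq> 0} = {i \<in> {..<p}. \<theta> i \<noteq> 0}" by auto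
  moreover have "L2_set (\<lambda>i\<in>{..<p}. \<theta> i) {..<p} = sqrt (\<Sum>i<p. (\<theta> i)\<^sup>2)"
    unfolding L2_set_def by (intro arg_cong[where f = sqrt] sum.cong) auto
  ultimately show ?thesis
    using assms by (auto simp: sparse_alt_def l0_norm_def space_PiM intro: real_le_rsqrt)
qed

lemma card_block_support:
  assumes "0 < q" "n * q \<le> p" "j \<in> {..<n} \<rightarrow>\<^sub>E {..<q}"
  shows "card {i \<in> {..<p}. i < n * q \<and> j (i div q) = i mod q} = n"
proof -
  have "bij_betw (\<lambda>b. b * q + j b) {..<n} {i \<in> {..<p}. i < n * q \<and> j (i div q) = i mod q}"
  proof (rule bij_betw_byWitness[where f' = "\<lambda>i. i div q"])
    show "\<forall>b\<in>{..<n}. (b * q + j b) div q = b"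
      using assms by (auto simp: PiE_iff)
    show "\<forall>i\<in>{i \<in> {..<p}. i < n * q \<and> j (i div q) = i mod q}. i div q * q + j (i div q) = i"
      by (simp add: div_mult_mod_eq)
    show "(\<lambda>i. i div q) ` {i \<in> {..<p}. i < n * q \<and> j (i div q) = i mod q} \<subseteq> {..<n}"
    proof (rule image_subsetI)
      fix i assume "i \<in> {i \<in> {..<p}. i < n * q \<and> j (i div q) = i mod q}"
      then have "i < n * q" by simp
      then show "i div q \<in> {..<n}" by (simp add: less_mult_imp_div_less)
    qed
    show "(\<lambda>b. b * q + j b) ` {..<n} \<subseteq> {i \<in> {..<p}. i < n * q \<and> j (i div q) = i mod q}"
    proof (rule image_subsetI)
      fix b assume b: "b \<in> {..<n}"
      then have jb: "j b < q" using assms by auto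
      have "b * q + j b < (b + 1) * q" using jb by simp
      also have "\<dots> \<le> n * q" using b by (intro mult_le_mono1) simp
      finally show "b * q + j b \<in> {i \<in> {..<p}. i < n * q \<and> j (i div q) = i mod q}"
        using jb assms by simp
    qed
  qed
  then show ?thesis using bij_betw_same_card by fastforce
qed

lemma minimax_risk_ge_sparse:
  fixes p s n :: nat and \<gamma> \<epsilon> c :: real
  assumes n: "1 \<le> n" "n\<^sup>2 \<le> p" "n \<le> s" and \<gamma>: "0 \<le> \<gamma>" "\<gamma> < 1" and c: "0 \<le> c" "c \<le> 1"
    and \<epsilon>: "\<epsilon>\<^sup>2 \<le> c * ((1 - \<gamma>) * n * ln (1 + p / (real n)\<^sup>2))"
  shows "1 - sqrt (exp (2 * c) - 1) \<le> minimax_risk p s \<gamma> \<epsilon>"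
proof -
  define q where "q = p div n"
  have np: "n \<le> p" using n by (metis le_square le_trans power2_eq_square)
  note q = inverse_div_le[OF n(1) np, folded q_def]
  define \<alpha> where "\<alpha> = sqrt (\<epsilon>\<^sup>2 / ((1 - \<gamma>) * n))"
  have \<alpha>2: "\<alpha>\<^sup>2 = \<epsilon>\<^sup>2 / ((1 - \<gamma>) * n)" using \<gamma> by (simp add: \<alpha>_def)
  have x: "exp (\<alpha>\<^sup>2) - 1 \<le> c * (p / (real n)\<^sup>2)"
    using c \<epsilon> \<gamma> n by (intro exp_le_of_le_mult_ln) (auto simp: \<alpha>2 field_simps)
  show ?thesis
  proof (rule minimax_risk_ge_block_prior[where q = q and n = n and h = 0 and g = 0 and \<alpha> = \<alpha> and \<beta> = 0])
    show "0 < q" "n * q \<le> p" "(0::real) = 0 \<or> real q * 0 = 1" "0 \<le> \<gamma>" "\<gamma> \<le> 1"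
      using q \<gamma> by auto
    fix j assume j: "j \<in> {..<n} \<rightarrow>\<^sub>E {..<q}"
    show "(\<lambda>i\<in>{..<p}. sqrt \<gamma> * 0 + sqrt (1 - \<gamma>) * (0 + \<alpha> * block_vec n q 0 j i)) \<in> sparse_alt p s \<epsilon>"
    proof (rule sparse_altI)
      have "(\<Sum>i<p. (sqrt \<gamma> * 0 + sqrt (1 - \<gamma>) * (0 + \<alpha> * block_vec n q 0 j i))\<^sup>2)
          = (1 - \<gamma>) * \<alpha>\<^sup>2 * (\<Sum>i<p. block_vec n q 0 j i * block_vec n q 0 j i)"
        using \<gamma> by (simp add: power_mult_distrib sum_distrib_left power2_eq_square[of "block_vec _ _ _ _ _"] mult.assoc)
      also have "\<dots> = \<epsilon>\<^sup>2"
        using q j n \<gamma> by (simp add: inner_block_vec \<alpha>2)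
      finally show "\<epsilon>\<^sup>2 \<le> (\<Sum>i<p. (sqrt \<gamma> * 0 + sqrt (1 - \<gamma>) * (0 + \<alpha> * block_vec n q 0 j i))\<^sup>2)"
        by simp
      have "card {i \<in> {..<p}. sqrt \<gamma> * 0 + sqrt (1 - \<gamma>) * (0 + \<alpha> * block_vec n q 0 j i) \<noteq> 0}
          \<le> card {i \<in> {..<p}. i < n * q \<and> j (i div q) = i mod q}"
        by (rule card_mono) (auto simp: block_vec_def split: if_splits)
      also have "\<dots> \<le> s" using card_block_support[OF q(1,2) j] n by simp
      finally show "card {i \<in> {..<p}. sqrt \<gamma> * 0 + sqrt (1 - \<gamma>) * (0 + \<alpha> * block_vec n q 0 j i) \<noteq> 0} \<le> s" .
    qed
  next
    have "n * ((exp (\<alpha>\<^sup>2) - 1) * (1 / q)) \<le> n * ((c * (p / (real n)\<^sup>2)) * (2 * n / p))"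
      using x q by (intro mult_left_mono mult_mono) (auto simp: c)
    also have "\<dots> = 2 * c" using n np by (simp add: power2_eq_square)
    finally show "0\<^sup>2 + real p * 0\<^sup>2 + real n * ((exp (\<alpha>\<^sup>2) - 1) / real q - \<alpha>\<^sup>2 * (2 * 0 - real q * 0\<^sup>2)) \<le> 2 * c"
      by simp
  qed
qed

text \<open>A shift of all coordinates by \<open>m\<close> is carried entirely by \<open>Z\<close> if \<open>\<gamma> p \<le> 1 - \<gamma>\<close> and entirely by \<open>W\<close>
  otherwise; in both cases its squared cost is at most \<open>2 p m\<^sup>2 / (1 - \<gamma> + \<gamma> p)\<close>.\<close>

lemma shift_split:
  fixes p :: nat and \<gamma> m c :: real
  assumes "0 \<le> \<gamma>" "\<gamma> \<le> 1" "1 \<le> p" and m: "p * m\<^sup>2 \<le> c * (1 - \<gamma> + \<gamma> * p)" and "0 \<le> c"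
  obtains h g :: real where "sqrt \<gamma> * h + sqrt (1 - \<gamma>) * g = m" "h\<^sup>2 + p * g\<^sup>2 \<le> 2 * c"
proof (cases "\<gamma> * p \<le> 1 - \<gamma>")
  case True
  have \<gamma>: "\<gamma> < 1" using True assms by (cases "\<gamma> = 1") auto
  have "p * m\<^sup>2 \<le> c * (2 * (1 - \<gamma>))"
    using m True \<open>0 \<le> c\<close> by (elim order_trans) (intro mult_left_mono, auto)
  then have "p * (m / sqrt (1 - \<gamma>))\<^sup>2 \<le> 2 * c"
    using \<gamma> by (simp add: power_divide field_simps)
  then show ?thesis using \<gamma> that[of 0 "m / sqrt (1 - \<gamma>)"] by simp
next
  case False
  have \<gamma>: "0 < \<gamma>" using False assms by (cases "\<gamma> = 0") auto
  have "p * m\<^sup>2 \<le> c * (2 * (\<gamma> * p))"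
    using m False \<open>0 \<le> c\<close> by (elim order_trans) (intro mult_left_mono, auto)
  then have "(m / sqrt \<gamma>)\<^sup>2 \<le> 2 * c"
    using \<gamma> assms by (simp add: power_divide field_simps)
  then show ?thesis using \<gamma> that[of "m / sqrt \<gamma>" 0] by simp
qed

text \<open>Without sparsity the constant vectors are the hard alternatives. The prior has no blocks.\<close>

lemma minimax_risk_ge_full:
  fixes p :: nat and \<gamma> \<epsilon> c :: real
  assumes "1 \<le> p" and \<gamma>: "0 \<le> \<gamma>" "\<gamma> \<le> 1" and c: "0 \<le> c"
    and \<epsilon>: "\<epsilon>\<^sup>2 \<le> c * (1 - \<gamma> + \<gamma> * p)"
  shows "1 - sqrt (exp (2 * c) - 1) \<le> minimax_risk p p \<gamma> \<epsilon>"
proof -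
  define m where "m = sqrt (\<epsilon>\<^sup>2 / p)"
  have m2: "p * m\<^sup>2 = \<epsilon>\<^sup>2" using assms by (simp add: m_def)
  obtain h g :: real where hg: "sqrt \<gamma> * h + sqrt (1 - \<gamma>) * g = m" "h\<^sup>2 + p * g\<^sup>2 \<le> 2 * c"
    using shift_split[of \<gamma> p m c] assms m2 by auto
  show ?thesis
  proof (rule minimax_risk_ge_block_prior[where q = 1 and n = 0 and h = h and g = g and \<alpha> = 0 and \<beta> = 1])
    fix j :: "nat \<Rightarrow> nat"
    have "(\<lambda>i\<in>{..<p}. m) \<in> sparse_alt p p \<epsilon>"
    proof (rule sparse_altI)
      show "\<epsilon>\<^sup>2 \<le> (\<Sum>i<p. m\<^sup>2)" using m2 by simp
      show "card {i \<in> {..<p}. m \<noteq> 0} \<le> p"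
        using card_mono[of "{..<p}" "{i \<in> {..<p}. m \<noteq> 0}"] by auto
    qed
    then show "(\<lambda>i\<in>{..<p}. sqrt \<gamma> * h + sqrt (1 - \<gamma>) * (g + 0 * block_vec 0 1 1 j i)) \<in> sparse_alt p p \<epsilon>"
      using hg(1) by simp
  qed (use \<gamma> hg(2) in auto)
qed

text \<open>The alternatives have the value \<open>0\<close> at the marked coordinate of each block, \<open>a\<close> at the other coordinates
  of the blocks, and \<open>a (1 - 1/q)\<close>, the average over a block, at the coordinates outside the blocks. Thus they
  are the constant vector \<open>a (1 - 1/q)\<close> minus a centered block vector, with at least \<open>n\<close> zeros.\<close>

lemma minimax_risk_ge_hidden:
  fixes p s n :: nat and \<gamma> \<epsilon> c :: real
  assumes n: "1 \<le> n" "2 * n \<le> p" "p - n \<le> s" and \<gamma>: "0 \<le> \<gamma>" "\<gamma> < 1" and c: "0 \<le> c" "c \<le> 1"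
    and \<epsilon>: "4 * \<epsilon>\<^sup>2 \<le> c * (1 - \<gamma> + \<gamma> * p)"
    and \<epsilon>': "sqrt p \<le> n \<and> 4 * \<epsilon>\<^sup>2 * n \<le> c * ((1 - \<gamma>) * p * sqrt p) \<or>
      4 * \<epsilon>\<^sup>2 \<le> c * ((1 - \<gamma>) * p * ln (1 + p / (real n)\<^sup>2))"
  shows "1 - sqrt (exp (4 * c) - 1) \<le> minimax_risk p s \<gamma> \<epsilon>"
proof -
  define q where "q = p div n"
  have np: "n \<le> p" "1 \<le> p" using n by auto
  note q = inverse_div_le[OF n(1) np(1), folded q_def]
  have q2: "2 \<le> q" using n by (simp add: q_def less_eq_div_iff_mult_less_eq)
  define b where "b = 1 - 1 / real q"
  have b: "1 / 2 \<le> b" "b \<le> 1" using q2 by (auto simp: b_def field_simps)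
  define a where "a = sqrt (4 * \<epsilon>\<^sup>2 / p)"
  have a2: "p * a\<^sup>2 = 4 * \<epsilon>\<^sup>2" using np by (simp add: a_def)
  define \<alpha> where "\<alpha> = - a / sqrt (1 - \<gamma>)"
  have \<alpha>2: "\<alpha>\<^sup>2 = 4 * \<epsilon>\<^sup>2 / (p * (1 - \<gamma>))"
    using \<gamma> np by (simp add: \<alpha>_def power_divide a_def)
  have s\<alpha>: "sqrt (1 - \<gamma>) * \<alpha> = - a" using \<gamma> by (simp add: \<alpha>_def)
  have "p * (a * b)\<^sup>2 \<le> p * a\<^sup>2"
    using b mult_left_le[of "b\<^sup>2" "a\<^sup>2"]
    by (intro mult_left_mono) (auto simp: power_mult_distrib power_le_one)
  also have "\<dots> \<le> c * (1 - \<gamma> + \<gamma> * p)" using \<epsilon> a2 by simp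
  finally obtain h g :: real where hg: "sqrt \<gamma> * h + sqrt (1 - \<gamma>) * g = a * b" "h\<^sup>2 + p * g\<^sup>2 \<le> 2 * c"
    using shift_split[of \<gamma> p "a * b" c] \<gamma> np c by auto
  have chi: "n * ((exp (\<alpha>\<^sup>2) - 1) / q - \<alpha>\<^sup>2 * (1 / q)) \<le> 2 * c"
  proof -
    define x where "x = \<alpha>\<^sup>2"
    have "0 \<le> x" by (simp add: x_def)
    \<comment> \<open>For \<open>n \<ge> sqrt p\<close> the centering matters and the quadratic bound on \<open>exp x - 1 - x\<close> is used; for
      smaller \<open>n\<close> it is bounded by \<open>exp x - 1\<close>.\<close>
    have A: "(n * (2 * n / p)) * (exp x - 1 - x) \<le> 2 * c"
      using \<epsilon>'
    proof
      assume *: "sqrt p \<le> n \<and> 4 * \<epsilon>\<^sup>2 * n \<le> c * ((1 - \<gamma>) * p * sqrt p)"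
      have xle: "x \<le> c * (sqrt p / n)"
        using * \<gamma> np n unfolding x_def \<alpha>2 by (simp add: field_simps)
      have "sqrt p / n \<le> 1" using * n by (simp add: field_simps)
      then have "c * (sqrt p / n) \<le> 1"
        using c by (intro mult_le_one) auto
      then have "x \<le> 1" using xle by linarith
      then have "exp x - 1 - x \<le> x\<^sup>2"
        using exp_bound[OF \<open>0 \<le> x\<close>] by simp
      also have "\<dots> \<le> (c * (sqrt p / n))\<^sup>2" using xle \<open>0 \<le> x\<close> by (intro power_mono)
      also have "\<dots> = c\<^sup>2 * (p / (real n)\<^sup>2)" by (simp add: power_mult_distrib power_divide)
      finally have "(n * (2 * n / p)) * (exp x - 1 - x) \<le> (n * (2 * n / p)) * (c\<^sup>2 * (p / (real n)\<^sup>2))"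
        by (intro mult_left_mono) auto
      also have "\<dots> = 2 * c\<^sup>2" using n np by (simp add: power2_eq_square)
      also have "\<dots> \<le> 2 * c" using c by (simp add: power2_eq_square mult_left_le)
      finally show ?thesis .
    next
      assume *: "4 * \<epsilon>\<^sup>2 \<le> c * ((1 - \<gamma>) * p * ln (1 + p / (real n)\<^sup>2))"
      have "exp x - 1 \<le> c * (p / (real n)\<^sup>2)"
        using * c \<gamma> n np by (intro exp_le_of_le_mult_ln) (auto simp: x_def \<alpha>2 field_simps)
      then have "(n * (2 * n / p)) * (exp x - 1 - x) \<le> (n * (2 * n / p)) * (c * (p / (real n)\<^sup>2))"
        using \<open>0 \<le> x\<close> by (intro mult_left_mono) auto
      also have "\<dots> = 2 * c" using n np by (simp add: power2_eq_square)
      finally show ?thesis .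
    qed
    have "n * ((exp x - 1) / q - x * (1 / q)) = n * (1 / q) * (exp x - 1 - x)"
      using q by (simp add: field_simps)
    also have "\<dots> \<le> n * (2 * n / p) * (exp x - 1 - x)"
    proof -
      have "0 \<le> exp x - 1 - x" using exp_ge_add_one_self[of x] by linarith
      then show ?thesis using q by (intro mult_right_mono mult_left_mono) auto
    qed
    finally show ?thesis using A by (simp add: x_def)
  qed
  show ?thesis
  proof (rule minimax_risk_ge_block_prior[where q = q and n = n and h = h and g = g and \<alpha> = \<alpha> and \<beta> = "1 / q"])
    show "0 < q" "n * q \<le> p" "g = 0 \<or> real q * (1 / real q) = 1" "0 \<le> \<gamma>" "\<gamma> \<le> 1"
      using q \<gamma> by auto
    fix j assume j: "j \<in> {..<n} \<rightarrow>\<^sub>E {..<q}"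
    have eq: "sqrt \<gamma> * h + sqrt (1 - \<gamma>) * (g + \<alpha> * block_vec n q (1 / q) j i)
        = a * (b - block_vec n q (1 / q) j i)" for i
    proof -
      have "sqrt \<gamma> * h + sqrt (1 - \<gamma>) * (g + \<alpha> * block_vec n q (1 / q) j i)
        = (sqrt \<gamma> * h + sqrt (1 - \<gamma>) * g) + (sqrt (1 - \<gamma>) * \<alpha>) * block_vec n q (1 / q) j i"
        by (simp only: distrib_left mult.assoc add.assoc)
      then show ?thesis unfolding hg(1) s\<alpha> by (simp add: right_diff_distrib)
    qed
    show "(\<lambda>i\<in>{..<p}. sqrt \<gamma> * h + sqrt (1 - \<gamma>) * (g + \<alpha> * block_vec n q (1 / q) j i)) \<in> sparse_alt p s \<epsilon>"
      unfolding eq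
    proof (rule sparse_altI)
      have "(\<Sum>i<p. (a * (b - block_vec n q (1 / q) j i))\<^sup>2)
          = (\<Sum>i<p. a\<^sup>2 * b\<^sup>2 - 2 * a\<^sup>2 * b * block_vec n q (1 / q) j i + a\<^sup>2 * (block_vec n q (1 / q) j i)\<^sup>2)"
        by (intro sum.cong refl) (simp add: power2_eq_square algebra_simps)
      also have "\<dots> = p * (a\<^sup>2 * b\<^sup>2) - 2 * a\<^sup>2 * b * (\<Sum>i<p. block_vec n q (1 / q) j i)
          + a\<^sup>2 * (\<Sum>i<p. (block_vec n q (1 / q) j i)\<^sup>2)"
        by (simp add: sum.distrib sum_subtractf sum_distrib_left)
      also have "(\<Sum>i<p. block_vec n q (1 / q) j i) = 0"
        using q j by (simp add: sum_block_vec)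
      finally have "p * (a\<^sup>2 * b\<^sup>2) \<le> (\<Sum>i<p. (a * (b - block_vec n q (1 / q) j i))\<^sup>2)"
        by (simp add: sum_nonneg)
      moreover have "p * a\<^sup>2 * (1 / 2)\<^sup>2 \<le> p * a\<^sup>2 * b\<^sup>2"
        using b by (intro mult_left_mono power_mono) auto
      then have "\<epsilon>\<^sup>2 \<le> p * (a\<^sup>2 * b\<^sup>2)"
        unfolding a2 mult.assoc[symmetric] by (simp add: power_divide)
      ultimately show "\<epsilon>\<^sup>2 \<le> (\<Sum>i<p. (a * (b - block_vec n q (1 / q) j i))\<^sup>2)" by linarith
      let ?Z = "{i \<in> {..<p}. i < n * q \<and> j (i div q) = i mod q}"
      have "{i \<in> {..<p}. a * (b - block_vec n q (1 / q) j i) \<noteq> 0} \<subseteq> {..<p} - ?Z"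
        by (auto simp: block_vec_def b_def)
      then have "card {i \<in> {..<p}. a * (b - block_vec n q (1 / q) j i) \<noteq> 0} \<le> card ({..<p} - ?Z)"
        by (intro card_mono) auto
      also have "\<dots> = p - n"
        using card_block_support[OF q(1,2) j] by (subst card_Diff_subset) auto
      finally show "card {i \<in> {..<p}. a * (b - block_vec n q (1 / q) j i) \<noteq> 0} \<le> s"
        using n by simp
    qed
  next
    have "2 * (1 / real q) - real q * (1 / real q)\<^sup>2 = 1 / q"
      using q by (simp add: power2_eq_square)
    then show "h\<^sup>2 + real p * g\<^sup>2 + real n * ((exp (\<alpha>\<^sup>2) - 1) / real q
        - \<alpha>\<^sup>2 * (2 * (1 / real q) - real q * (1 / real q)\<^sup>2)) \<le> 4 * c"
      using chi hg(2) by simp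
  qed
qed

text \<open>For \<open>s \<ge> sqrt p\<close> the sparse bound at sparsity \<open>\<lfloor>sqrt p\<rfloor>\<close> gives the rate \<open>(1 - \<gamma>) sqrt p\<close>.\<close>

lemma minimax_risk_ge_sqrt:
  fixes p s :: nat and \<gamma> \<epsilon> c :: real
  assumes ps: "1 \<le> p" "sqrt p \<le> s" and \<gamma>: "0 \<le> \<gamma>" "\<gamma> < 1" and c: "0 \<le> c" "4 * c \<le> 1"
    and \<epsilon>: "\<epsilon>\<^sup>2 \<le> c * ((1 - \<gamma>) * sqrt p)"
  shows "1 - sqrt (exp (8 * c) - 1) \<le> minimax_risk p s \<gamma> \<epsilon>"
proof -
  define n where "n = nat \<lfloor>sqrt p\<rfloor>"
  have n_le: "real n \<le> sqrt p" by (simp add: n_def)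
  have n1: "1 \<le> n" using ps by (simp add: n_def le_nat_iff)
  have "sqrt p < real n + 1" by (simp add: n_def)
  then have n_ge: "sqrt p \<le> 2 * real n" using n1 by linarith
  have "(real n)\<^sup>2 \<le> p" using power_mono[OF n_le, of 2] by simp
  then have n2: "n\<^sup>2 \<le> p" by (metis of_nat_le_iff of_nat_power)
  have "n \<le> s" using n_le ps by linarith
  have "1 \<le> p / (real n)\<^sup>2" using \<open>(real n)\<^sup>2 \<le> p\<close> n1 by (simp add: field_simps)
  then have "ln 2 \<le> ln (1 + p / (real n)\<^sup>2)" by (subst ln_le_cancel_iff) auto
  moreover have "1 / 2 \<le> ln (2::real)" using ln2_ge_two_thirds by simp
  ultimately have ln: "1 / 2 \<le> ln (1 + p / (real n)\<^sup>2)" by linarith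
  have "sqrt p \<le> 4 * (n * (1 / 2))" using n_ge by simp
  also have "\<dots> \<le> 4 * (n * ln (1 + p / (real n)\<^sup>2))" using ln by (intro mult_left_mono) auto
  finally have "c * ((1 - \<gamma>) * sqrt p) \<le> c * ((1 - \<gamma>) * (4 * (n * ln (1 + p / (real n)\<^sup>2))))"
    using c \<gamma> by (intro mult_left_mono) auto
  with \<epsilon> have "\<epsilon>\<^sup>2 \<le> (4 * c) * ((1 - \<gamma>) * n * ln (1 + p / (real n)\<^sup>2))"
    by (simp add: mult_ac)
  from minimax_risk_ge_sparse[OF n1 n2 \<open>n \<le> s\<close> \<gamma> _ c(2) this] c show ?thesis by simp
qed

text \<open>For \<open>s \<ge> sqrt p\<close>: if the second summand of the rate is at most twice the first, the rate is at most three
  times the first; otherwise it is less than twice the second.\<close>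

lemma minimax_risk_ge_rate:
  fixes p s :: nat and \<gamma> \<epsilon> c :: real
  assumes ps: "1 \<le> s" "s \<le> p" and \<gamma>: "0 \<le> \<gamma>" "\<gamma> \<le> 1" and c: "0 \<le> c" "24 * c \<le> 1"
    and \<epsilon>: "0 < \<epsilon>\<^sup>2" "\<epsilon>\<^sup>2 \<le> c * rate_sq p s \<gamma>"
  shows "1 - sqrt (exp (24 * c) - 1) \<le> minimax_risk p s \<gamma> \<epsilon>"
proof -
  have mono: "1 - sqrt (exp (24 * c) - 1) \<le> 1 - sqrt (exp (k * c) - 1)" if "k \<le> 24" for k
    using that c by (intro diff_left_mono real_sqrt_le_mono) (auto intro: mult_right_mono)
  let ?B = "1 - \<gamma> + \<gamma> * p"
  have p1: "1 \<le> p" using ps by simp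
  show ?thesis
  proof (cases "real s < sqrt p")
    case True
    have r: "rate_sq p s \<gamma> = (1 - \<gamma>) * s * ln (1 + p / (real s)\<^sup>2)"
      using True by (simp add: rate_sq_def)
    have "\<gamma> \<noteq> 1" using \<epsilon> r by auto
    then have \<gamma>': "\<gamma> < 1" using \<gamma> by simp
    have "(real s)\<^sup>2 \<le> p" using True power_mono[of "real s" "sqrt p" 2] by simp
    then have "s\<^sup>2 \<le> p" by (metis of_nat_le_iff of_nat_power)
    from minimax_risk_ge_sparse[OF ps(1) this order_refl \<gamma>(1) \<gamma>' c(1) _ \<epsilon>(2)[unfolded r]] c
    show ?thesis by (intro order_trans[OF mono[of 2]]) simp_all
  next
    case False
    then have sp: "sqrt p \<le> s" by simp
    have sqrt: ?thesis if "\<epsilon>\<^sup>2 \<le> (3 * c) * ((1 - \<gamma>) * sqrt p)"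
    proof -
      have "\<gamma> \<noteq> 1" using \<epsilon> that by auto
      then have \<gamma>': "\<gamma> < 1" using \<gamma> by simp
      from minimax_risk_ge_sqrt[OF p1 sp \<gamma>(1) \<gamma>' _ _ that] c show ?thesis by simp
    qed
    have B: "0 \<le> ?B" using \<gamma> by simp
    show ?thesis
    proof (cases "s = p")
      case True
      have "sqrt p > 0" using p1 by simp
      then have "\<not> s \<le> real p - sqrt p" using True by simp
      then have r: "rate_sq p s \<gamma> = (1 - \<gamma>) * sqrt p + ?B"
        using True False by (simp add: rate_sq_def)
      show ?thesis
      proof (cases "?B \<le> 2 * ((1 - \<gamma>) * sqrt p)")
        case True
        have "\<epsilon>\<^sup>2 \<le> c * (3 * ((1 - \<gamma>) * sqrt p))"
          using \<epsilon>(2) unfolding r by (rule order_trans) (intro mult_left_mono, use True c in auto)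
        then show ?thesis by (intro sqrt) (simp add: mult_ac)
      next
        case False
        have "\<epsilon>\<^sup>2 \<le> c * (2 * ?B)"
          using \<epsilon>(2) unfolding r by (rule order_trans) (intro mult_left_mono, use False c B in auto)
        then have "\<epsilon>\<^sup>2 \<le> (2 * c) * ?B" by (simp add: algebra_simps)
        from minimax_risk_ge_full[OF p1 \<gamma> _ this] c True
        show ?thesis by (intro order_trans[OF mono[of 4]]) simp_all
      qed
    next
      case False
      then have sp': "s < p" using ps by simp
      define n where "n = p - s"
      have n1: "1 \<le> n" using sp' by (simp add: n_def)
      have n: "real p - real s = real n" using sp' by (simp add: n_def)
      define A where "A = (if sqrt p \<le> n then (1 - \<gamma>) * real p powr (3/2) / n
          else (1 - \<gamma>) * p * ln (1 + p / (real n)\<^sup>2))"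
      have r: "rate_sq p s \<gamma> = (1 - \<gamma>) * sqrt p + min A ?B"
        using sp False unfolding rate_sq_def A_def n by (auto simp: n[symmetric])
      have pow: "real p powr (3/2) = p * sqrt p"
        using p1 by (simp add: powr_half_sqrt[symmetric] powr_mult_base)
      show ?thesis
      proof (cases "min A ?B \<le> 2 * ((1 - \<gamma>) * sqrt p)")
        case True
        have "\<epsilon>\<^sup>2 \<le> c * (3 * ((1 - \<gamma>) * sqrt p))"
          using \<epsilon>(2) unfolding r by (rule order_trans) (intro mult_left_mono, use True c in auto)
        then show ?thesis by (intro sqrt) (simp add: mult_ac)
      next
        case big: False
        have "\<gamma> \<noteq> 1"
          using big by (auto simp: A_def split: if_splits)
        then have \<gamma>': "\<gamma> < 1" using \<gamma> by simp
        have le: "4 * \<epsilon>\<^sup>2 \<le> (6 * c) * min A ?B"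
        proof -
          have "\<epsilon>\<^sup>2 \<le> c * (3 / 2 * min A ?B)"
            using \<epsilon>(2) unfolding r by (rule order_trans) (intro mult_left_mono, use big c in auto)
          then show ?thesis by simp
        qed
        have leA: "4 * \<epsilon>\<^sup>2 \<le> (6 * c) * A" and leB: "4 * \<epsilon>\<^sup>2 \<le> (6 * c) * ?B"
          using order_trans[OF le mult_left_mono[OF min.cobounded1]]
            order_trans[OF le mult_left_mono[OF min.cobounded2]] c by auto
        \<comment> \<open>If \<open>n > p / 2\<close> then the first summand of the rate already dominates.\<close>
        have n2: "2 * n \<le> p"
        proof (cases "sqrt p \<le> n")
          case True
          show ?thesis
          proof (rule ccontr)
            assume "\<not> 2 * n \<le> p"
            then have "p \<le> 2 * n" by simp
            then have "real p \<le> 2 * real n" by linarith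
            then have "((1 - \<gamma>) * sqrt p) * p \<le> ((1 - \<gamma>) * sqrt p) * (2 * n)"
              using \<gamma> by (intro mult_left_mono) auto
            then have "A \<le> 2 * ((1 - \<gamma>) * sqrt p)"
              using True n1 unfolding A_def pow by (simp add: field_simps)
            then show False using big by simp
          qed
        next
          case False
          then show ?thesis using sp by (simp add: n_def)
        qed
        have "sqrt p \<le> n \<and> 4 * \<epsilon>\<^sup>2 * n \<le> (6 * c) * ((1 - \<gamma>) * p * sqrt p) \<or>
          4 * \<epsilon>\<^sup>2 \<le> (6 * c) * ((1 - \<gamma>) * p * ln (1 + p / (real n)\<^sup>2))"
        proof (cases "sqrt p \<le> n")
          case True
          have "A * n = (1 - \<gamma>) * p * sqrt p" using True n1 by (simp add: A_def pow)
          moreover have "4 * \<epsilon>\<^sup>2 * n \<le> (6 * c) * (A * n)"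
            using mult_right_mono[OF leA, of "real n"] by (simp add: mult.assoc)
          ultimately show ?thesis using True by simp
        next
          case False
          then show ?thesis using leA by (simp add: A_def)
        qed
        from minimax_risk_ge_hidden[OF n1 n2 _ \<gamma>(1) \<gamma>' _ _ leB this] c
        show ?thesis by (simp add: n_def)
      qed
    qed
  qed
qed

section \<open>Tail bounds for the noise\<close>

lemma integrable_gauss_vec_component:
  fixes f :: "real \<Rightarrow> real"
  assumes "i < p" "integrable std_normal_distribution f"
  shows "integrable (gauss_vec p) (\<lambda>z. f (z i))"
    and "(\<integral>z. f (z i) \<partial>gauss_vec p) = (\<integral>x. f x \<partial>std_normal_distribution)"
proof -
  have *: "distr (gauss_vec p) std_normal_distribution (\<lambda>z. z i) = std_normal_distribution"
    using assms by (intro distr_PiM_component prob_space_std_normal) auto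
  have f: "f \<in> borel_measurable std_normal_distribution" using assms by auto
  have m: "(\<lambda>z. z i) \<in> gauss_vec p \<rightarrow>\<^sub>M std_normal_distribution"
    using assms by (intro measurable_component_singleton) auto
  show "integrable (gauss_vec p) (\<lambda>z. f (z i))"
    using integrable_distr_eq[OF m f] assms by (simp add: *)
  show "(\<integral>z. f (z i) \<partial>gauss_vec p) = (\<integral>x. f x \<partial>std_normal_distribution)"
    using integral_distr[OF m f] by (simp add: *)
qed

lemma
  fixes f g :: "real \<Rightarrow> real"
  assumes ij: "i < p" "j < p" "i \<noteq> j"
    and fg: "integrable std_normal_distribution f" "integrable std_normal_distribution g"
  shows integrable_gauss_vec_mult: "integrable (gauss_vec p) (\<lambda>z. f (z i) * g (z j))"
    and integral_gauss_vec_mult: "(\<integral>z. f (z i) * g (z j) \<partial>gauss_vec p) =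
      (\<integral>x. f x \<partial>std_normal_distribution) * (\<integral>x. g x \<partial>std_normal_distribution)"
proof -
  let ?N = std_normal_distribution
  interpret W: prob_space ?N by (rule prob_space_std_normal)
  interpret N: product_prob_space "\<lambda>_. ?N" "{..<p}"
    by (intro product_prob_spaceI prob_space_std_normal)
  define F where "F k x = (if k = i then f x else if k = j then g x else 1)" for k x
  have F: "integrable ?N (F k)" for k
    using fg by (cases "k = i"; cases "k = j") (auto simp: F_def[abs_def])
  have split: "(\<Prod>k<p. h k) = h i * h j * (\<Prod>k\<in>{..<p} - {i} - {j}. h k)" for h :: "nat \<Rightarrow> real"
    using ij by (subst prod.remove[of _ i], simp_all) (subst prod.remove[of _ j], simp_all)
  have eq: "f (z i) * g (z j) = (\<Prod>k<p. F k (z k))" for z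
    unfolding split using ij by (simp add: F_def)
  show "integrable (gauss_vec p) (\<lambda>z. f (z i) * g (z j))"
    unfolding eq using F by (intro N.product_integrable_prod) auto
  have "(\<integral>z. f (z i) * g (z j) \<partial>gauss_vec p) = (\<Prod>k<p. integral\<^sup>L ?N (F k))"
    unfolding eq using F by (intro N.product_integral_prod) auto
  also have "\<dots> = integral\<^sup>L ?N f * integral\<^sup>L ?N g"
    unfolding split using ij by (simp add: F_def[abs_def] W.prob_space[simplified])
  finally show "(\<integral>z. f (z i) * g (z j) \<partial>gauss_vec p) = integral\<^sup>L ?N f * integral\<^sup>L ?N g" .
qed

text \<open>Chebyshev for sums of functions of the independent coordinates.\<close>

lemma gauss_vec_Chebyshev:
  fixes f :: "nat \<Rightarrow> real \<Rightarrow> real"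
  assumes G: "G \<subseteq> {..<p}" and t: "0 < t"
    and f: "\<And>i. i \<in> G \<Longrightarrow> f i \<in> borel_measurable borel"
      "\<And>i. i \<in> G \<Longrightarrow> integrable std_normal_distribution (\<lambda>x. (f i x)\<^sup>2)"
      "\<And>i. i \<in> G \<Longrightarrow> (\<integral>x. f i x \<partial>std_normal_distribution) = m i"
      "\<And>i. i \<in> G \<Longrightarrow> (\<integral>x. (f i x)\<^sup>2 \<partial>std_normal_distribution) - (m i)\<^sup>2 \<le> V i"
  shows "{z \<in> space (gauss_vec p). t \<le> \<bar>(\<Sum>i\<in>G. f i (z i)) - (\<Sum>i\<in>G. m i)\<bar>} \<in> sets (gauss_vec p)"
    and "measure (gauss_vec p) {z \<in> space (gauss_vec p). t \<le> \<bar>(\<Sum>i\<in>G. f i (z i)) - (\<Sum>i\<in>G. m i)\<bar>}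
      \<le> (\<Sum>i\<in>G. V i) / t\<^sup>2"
proof -
  let ?N = std_normal_distribution
  interpret W: prob_space ?N by (rule prob_space_std_normal)
  interpret Z: prob_space "gauss_vec p" by (rule prob_space_gauss_vec)
  have fin: "finite G" using G finite_subset by blast
  define g where "g i x = f i x - m i" for i x
  have f1: "integrable ?N (f i)" if "i \<in> G" for i
    using W.square_integrable_imp_integrable[of "f i"] f that by simp
  have g1: "integrable ?N (g i)" if "i \<in> G" for i
    using f1[OF that] by (simp add: g_def[abs_def])
  have g2eq: "(g i x)\<^sup>2 = (f i x)\<^sup>2 - 2 * m i * f i x + (m i)\<^sup>2" for i x
    by (simp add: g_def power2_eq_square algebra_simps)
  have g2: "integrable ?N (\<lambda>x. (g i x)\<^sup>2)" if "i \<in> G" for i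
    unfolding g2eq using f1[OF that] f(2)[OF that] by simp
  have g2i: "(\<integral>x. (g i x)\<^sup>2 \<partial>?N) \<le> V i" if "i \<in> G" for i
  proof -
    have "(\<integral>x. (g i x)\<^sup>2 \<partial>?N) = (\<integral>x. (f i x)\<^sup>2 \<partial>?N) - (m i)\<^sup>2"
      unfolding g2eq using f1[OF that] f(2)[OF that] f(3)[OF that]
      by (simp add: W.prob_space[simplified] power2_eq_square)
    then show ?thesis using f(4)[OF that] by simp
  qed
  have g0: "(\<integral>x. g i x \<partial>?N) = 0" if "i \<in> G" for i
    using f1[OF that] f(3)[OF that] by (simp add: g_def W.prob_space[simplified])
  have Gp: "i < p" if "i \<in> G" for i using G that by auto
  have int2: "integrable (gauss_vec p) (\<lambda>z. g i (z i) * g j (z j))" if "i \<in> G" "j \<in> G" for i j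
  proof (cases "i = j")
    case True
    then show ?thesis
      using integrable_gauss_vec_component(1)[OF Gp g2] that by (simp add: power2_eq_square)
  next
    case False
    then show ?thesis using that Gp g1 by (intro integrable_gauss_vec_mult) auto
  qed
  have sq: "((\<Sum>i\<in>G. f i (z i)) - (\<Sum>i\<in>G. m i))\<^sup>2 = (\<Sum>i\<in>G. \<Sum>j\<in>G. g i (z i) * g j (z j))" for z
    by (simp add: g_def sum_subtractf[symmetric] power2_eq_square sum_product)
  have m: "(\<lambda>z. \<Sum>i\<in>G. f i (z i)) \<in> borel_measurable (gauss_vec p)"
  proof (intro borel_measurable_sum)
    fix i assume i: "i \<in> G"
    have "(\<lambda>z. z i) \<in> gauss_vec p \<rightarrow>\<^sub>M borel"
      using measurable_component_singleton[of i "{..<p}" "\<lambda>_. std_normal_distribution"] Gp[OF i]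
      by simp
    then show "(\<lambda>z. f i (z i)) \<in> borel_measurable (gauss_vec p)"
      using f(1)[OF i] by (rule measurable_compose)
  qed
  show "{z \<in> space (gauss_vec p). t \<le> \<bar>(\<Sum>i\<in>G. f i (z i)) - (\<Sum>i\<in>G. m i)\<bar>} \<in> sets (gauss_vec p)"
    using m by measurable
  have "measure (gauss_vec p) {z \<in> space (gauss_vec p). t \<le> \<bar>(\<Sum>i\<in>G. f i (z i)) - (\<Sum>i\<in>G. m i)\<bar>}
      \<le> Z.expectation (\<lambda>z. ((\<Sum>i\<in>G. f i (z i)) - (\<Sum>i\<in>G. m i))\<^sup>2) / t\<^sup>2"
    using m int2 t by (intro Z.second_moment_method) (auto simp: sq)
  also have "Z.expectation (\<lambda>z. ((\<Sum>i\<in>G. f i (z i)) - (\<Sum>i\<in>G. m i))\<^sup>2)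
      = (\<Sum>i\<in>G. \<Sum>j\<in>G. Z.expectation (\<lambda>z. g i (z i) * g j (z j)))"
    unfolding sq using int2 by simp
  also have "\<dots> = (\<Sum>i\<in>G. \<Sum>j\<in>G. if i = j then (\<integral>x. (g i x)\<^sup>2 \<partial>?N) else 0)"
  proof (intro sum.cong refl)
    fix i j assume ij: "i \<in> G" "j \<in> G"
    show "Z.expectation (\<lambda>z. g i (z i) * g j (z j)) = (if i = j then (\<integral>x. (g i x)\<^sup>2 \<partial>?N) else 0)"
    proof (cases "i = j")
      case True
      then show ?thesis
        using integrable_gauss_vec_component(2)[OF Gp g2] ij by (simp add: power2_eq_square)
    next
      case False
      then show ?thesis using ij Gp g1 g0 by (subst integral_gauss_vec_mult) auto
    qed
  qed
  also have "\<dots> = (\<Sum>i\<in>G. \<integral>x. (g i x)\<^sup>2 \<partial>?N)" using fin by simp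
  also have "\<dots> / t\<^sup>2 \<le> (\<Sum>i\<in>G. V i) / t\<^sup>2"
    using g2i by (intro divide_right_mono sum_mono) auto
  finally show "measure (gauss_vec p) {z \<in> space (gauss_vec p). t \<le> \<bar>(\<Sum>i\<in>G. f i (z i)) - (\<Sum>i\<in>G. m i)\<bar>}
      \<le> (\<Sum>i\<in>G. V i) / t\<^sup>2" .
qed

lemma std_normal_moments:
  shows "integrable std_normal_distribution (\<lambda>x. x ^ k)"
    and "(\<integral>x. x \<partial>std_normal_distribution) = 0"
    and "(\<integral>x. x\<^sup>2 \<partial>std_normal_distribution) = 1"
    and "(\<integral>x. x ^ 4 \<partial>std_normal_distribution) = 3"
proof -
  show "integrable std_normal_distribution (\<lambda>x. x ^ k)"
    by (subst integrable_real_density) (auto intro: integrable_std_normal_moment)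
  have eq: "(\<integral>x. x ^ k \<partial>std_normal_distribution) = (\<integral>x. std_normal_density x * x ^ k \<partial>lborel)" for k
    by (subst integral_real_density) auto
  show "(\<integral>x. x \<partial>std_normal_distribution) = 0"
    using eq[of 1] integral_std_normal_moment_odd[of 0] by simp
  show "(\<integral>x. x\<^sup>2 \<partial>std_normal_distribution) = 1"
    using eq[of 2] integral_std_normal_moment_even[of 1] by simp
  show "(\<integral>x. x ^ 4 \<partial>std_normal_distribution) = 3"
    using eq[of 4] integral_std_normal_moment_even[of 2] by (simp add: fact_numeral)
qed

lemma std_normal_tail:
  assumes "0 < K"
  shows "measure std_normal_distribution {x. K \<le> \<bar>x\<bar>} \<le> 1 / K\<^sup>2"
proof -
  interpret W: prob_space std_normal_distribution by (rule prob_space_std_normal)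
  have "W.prob {x \<in> space std_normal_distribution. K \<le> \<bar>x\<bar>} \<le> (\<integral>x. x\<^sup>2 \<partial>std_normal_distribution) / K\<^sup>2"
    using assms std_normal_moments(1)[of 2] by (intro W.second_moment_method) auto
  then show ?thesis by (simp add: std_normal_moments)
qed

lemma sum_sq_tail:
  assumes "0 < K" "1 \<le> p"
  defines "E \<equiv> {z \<in> space (gauss_vec p). K * sqrt p \<le> \<bar>(\<Sum>i<p. (z i)\<^sup>2) - p\<bar>}"
  shows "E \<in> sets (gauss_vec p)" "measure (gauss_vec p) E \<le> 2 / K\<^sup>2"
proof -
  have p4: "((x::real)\<^sup>2)\<^sup>2 = x ^ 4" for x by simp
  note * = gauss_vec_Chebyshev[where G = "{..<p}" and p = p and f = "\<lambda>_ x. x\<^sup>2" and m = "\<lambda>_. 1"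
      and V = "\<lambda>_. 2" and t = "K * sqrt p"]
  have [measurable]: "(\<lambda>x::real. x\<^sup>2) \<in> borel_measurable borel" by measurable
  have "{z \<in> space (gauss_vec p). K * sqrt p \<le> \<bar>(\<Sum>i<p. (z i)\<^sup>2) - (\<Sum>i<p. 1)\<bar>} \<in> sets (gauss_vec p)"
    using assms by (intro *(1)) (simp_all add: std_normal_moments p4 del: power2_eq_square)
  then show "E \<in> sets (gauss_vec p)" by (simp add: E_def)
  have "measure (gauss_vec p) {z \<in> space (gauss_vec p). K * sqrt p \<le> \<bar>(\<Sum>i<p. (z i)\<^sup>2) - (\<Sum>i<p. 1)\<bar>}
      \<le> (\<Sum>i<p. 2) / (K * sqrt p)\<^sup>2"
    using assms by (intro *(2)) (simp_all add: std_normal_moments p4)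
  then show "measure (gauss_vec p) E \<le> 2 / K\<^sup>2"
    using assms by (simp add: E_def power_mult_distrib)
qed

lemma linear_form_tail:
  fixes a :: "nat \<Rightarrow> real"
  assumes "0 < K" "0 < (\<Sum>i<p. (a i)\<^sup>2)"
  defines "E \<equiv> {z \<in> space (gauss_vec p). K * sqrt (\<Sum>i<p. (a i)\<^sup>2) \<le> \<bar>\<Sum>i<p. a i * z i\<bar>}"
  shows "E \<in> sets (gauss_vec p)" "measure (gauss_vec p) E \<le> 1 / K\<^sup>2"
proof -
  note * = gauss_vec_Chebyshev[where G = "{..<p}" and p = p and f = "\<lambda>i x. a i * x" and m = "\<lambda>_. 0"
      and V = "\<lambda>i. (a i)\<^sup>2" and t = "K * sqrt (\<Sum>i<p. (a i)\<^sup>2)"]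
  have i2: "integrable std_normal_distribution (\<lambda>x. (a i * x)\<^sup>2)" for i
    unfolding power_mult_distrib using std_normal_moments(1)[of 2] by simp
  have e2: "(\<integral>x. (a i * x)\<^sup>2 \<partial>std_normal_distribution) = (a i)\<^sup>2" for i
    unfolding power_mult_distrib by (simp add: std_normal_moments)
  have "{z \<in> space (gauss_vec p). K * sqrt (\<Sum>i<p. (a i)\<^sup>2) \<le> \<bar>(\<Sum>i<p. a i * z i) - (\<Sum>i<p. 0)\<bar>} \<in> sets (gauss_vec p)"
    using assms by (intro *(1)) (simp_all add: std_normal_moments i2 e2)
  then show "E \<in> sets (gauss_vec p)" by (simp add: E_def)
  have "measure (gauss_vec p) {z \<in> space (gauss_vec p). K * sqrt (\<Sum>i<p. (a i)\<^sup>2) \<le> \<bar>(\<Sum>i<p. a i * z i) - (\<Sum>i<p. 0)\<bar>}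
      \<le> (\<Sum>i<p. (a i)\<^sup>2) / (K * sqrt (\<Sum>i<p. (a i)\<^sup>2))\<^sup>2"
    using assms by (intro *(2)) (simp_all add: std_normal_moments i2 e2)
  then show "measure (gauss_vec p) E \<le> 1 / K\<^sup>2"
    using assms by (simp add: E_def power_mult_distrib)
qed

lemma sum_tail:
  assumes "0 < K" "1 \<le> p"
  defines "E \<equiv> {z \<in> space (gauss_vec p). K * sqrt p \<le> \<bar>\<Sum>i<p. z i\<bar>}"
  shows "E \<in> sets (gauss_vec p)" "measure (gauss_vec p) E \<le> 1 / K\<^sup>2"
  using linear_form_tail[where K = K and p = p and a = "\<lambda>_. 1"] assms by (simp_all add: E_def)

text \<open>A region has small probability if it is avoided outside of unlikely sets of noise.\<close>

lemma obs_law_le: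
  assumes A: "A \<in> sets (Rvec p)" and E: "E \<in> sets (gauss_vec p)" "measure (gauss_vec p) E \<le> d"
    and F: "F \<in> sets borel" "measure std_normal_distribution F \<le> d'"
    and imp: "\<And>w z. w \<notin> F \<Longrightarrow> z \<in> space (gauss_vec p) \<Longrightarrow> z \<notin> E \<Longrightarrow> obs_map p \<gamma> \<theta> (w, z) \<notin> A"
  shows "measure (obs_law p \<gamma> \<theta>) A \<le> d + d'"
proof -
  let ?N = std_normal_distribution and ?Z = "gauss_vec p"
  interpret W: prob_space ?N by (rule prob_space_std_normal)
  interpret Z: prob_space ?Z by (rule prob_space_gauss_vec)
  interpret P: prob_space "gauss_pair p" by (rule prob_space_gauss_pair)
  have 1: "measure (gauss_pair p) (space ?N \<times> E) = measure ?Z E"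
    using E Z.emeasure_pair_measure_Times[of "space ?N" ?N E]
    by (simp add: measure_def W.emeasure_space_1[simplified])
  have 2: "measure (gauss_pair p) (F \<times> space ?Z) = measure ?N F"
    using F Z.emeasure_pair_measure_Times[of F ?N "space ?Z"]
    by (simp add: measure_def Z.emeasure_space_1)
  have m: "space ?N \<times> E \<in> sets (gauss_pair p)" "F \<times> space ?Z \<in> sets (gauss_pair p)"
    using E F by (auto intro!: pair_measureI)
  have "measure (obs_law p \<gamma> \<theta>) A \<le> measure (gauss_pair p) (space ?N \<times> E \<union> F \<times> space ?Z)"
    unfolding measure_obs_law[OF A] using imp m
    by (intro P.finite_measure_mono) (auto simp: space_pair_measure)
  also have "\<dots> \<le> measure (gauss_pair p) (space ?N \<times> E) + measure (gauss_pair p) (F \<times> space ?Z)"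
    using m by (intro measure_Un_le)
  finally show ?thesis using E F 1 2 by linarith
qed

lemma obs_law_le':
  assumes "A \<in> sets (Rvec p)" "E \<in> sets (gauss_vec p)" "measure (gauss_vec p) E \<le> d"
    and "\<And>w z. z \<in> space (gauss_vec p) \<Longrightarrow> z \<notin> E \<Longrightarrow> obs_map p \<gamma> \<theta> (w, z) \<notin> A"
  shows "measure (obs_law p \<gamma> \<theta>) A \<le> d"
  using obs_law_le[OF assms(1-3), of "{}" 0 \<gamma> \<theta>] assms(4) by simp

section \<open>Centering\<close>

text \<open>The mean of the coordinates.\<close>

definition vec_mean :: "nat \<Rightarrow> (nat \<Rightarrow> real) \<Rightarrow> real" where
  "vec_mean p x = (\<Sum>i<p. x i) / p"

lemma vec_mean_obs_map:
  assumes "1 \<le> p"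
  shows "vec_mean p (obs_map p \<gamma> \<theta> (w, z)) = vec_mean p \<theta> + sqrt \<gamma> * w + sqrt (1 - \<gamma>) * vec_mean p z"
  using assms by (simp add: vec_mean_def obs_map_def sum.distrib sum_distrib_left[symmetric] add_divide_distrib)

lemma obs_map_centered:
  assumes "1 \<le> p" "i < p"
  shows "obs_map p \<gamma> \<theta> (w, z) i - vec_mean p (obs_map p \<gamma> \<theta> (w, z))
    = (\<theta> i - vec_mean p \<theta>) + sqrt (1 - \<gamma>) * (z i - vec_mean p z)"
  using assms by (simp add: vec_mean_obs_map[OF assms(1)]) (simp add: obs_map_def algebra_simps)

lemma sum_centered: "(\<Sum>i<p. x i - vec_mean p x) = 0"
  by (cases "p = 0") (simp_all add: vec_mean_def sum_subtractf)

lemma sum_sq_centered: "(\<Sum>i<p. (x i - vec_mean p x)\<^sup>2) = (\<Sum>i<p. (x i)\<^sup>2) - p * (vec_mean p x)\<^sup>2"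
proof (cases "p = 0")
  case False
  have "(\<Sum>i<p. (x i - vec_mean p x)\<^sup>2) = (\<Sum>i<p. (x i)\<^sup>2) - 2 * vec_mean p x * (\<Sum>i<p. x i) + p * (vec_mean p x)\<^sup>2"
    by (simp add: power2_eq_square algebra_simps sum.distrib sum_subtractf sum_distrib_left)
  also have "(\<Sum>i<p. x i) = p * vec_mean p x" using False by (simp add: vec_mean_def)
  finally show ?thesis by (simp add: power2_eq_square algebra_simps)
qed simp

lemma vec_mean_measurable [measurable]: "vec_mean p \<in> borel_measurable (Rvec p)"
  unfolding vec_mean_def[abs_def] by measurable

section \<open>The centered sum of squares\<close>

text \<open>Rejection for a large centered sum of squares. The threshold is not divided by \<open>1 - \<gamma>\<close>, so the region
  is meaningful for \<open>\<gamma> = 1\<close>, where it rejects exactly the nonconstant vectors.\<close>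

definition chisq_region :: "nat \<Rightarrow> real \<Rightarrow> real \<Rightarrow> (nat \<Rightarrow> real) set" where
  "chisq_region p \<gamma> K = {x \<in> space (Rvec p). (\<Sum>i<p. (x i - vec_mean p x)\<^sup>2) > (1 - \<gamma>) * (p + K * sqrt p)}"

lemma chisq_region_sets [measurable]: "chisq_region p \<gamma> K \<in> sets (Rvec p)"
  unfolding chisq_region_def by measurable

lemma chisq_null:
  assumes p: "1 \<le> p" and \<gamma>: "0 \<le> \<gamma>" "\<gamma> \<le> 1" and K: "0 < K"
  shows "measure (obs_law p \<gamma> (\<lambda>i\<in>{..<p}. 0)) (chisq_region p \<gamma> K) \<le> 2 / K\<^sup>2"
proof (rule obs_law_le'[OF _ sum_sq_tail[OF K p]])
  fix w z assume z: "z \<in> space (gauss_vec p)" 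
    "z \<notin> {z \<in> space (gauss_vec p). K * sqrt p \<le> \<bar>(\<Sum>i<p. (z i)\<^sup>2) - p\<bar>}"
  define x where "x = obs_map p \<gamma> (\<lambda>i\<in>{..<p}. 0) (w, z)"
  have "vec_mean p (\<lambda>i\<in>{..<p}. 0) = 0" by (simp add: vec_mean_def)
  then have "(\<Sum>i<p. (x i - vec_mean p x)\<^sup>2) = (\<Sum>i<p. (1 - \<gamma>) * (z i - vec_mean p z)\<^sup>2)"
    using p \<gamma> unfolding x_def by (intro sum.cong refl) (simp add: obs_map_centered[OF p] power_mult_distrib)
  also have "\<dots> = (1 - \<gamma>) * ((\<Sum>i<p. (z i)\<^sup>2) - p * (vec_mean p z)\<^sup>2)"
    by (simp add: sum_distrib_left[symmetric] sum_sq_centered)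
  also have "\<dots> \<le> (1 - \<gamma>) * (p + K * sqrt p)"
  proof (rule mult_left_mono)
    have a: "0 \<le> p * (vec_mean p z)\<^sup>2" "(\<Sum>i<p. (z i)\<^sup>2) - p < K * sqrt p"
      using z by (simp_all add: not_le abs_less_iff)
    show "(\<Sum>i<p. (z i)\<^sup>2) - p * (vec_mean p z)\<^sup>2 \<le> p + K * sqrt p"
      using a by linarith
  qed (use \<gamma> in simp)
  finally show "x \<notin> chisq_region p \<gamma> K" by (simp add: chisq_region_def)
qed simp

lemma chisq_alt:
  fixes p :: nat and \<gamma> K :: real and \<theta> :: "nat \<Rightarrow> real"
  assumes p: "1 \<le> p" and \<gamma>: "0 \<le> \<gamma>" "\<gamma> \<le> 1" and K: "1 \<le> K"
  defines "V \<equiv> \<Sum>i<p. (\<theta> i - vec_mean p \<theta>)\<^sup>2"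
  assumes V: "0 < V" "16 * K\<^sup>2 * ((1 - \<gamma>) * sqrt p) \<le> V"
  shows "measure (obs_law p \<gamma> \<theta>) (space (Rvec p) - chisq_region p \<gamma> K) \<le> 4 / K\<^sup>2"
proof -
  define v where "v i = \<theta> i - vec_mean p \<theta>" for i
  define s where "s = sqrt (1 - \<gamma>)"
  have s: "0 \<le> s" "s\<^sup>2 = 1 - \<gamma>" using \<gamma> by (auto simp: s_def)
  have K0: "0 < K" using K by simp
  have V_eq: "V = (\<Sum>i<p. (v i)\<^sup>2)" by (simp add: V_def v_def)
  let ?E1 = "{z \<in> space (gauss_vec p). K * sqrt p \<le> \<bar>(\<Sum>i<p. (z i)\<^sup>2) - p\<bar>}"
  let ?E2 = "{z \<in> space (gauss_vec p). K * sqrt (\<Sum>i<p. (v i)\<^sup>2) \<le> \<bar>\<Sum>i<p. v i * z i\<bar>}"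
  let ?E3 = "{z \<in> space (gauss_vec p). K * sqrt p \<le> \<bar>\<Sum>i<p. z i\<bar>}"
  note E1 = sum_sq_tail[OF K0 p] and E2 = linear_form_tail[OF K0 V(1)[unfolded V_eq]]
    and E3 = sum_tail[OF K0 p]
  show ?thesis
  proof (rule obs_law_le'[where E = "?E1 \<union> (?E2 \<union> ?E3)"])
    have "measure (gauss_vec p) (?E1 \<union> (?E2 \<union> ?E3)) \<le>
        measure (gauss_vec p) ?E1 + (measure (gauss_vec p) ?E2 + measure (gauss_vec p) ?E3)"
      by (intro order_trans[OF measure_Un_le] add_left_mono measure_Un_le sets.Un E1 E2 E3)
    also have "\<dots> \<le> 2 / K\<^sup>2 + (1 / K\<^sup>2 + 1 / K\<^sup>2)"
      by (intro add_mono E1 E2 E3)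
    finally show "measure (gauss_vec p) (?E1 \<union> (?E2 \<union> ?E3)) \<le> 4 / K\<^sup>2" by simp
  next
    fix w z assume z: "z \<in> space (gauss_vec p)" "z \<notin> ?E1 \<union> (?E2 \<union> ?E3)"
    define x where "x = obs_map p \<gamma> \<theta> (w, z)"
    have z1: "p - K * sqrt p < (\<Sum>i<p. (z i)\<^sup>2)" using z by auto
    have z2: "- (K * sqrt V) < (\<Sum>i<p. v i * z i)" using z by (auto simp: V_eq)
    have "\<bar>\<Sum>i<p. z i\<bar> < K * sqrt p" using z by auto
    then have "(\<Sum>i<p. z i)\<^sup>2 \<le> (K * sqrt p)\<^sup>2" by (intro abs_le_square_iff[THEN iffD1]) (use K0 in auto)
    then have z3: "p * (vec_mean p z)\<^sup>2 \<le> K\<^sup>2"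
      using p by (simp add: vec_mean_def power_divide power_mult_distrib power2_eq_square field_simps)
    have "(\<Sum>i<p. (x i - vec_mean p x)\<^sup>2) = (\<Sum>i<p. (v i + s * (z i - vec_mean p z))\<^sup>2)"
      using p by (intro sum.cong refl) (simp add: obs_map_centered[OF p] x_def v_def s_def)
    also have "\<dots> = V + 2 * s * (\<Sum>i<p. v i * z i) - 2 * s * vec_mean p z * (\<Sum>i<p. v i)
        + s\<^sup>2 * (\<Sum>i<p. (z i - vec_mean p z)\<^sup>2)"
      unfolding V_eq sum_distrib_left sum.distrib[symmetric] sum_subtractf[symmetric]
      by (intro sum.cong refl) (simp add: power2_eq_square algebra_simps)
    also have "(\<Sum>i<p. v i) = 0" by (simp add: v_def sum_centered)
    also have "V + 2 * s * (\<Sum>i<p. v i * z i) - 2 * s * vec_mean p z * 0 + s\<^sup>2 * (\<Sum>i<p. (z i - vec_mean p z)\<^sup>2)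
        \<ge> V + 2 * s * (- (K * sqrt V)) + s\<^sup>2 * ((p - K * sqrt p) - K\<^sup>2)"
    proof -
      have "2 * s * (- (K * sqrt V)) \<le> 2 * s * (\<Sum>i<p. v i * z i)"
        using z2 s by (intro mult_left_mono) auto
      moreover have "s\<^sup>2 * ((p - K * sqrt p) - K\<^sup>2) \<le> s\<^sup>2 * (\<Sum>i<p. (z i - vec_mean p z)\<^sup>2)"
        using z1 z3 unfolding sum_sq_centered by (intro mult_left_mono) auto
      ultimately show ?thesis by linarith
    qed
    finally have Q: "V - 2 * (s * K * sqrt V) + s\<^sup>2 * (p - K * sqrt p - K\<^sup>2) \<le> (\<Sum>i<p. (x i - vec_mean p x)\<^sup>2)"
      by simp
    have sp: "1 \<le> sqrt p" using p by simp
    have sq: "s\<^sup>2 * 1 \<le> s\<^sup>2 * sqrt p" using sp by (intro mult_left_mono) auto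
    have "(4 * (s * K))\<^sup>2 = 16 * K\<^sup>2 * (s\<^sup>2 * 1)" by (simp add: power_mult_distrib)
    also have "\<dots> \<le> 16 * K\<^sup>2 * (s\<^sup>2 * sqrt p)" by (rule mult_left_mono[OF sq]) simp
    also have "\<dots> \<le> V" using V s by simp
    \<comment> \<open>Half of \<open>V\<close> pays for the cross term and a quarter for the fluctuations of the noise.\<close>
    finally have "4 * (s * K) \<le> sqrt V" by (rule real_le_rsqrt)
    then have "4 * (s * K) * sqrt V \<le> sqrt V * sqrt V" using V by (intro mult_right_mono) auto
    then have a: "2 * (s * K * sqrt V) \<le> V / 2" using V by simp
    have "s\<^sup>2 * (2 * K * sqrt p + K\<^sup>2) \<le> s\<^sup>2 * (4 * K\<^sup>2 * sqrt p)"
    proof (intro mult_left_mono)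
      have "K * 1 \<le> K * K" using K by (intro mult_left_mono) auto
      then have "2 * K * sqrt p \<le> 2 * K\<^sup>2 * sqrt p" by (intro mult_right_mono) (auto simp: power2_eq_square)
      moreover have "K\<^sup>2 * 1 \<le> K\<^sup>2 * sqrt p" using sp by (intro mult_left_mono) auto
      moreover have "0 \<le> K\<^sup>2 * sqrt p" by simp
      ultimately show "2 * K * sqrt p + K\<^sup>2 \<le> 4 * K\<^sup>2 * sqrt p" by linarith
    qed simp
    also have "\<dots> = (16 * K\<^sup>2 * ((1 - \<gamma>) * sqrt p)) / 4" using s by simp
    also have "\<dots> \<le> V / 4" using V(2) by (rule divide_right_mono) simp
    finally have "s\<^sup>2 * (2 * K * sqrt p + K\<^sup>2) \<le> V / 4" .
    then have "s\<^sup>2 * (p + K * sqrt p) < V - 2 * (s * K * sqrt V) + s\<^sup>2 * (p - K * sqrt p - K\<^sup>2)"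
      using a V by (simp add: algebra_simps)
    with Q have "s\<^sup>2 * (p + K * sqrt p) < (\<Sum>i<p. (x i - vec_mean p x)\<^sup>2)" by linarith
    moreover have "x \<in> space (Rvec p)" by (simp add: x_def obs_map_def space_PiM)
    ultimately show "x \<notin> space (Rvec p) - chisq_region p \<gamma> K"
      using s by (simp add: chisq_region_def)
  qed (use E1 E2 E3 in auto)
qed

section \<open>The mean test\<close>

text \<open>Rejection for a large mean of the observation.\<close>

definition mean_region :: "nat \<Rightarrow> real \<Rightarrow> real \<Rightarrow> (nat \<Rightarrow> real) set" where
  "mean_region p \<gamma> K = {x \<in> space (Rvec p). p * (vec_mean p x)\<^sup>2 > K\<^sup>2 * (1 - \<gamma> + \<gamma> * p)}"

lemma mean_region_sets [measurable]: "mean_region p \<gamma> K \<in> sets (Rvec p)"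
  unfolding mean_region_def by measurable

lemma vec_mean_noise_le:
  fixes p :: nat and \<gamma> K w :: real
  assumes p: "1 \<le> p" and \<gamma>: "0 \<le> \<gamma>" "\<gamma> \<le> 1" and K: "0 < K"
    and w: "\<bar>w\<bar> \<le> K" and z: "\<bar>\<Sum>i<p. z i\<bar> \<le> K * sqrt p"
  shows "sqrt p * \<bar>sqrt \<gamma> * w + sqrt (1 - \<gamma>) * vec_mean p z\<bar> \<le> 2 * K * sqrt (1 - \<gamma> + \<gamma> * p)"
proof -
  let ?B = "1 - \<gamma> + \<gamma> * p"
  have B: "\<gamma> * p \<le> ?B" "1 - \<gamma> \<le> ?B" using \<gamma> by auto
  have "\<bar>sqrt p * (sqrt \<gamma> * w)\<bar> = sqrt (\<gamma> * p) * \<bar>w\<bar>" by (simp add: real_sqrt_mult abs_mult \<gamma>)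
  also have "\<dots> \<le> sqrt ?B * K" using w \<gamma> B by (intro mult_mono real_sqrt_le_mono) auto
  finally have 1: "\<bar>sqrt p * (sqrt \<gamma> * w)\<bar> \<le> sqrt ?B * K" .
  have "\<bar>sqrt p * (sqrt (1 - \<gamma>) * vec_mean p z)\<bar> = sqrt (1 - \<gamma>) * (\<bar>\<Sum>i<p. z i\<bar> / sqrt p)"
    using p \<gamma> by (simp add: vec_mean_def abs_mult real_div_sqrt field_simps)
  also have "\<dots> \<le> sqrt ?B * K"
    using z p \<gamma> B by (intro mult_mono real_sqrt_le_mono) (auto simp: divide_le_eq)
  finally have 2: "\<bar>sqrt p * (sqrt (1 - \<gamma>) * vec_mean p z)\<bar> \<le> sqrt ?B * K" .
  have "sqrt p * \<bar>sqrt \<gamma> * w + sqrt (1 - \<gamma>) * vec_mean p z\<bar>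
      = \<bar>sqrt p * (sqrt \<gamma> * w) + sqrt p * (sqrt (1 - \<gamma>) * vec_mean p z)\<bar>"
    by (simp add: distrib_left[symmetric] abs_mult)
  also have "\<dots> \<le> sqrt ?B * K + sqrt ?B * K"
    by (intro order_trans[OF abs_triangle_ineq] add_mono 1 2)
  finally show ?thesis by (simp add: mult_ac)
qed

lemma mean_null:
  assumes p: "1 \<le> p" and \<gamma>: "0 \<le> \<gamma>" "\<gamma> \<le> 1" and K: "0 < K"
  shows "measure (obs_law p \<gamma> (\<lambda>i\<in>{..<p}. 0)) (mean_region p \<gamma> (2 * K)) \<le> 2 / K\<^sup>2"
proof -
  have "measure (obs_law p \<gamma> (\<lambda>i\<in>{..<p}. 0)) (mean_region p \<gamma> (2 * K)) \<le> 1 / K\<^sup>2 + 1 / K\<^sup>2"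
  proof (rule obs_law_le[OF _ sum_tail[OF K p] _ std_normal_tail[OF K]])
    fix w z assume wz: "w \<notin> {x. K \<le> \<bar>x\<bar>}" "z \<in> space (gauss_vec p)"
      "z \<notin> {z \<in> space (gauss_vec p). K * sqrt p \<le> \<bar>\<Sum>i<p. z i\<bar>}"
    define x where "x = obs_map p \<gamma> (\<lambda>i\<in>{..<p}. 0) (w, z)"
    have "vec_mean p (\<lambda>i\<in>{..<p}. 0) = 0" by (simp add: vec_mean_def)
    then have "sqrt p * \<bar>vec_mean p x\<bar> \<le> 2 * K * sqrt (1 - \<gamma> + \<gamma> * p)"
      using vec_mean_noise_le[OF p \<gamma> K, of w z] wz by (simp add: x_def vec_mean_obs_map[OF p] add.assoc)
    then have "(sqrt p * \<bar>vec_mean p x\<bar>)\<^sup>2 \<le> (2 * K * sqrt (1 - \<gamma> + \<gamma> * p))\<^sup>2"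
      by (intro power_mono) auto
    then have "p * (vec_mean p x)\<^sup>2 \<le> (2 * K)\<^sup>2 * (1 - \<gamma> + \<gamma> * p)"
      using \<gamma> by (simp add: power_mult_distrib)
    then show "x \<notin> mean_region p \<gamma> (2 * K)" by (simp add: mean_region_def)
  qed measurable
  then show ?thesis by simp
qed

text \<open>With noise up to \<open>2 K\<close> standard units, a mean of \<open>5 K\<close> units stays above the level \<open>2 K\<close>.\<close>

lemma mean_alt:
  assumes p: "1 \<le> p" and \<gamma>: "0 \<le> \<gamma>" "\<gamma> \<le> 1" and K: "0 < K"
    and \<theta>: "25 * K\<^sup>2 * (1 - \<gamma> + \<gamma> * p) \<le> p * (vec_mean p \<theta>)\<^sup>2"
  shows "measure (obs_law p \<gamma> \<theta>) (space (Rvec p) - mean_region p \<gamma> (2 * K)) \<le> 2 / K\<^sup>2"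
proof -
  let ?B = "1 - \<gamma> + \<gamma> * p"
  have "\<gamma> * 1 \<le> \<gamma> * p" using p \<gamma> by (intro mult_left_mono) auto
  then have B: "0 < ?B" by linarith
  have "measure (obs_law p \<gamma> \<theta>) (space (Rvec p) - mean_region p \<gamma> (2 * K)) \<le> 1 / K\<^sup>2 + 1 / K\<^sup>2"
  proof (rule obs_law_le[OF _ sum_tail[OF K p] _ std_normal_tail[OF K]])
    fix w z assume wz: "w \<notin> {x. K \<le> \<bar>x\<bar>}" "z \<in> space (gauss_vec p)"
      "z \<notin> {z \<in> space (gauss_vec p). K * sqrt p \<le> \<bar>\<Sum>i<p. z i\<bar>}"
    define x where "x = obs_map p \<gamma> \<theta> (w, z)"
    define e where "e = sqrt \<gamma> * w + sqrt (1 - \<gamma>) * vec_mean p z"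
    have x: "vec_mean p x = vec_mean p \<theta> + e" by (simp add: x_def e_def vec_mean_obs_map[OF p] add.assoc)
    have e: "sqrt p * \<bar>e\<bar> \<le> 2 * K * sqrt ?B"
      using vec_mean_noise_le[OF p \<gamma> K, of w z] wz by (simp add: e_def)
    have "(5 * K * sqrt ?B)\<^sup>2 \<le> (sqrt p * \<bar>vec_mean p \<theta>\<bar>)\<^sup>2"
      using \<theta> B by (simp add: power_mult_distrib)
    then have "5 * K * sqrt ?B \<le> sqrt p * \<bar>vec_mean p \<theta>\<bar>"
      by (rule power2_le_imp_le) auto
    also have "\<dots> \<le> sqrt p * (\<bar>vec_mean p x\<bar> + \<bar>e\<bar>)"
      unfolding x by (intro mult_left_mono) auto
    finally have "3 * K * sqrt ?B \<le> sqrt p * \<bar>vec_mean p x\<bar>"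
      using e by (simp add: distrib_left)
    moreover have "2 * K * sqrt ?B < 3 * K * sqrt ?B" using K B by simp
    ultimately have "2 * K * sqrt ?B < sqrt p * \<bar>vec_mean p x\<bar>" by linarith
    then have "(2 * K * sqrt ?B)\<^sup>2 < (sqrt p * \<bar>vec_mean p x\<bar>)\<^sup>2"
      using K B by (intro power_strict_mono) auto
    then have "(2 * K)\<^sup>2 * ?B < p * (vec_mean p x)\<^sup>2"
      using B by (simp add: power_mult_distrib)
    moreover have "x \<in> space (Rvec p)" by (simp add: x_def obs_map_def space_PiM)
    ultimately show "x \<notin> space (Rvec p) - mean_region p \<gamma> (2 * K)" by (simp add: mean_region_def)
  qed measurable
  then show ?thesis by simp
qed

section \<open>The cosh statistic\<close>

lemma std_normal_cosh_moments:
  fixes l u :: real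
  shows "integrable std_normal_distribution (\<lambda>x. (cosh (l * (u + x)))\<^sup>2)"
    and "(\<integral>x. cosh (l * (u + x)) \<partial>std_normal_distribution) = cosh (l * u) * exp (l\<^sup>2 / 2)"
    and "(\<integral>x. (cosh (l * (u + x)))\<^sup>2 \<partial>std_normal_distribution)
      = (cosh (2 * l * u) * exp (2 * l\<^sup>2) + 1) / 2"
proof -
  interpret W: prob_space std_normal_distribution by (rule prob_space_std_normal)
  have eq: "cosh (l * (u + x)) = (exp (l * u) * exp (l * x) + exp (- (l * u)) * exp ((- l) * x)) / 2" for l u x :: real
    by (simp add: cosh_field_def exp_add[symmetric] algebra_simps)
  have int: "integrable std_normal_distribution (\<lambda>x. cosh (l * (u + x)))" for l u
    unfolding eq using integrable_exp_std_normal[of l] integrable_exp_std_normal[of "- l"] by simp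
  have mean: "(\<integral>x. cosh (l * (u + x)) \<partial>std_normal_distribution) = cosh (l * u) * exp (l\<^sup>2 / 2)" for l u
    unfolding eq using integrable_exp_std_normal[of l] integrable_exp_std_normal[of "- l"]
    by (simp add: integral_exp_std_normal integral_exp_std_normal[of "- l", simplified])
       (simp add: cosh_field_def field_simps)
  have sq: "(cosh (l * (u + x)))\<^sup>2 = (cosh ((2 * l) * (u + x)) + 1) / 2" for x
    using cosh_double_cosh[of "l * (u + x)"] by (simp add: mult.assoc)
  show "integrable std_normal_distribution (\<lambda>x. (cosh (l * (u + x)))\<^sup>2)"
    unfolding sq using int[of "2 * l" u] by simp
  show "(\<integral>x. cosh (l * (u + x)) \<partial>std_normal_distribution) = cosh (l * u) * exp (l\<^sup>2 / 2)"
    by (rule mean)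
  show "(\<integral>x. (cosh (l * (u + x)))\<^sup>2 \<partial>std_normal_distribution)
      = (cosh (2 * l * u) * exp (2 * l\<^sup>2) + 1) / 2"
    unfolding sq using int[of "2 * l" u] mean[of "2 * l" u]
    by (simp add: W.prob_space[simplified] power_mult_distrib)
qed

lemma cosh_sq_le_4:
  fixes a :: real
  assumes "\<bar>a\<bar> \<le> 1"
  shows "(cosh a)\<^sup>2 \<le> 4"
proof -
  have "cosh a = cosh \<bar>a\<bar>" by simp
  also have "\<dots> \<le> cosh 1" using assms by (subst cosh_real_nonneg_le_iff) auto
  also have "\<dots> \<le> 2"
  proof -
    have "exp 1 + exp (- 1) \<le> 3 + (1 :: real)" by (intro add_mono exp_le) simp
    then show ?thesis by (simp add: cosh_field_def)
  qed
  finally show ?thesis using power_mono[of "cosh a" 2 2] by simp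
qed

text \<open>The variance of \<open>cosh (l (u + Z))\<close> is of order \<open>L\<^sup>2\<close> as long as \<open>\<bar>l u\<bar> \<le> 1\<close>.\<close>

lemma cosh_sum_tail:
  fixes u :: "nat \<Rightarrow> real" and l L K :: real
  assumes G: "G \<subseteq> {..<p}" and p: "1 \<le> p" and K: "0 < K" and L: "1 \<le> L"
    and l: "exp (l\<^sup>2) = 1 + L" and u: "\<And>i. i \<in> G \<Longrightarrow> \<bar>l * u i\<bar> \<le> 1"
  defines "E \<equiv> {z \<in> space (gauss_vec p). K * sqrt p * L \<le>
    \<bar>(\<Sum>i\<in>G. cosh (l * (u i + z i))) - (\<Sum>i\<in>G. cosh (l * u i) * sqrt (1 + L))\<bar>}"
  shows "E \<in> sets (gauss_vec p)" "measure (gauss_vec p) E \<le> 8 / K\<^sup>2"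
proof -
  have sqrt: "exp (l\<^sup>2 / 2) = sqrt (1 + L)"
    unfolding l[symmetric] by (rule real_sqrt_unique[symmetric]) (auto simp: exp_double[symmetric])
  have exp2: "exp (2 * l\<^sup>2) = (1 + L)\<^sup>2" unfolding l[symmetric] by (simp add: exp_double)
  have t: "0 < K * sqrt p * L" using K p L by simp
  have var: "(\<integral>x. (cosh (l * (u i + x)))\<^sup>2 \<partial>std_normal_distribution) - (cosh (l * u i) * sqrt (1 + L))\<^sup>2 \<le> 8 * L\<^sup>2"
    if "i \<in> G" for i
  proof -
    define C where "C = (cosh (l * u i))\<^sup>2"
    have C: "C \<le> 4" using cosh_sq_le_4[OF u[OF that]] by (simp add: C_def)
    have cd: "cosh (2 * l * u i) = 2 * C - 1"
      using cosh_double_cosh[of "l * u i"] by (simp add: C_def mult.assoc)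
    have "(\<integral>x. (cosh (l * (u i + x)))\<^sup>2 \<partial>std_normal_distribution) - (cosh (l * u i) * sqrt (1 + L))\<^sup>2
        = ((2 * C - 1) * (1 + L)\<^sup>2 + 1) / 2 - C * (1 + L)"
      using L unfolding std_normal_cosh_moments(3) cd exp2 power_mult_distrib by (simp add: C_def)
    also have "\<dots> = C * ((1 + L) * L) - ((1 + L)\<^sup>2 - 1) / 2"
      by (simp add: power2_eq_square field_simps)
    also have "\<dots> \<le> C * ((1 + L) * L)" using L one_le_power[of "1 + L" 2] by simp
    also have "\<dots> \<le> 4 * ((1 + L) * L)" using C L by (intro mult_right_mono) auto
    also have "\<dots> \<le> 4 * ((L + L) * L)" using L by (intro mult_left_mono mult_right_mono) auto
    finally show ?thesis by (simp add: power2_eq_square)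
  qed
  note * = gauss_vec_Chebyshev[OF G t, where f = "\<lambda>i x. cosh (l * (u i + x))"
      and m = "\<lambda>i. cosh (l * u i) * sqrt (1 + L)" and V = "\<lambda>_. 8 * L\<^sup>2"]
  have meas: "(\<lambda>x. cosh (l * (u i + x))) \<in> borel_measurable borel" for i
    by (intro borel_measurable_continuous_onI continuous_intros)
  show "E \<in> sets (gauss_vec p)"
    unfolding E_def using var by (intro *(1) meas std_normal_cosh_moments(1)) (auto simp: std_normal_cosh_moments(2) sqrt)
  have "measure (gauss_vec p) E \<le> (\<Sum>i\<in>G. 8 * L\<^sup>2) / (K * sqrt p * L)\<^sup>2"
    unfolding E_def using var by (intro *(2) meas std_normal_cosh_moments(1)) (auto simp: std_normal_cosh_moments(2) sqrt)
  also have "\<dots> \<le> (\<Sum>i<p. 8 * L\<^sup>2) / (K * sqrt p * L)\<^sup>2"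
    using G by (intro divide_right_mono sum_mono2) auto
  also have "\<dots> = 8 / K\<^sup>2" using p L by (simp add: power_mult_distrib)
  finally show "measure (gauss_vec p) E \<le> 8 / K\<^sup>2" .
qed

text \<open>By Markov, the indices whose noise exceeds \<open>K\<close> carry less than half of the total weight, outside of
  an event of probability at most \<open>2 / K\<^sup>2\<close>. No second moment of the weights is involved.\<close>

lemma weight_tail:
  fixes w :: "nat \<Rightarrow> real"
  assumes S: "S \<subseteq> {..<p}" and w: "\<And>i. i \<in> S \<Longrightarrow> 0 \<le> w i" "0 < sum w S" and K: "0 < K"
  defines "E \<equiv> {z \<in> space (gauss_vec p). sum w S / 2 \<le> (\<Sum>i\<in>S. w i * of_bool (K \<le> \<bar>z i\<bar>))}"
  shows "E \<in> sets (gauss_vec p)" "measure (gauss_vec p) E \<le> 2 / K\<^sup>2"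
proof -
  interpret W: prob_space std_normal_distribution by (rule prob_space_std_normal)
  interpret Z: prob_space "gauss_vec p" by (rule prob_space_gauss_vec)
  have Sp: "i < p" if "i \<in> S" for i using S that by auto
  define g where "g x = (indicator {x. K \<le> \<bar>x\<bar>} x :: real)" for x :: real
  have g: "of_bool (K \<le> \<bar>x\<bar>) = g x" for x by (simp add: g_def indicator_def)
  have gm [measurable]: "g \<in> borel_measurable borel" unfolding g_def[abs_def] by measurable
  have gi: "integrable std_normal_distribution g"
    by (rule W.integrable_const_bound[where B = 1]) (auto simp: g_def)
  have "(\<integral>x. g x \<partial>std_normal_distribution) = W.prob {x. K \<le> \<bar>x\<bar>}"
    unfolding g_def by simp
  then have ge: "(\<integral>x. g x \<partial>std_normal_distribution) \<le> 1 / K\<^sup>2"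
    using std_normal_tail[OF K] by simp
  have int: "integrable (gauss_vec p) (\<lambda>z. \<Sum>i\<in>S. w i * g (z i))"
    using Sp gi by (auto intro!: integrable_gauss_vec_component(1))
  then have "(\<lambda>z. \<Sum>i\<in>S. w i * g (z i)) \<in> borel_measurable (gauss_vec p)" by auto
  then show "E \<in> sets (gauss_vec p)" unfolding E_def g by measurable
  have "measure (gauss_vec p) E \<le> (\<integral>z. (\<Sum>i\<in>S. w i * g (z i)) \<partial>gauss_vec p) / (sum w S / 2)"
    unfolding E_def g using int w
    by (intro integral_Markov_inequality_measure[where A = "{}"]) (auto intro!: sum_nonneg simp: g_def)
  also have "(\<integral>z. (\<Sum>i\<in>S. w i * g (z i)) \<partial>gauss_vec p) = (\<Sum>i\<in>S. w i * (\<integral>x. g x \<partial>std_normal_distribution))"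
    using Sp gi by (subst Bochner_Integration.integral_sum)
      (auto intro!: integrable_gauss_vec_component sum.cong simp: integrable_gauss_vec_component(2))
  also have "\<dots> \<le> (\<Sum>i\<in>S. w i * (1 / K\<^sup>2))"
    using ge w by (intro sum_mono mult_left_mono) auto
  also have "(\<Sum>i\<in>S. w i * (1 / K\<^sup>2)) / (sum w S / 2) = 2 / K\<^sup>2"
    using w by (simp add: sum_divide_distrib[symmetric] field_simps)
  finally show "measure (gauss_vec p) E \<le> 2 / K\<^sup>2"
    using w by (simp add: divide_right_mono)
qed

lemma cosh_shift_bounds:
  fixes x y h :: real
  assumes "\<bar>y\<bar> \<le> h"
  shows "cosh (x - y) \<le> exp h * cosh x" "exp (- h) * cosh x \<le> cosh (x - y)"
proof -
  have *: "cosh (x - y) = (exp (- y) * exp x + exp y * exp (- x)) / 2"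
    by (simp add: cosh_field_def exp_add[symmetric])
  have "exp (- y) * exp x + exp y * exp (- x) \<le> exp h * exp x + exp h * exp (- x)"
    using assms by (intro add_mono mult_right_mono) auto
  then show "cosh (x - y) \<le> exp h * cosh x"
    unfolding * by (simp add: cosh_field_def field_simps)
  have "exp (- h) * exp x + exp (- h) * exp (- x) \<le> exp (- y) * exp x + exp y * exp (- x)"
    using assms by (intro add_mono mult_right_mono) auto
  then show "exp (- h) * cosh x \<le> cosh (x - y)"
    unfolding * by (simp add: cosh_field_def field_simps)
qed

text \<open>The ratio \<open>p / k\<^sup>2\<close>, which is at least \<open>1\<close> where it is used.\<close>

definition sparsity_ratio :: "nat \<Rightarrow> nat \<Rightarrow> real" where
  "sparsity_ratio p k = p / (real k)\<^sup>2"

text \<open>The factor \<open>\<lambda>\<close> in the argument of the cosh statistic, tuned so that \<open>exp (\<lambda>\<^sup>2) = 1 + p / k\<^sup>2\<close>.\<close>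

definition tilt :: "nat \<Rightarrow> nat \<Rightarrow> real" where
  "tilt p k = sqrt (ln (1 + sparsity_ratio p k))"

lemma tilt_bounds:
  fixes p k :: nat and L l :: real
  assumes "1 \<le> k" "k\<^sup>2 \<le> p"
  defines "L \<equiv> sparsity_ratio p k" and "l \<equiv> tilt p k"
  shows "1 \<le> L" "exp (l\<^sup>2) = 1 + L" "1 / 2 \<le> l\<^sup>2" "1 / 2 \<le> l" "l\<^sup>2 \<le> p"
    "l\<^sup>2 * sqrt (1 + L) \<le> 2 * L" "l * sqrt (1 + L) \<le> 2 * L" "sqrt (1 + L) \<le> 2 * L"
    "sqrt p * L = k * (sqrt L * L)" "l\<^sup>2 = ln (1 + p / (real k)\<^sup>2)"
proof -
  have k: "(real k)\<^sup>2 \<le> p" "1 \<le> (real k)\<^sup>2"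
    using assms(1,2) by (metis of_nat_le_iff of_nat_power, simp)
  have k0: "0 < (real k)\<^sup>2" using k(2) by linarith
  show L: "1 \<le> L"
    using k(1) unfolding L_def sparsity_ratio_def le_divide_eq_1_pos[OF k0] .
  have "p / (real k)\<^sup>2 \<le> p / 1" using k k0 by (intro divide_left_mono) auto
  then have Lp: "L \<le> p" by (simp add: L_def sparsity_ratio_def)
  have l2: "l\<^sup>2 = ln (1 + L)" using L by (simp add: l_def tilt_def L_def)
  show "l\<^sup>2 = ln (1 + p / (real k)\<^sup>2)" using l2 by (simp add: L_def sparsity_ratio_def)
  show "exp (l\<^sup>2) = 1 + L" using L by (simp add: l2)
  have "ln 2 \<le> ln (1 + L)" using L by (subst ln_le_cancel_iff) auto
  moreover have "1 / 2 \<le> ln (2::real)" using ln2_ge_two_thirds by simp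
  ultimately show l2h: "1 / 2 \<le> l\<^sup>2" unfolding l2 by linarith
  have l0: "0 \<le> l" using L by (simp add: l_def tilt_def L_def)
  show "1 / 2 \<le> l"
    by (rule power2_le_imp_le[OF _ l0]) (use l2h in \<open>simp add: power_divide\<close>)
  have "ln (1 + L) \<le> L" using L by (intro ln_add_one_self_le_self) auto
  then show "l\<^sup>2 \<le> p" using Lp l2 by simp
  define r where "r = sqrt (1 + L)"
  have r: "1 \<le> r" "r\<^sup>2 = 1 + L" using L by (auto simp: r_def)
  have "l\<^sup>2 = 2 * ln r" unfolding l2 r_def using L by (simp add: ln_sqrt)
  also have "\<dots> \<le> 2 * (r - 1)" using r ln_le_minus_one[of r] by simp
  finally have "l\<^sup>2 * r \<le> 2 * (r - 1) * r" using r by (intro mult_right_mono) auto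
  also have "\<dots> \<le> 2 * L" using r by (simp add: power2_eq_square algebra_simps)
  finally show "l\<^sup>2 * sqrt (1 + L) \<le> 2 * L" by (simp add: r_def)
  have LL: "L \<le> L * L" using L by simp
  have "1 + L \<le> 4 * (L * L)" using L LL by linarith
  then have "r\<^sup>2 \<le> (2 * L)\<^sup>2" unfolding r(2) by (simp add: power2_eq_square)
  then have "r \<le> 2 * L" by (rule power2_le_imp_le) (use L in simp)
  then show "sqrt (1 + L) \<le> 2 * L" by (simp add: r_def)
  have "(l * r)\<^sup>2 \<le> L * (2 * L)"
    unfolding power_mult_distrib r(2) using \<open>ln (1 + L) \<le> L\<close> L l2 by (intro mult_mono) auto
  also have "\<dots> \<le> (2 * L)\<^sup>2" by (simp add: power2_eq_square)
  finally have "l * r \<le> 2 * L" by (rule power2_le_imp_le) (use L in simp)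
  then show "l * sqrt (1 + L) \<le> 2 * L" by (simp add: r_def)
  have "real p = (real k)\<^sup>2 * L" using assms(1) by (simp add: L_def sparsity_ratio_def)
  then have "sqrt p = k * sqrt L" by (simp add: real_sqrt_mult)
  then show "sqrt p * L = k * (sqrt L * L)" by simp
qed

text \<open>The multiple of \<open>sqrt p \<cdot> p / k\<^sup>2\<close> by which the cosh statistic must exceed its null mean. It covers the
  fluctuation of the statistic and the error caused by centering at the empirical mean.\<close>

definition cosh_level :: "real \<Rightarrow> real" where
  "cosh_level K = 4 * K\<^sup>2 * exp K"

text \<open>Rejection for a large cosh statistic of the centered and rescaled observation; without the empirical
  mean of the noise, the null mean of the statistic would be \<open>p * sqrt (1 + p / k\<^sup>2)\<close>.\<close>

definition cosh_region :: "nat \<Rightarrow> real \<Rightarrow> nat \<Rightarrow> real \<Rightarrow> (nat \<Rightarrow> real) set" where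
  "cosh_region p \<gamma> k K = {x \<in> space (Rvec p).
     (\<Sum>i<p. cosh (tilt p k * ((x i - vec_mean p x) / sqrt (1 - \<gamma>))))
       > p * sqrt (1 + sparsity_ratio p k) + cosh_level K * sqrt p * sparsity_ratio p k}"

lemma cosh_measurable [measurable]: "(cosh :: real \<Rightarrow> real) \<in> borel_measurable borel"
  by (intro borel_measurable_continuous_onI continuous_intros)

lemma cosh_region_sets [measurable]: "cosh_region p \<gamma> k K \<in> sets (Rvec p)"
  unfolding cosh_region_def by measurable

lemma tilt_mean_le:
  fixes z :: "nat \<Rightarrow> real"
  assumes p: "1 \<le> p" and k: "1 \<le> k" "k\<^sup>2 \<le> p" and K: "0 < K" and z: "\<bar>\<Sum>i<p. z i\<bar> \<le> K * sqrt p"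
  shows "\<bar>tilt p k * vec_mean p z\<bar> \<le> K" "sqrt p * \<bar>vec_mean p z\<bar> \<le> K"
proof -
  show 1: "sqrt p * \<bar>vec_mean p z\<bar> \<le> K"
  proof -
    have "sqrt p * \<bar>vec_mean p z\<bar> = \<bar>\<Sum>i<p. z i\<bar> / sqrt p"
      using p by (simp add: vec_mean_def real_div_sqrt field_simps)
    also have "\<dots> \<le> K" using z p by (simp add: divide_le_eq)
    finally show ?thesis .
  qed
  have t: "tilt p k \<le> sqrt p" "0 \<le> tilt p k"
    using tilt_bounds(4,5)[OF k] by (auto intro: real_le_rsqrt)
  have "\<bar>tilt p k * vec_mean p z\<bar> = tilt p k * \<bar>vec_mean p z\<bar>" using t by (simp add: abs_mult)
  also have "\<dots> \<le> sqrt p * \<bar>vec_mean p z\<bar>" using t by (intro mult_right_mono) auto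
  finally show "\<bar>tilt p k * vec_mean p z\<bar> \<le> K" using 1 by linarith
qed

lemma cosh_null:
  fixes p k :: nat
  assumes k: "1 \<le> k" "k\<^sup>2 \<le> p" and \<gamma>: "0 \<le> \<gamma>" "\<gamma> < 1" and K: "1 \<le> K"
  shows "measure (obs_law p \<gamma> (\<lambda>i\<in>{..<p}. 0)) (cosh_region p \<gamma> k K) \<le> 9 / K\<^sup>2"
proof -
  have "1 \<le> k\<^sup>2" using k by simp
  then have p: "1 \<le> p" using k by linarith
  define L where "L = sparsity_ratio p k"
  define l where "l = tilt p k"
  note b = tilt_bounds[OF k, folded L_def l_def]
  have K0: "0 < K" using K by simp
  let ?E1 = "{z \<in> space (gauss_vec p). K * sqrt p * L \<le>
    \<bar>(\<Sum>i<p. cosh (l * (0 + z i))) - (\<Sum>i<p. cosh (l * 0) * sqrt (1 + L))\<bar>}"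
  let ?E2 = "{z \<in> space (gauss_vec p). K * sqrt p \<le> \<bar>\<Sum>i<p. z i\<bar>}"
  have E1: "?E1 \<in> sets (gauss_vec p)" "measure (gauss_vec p) ?E1 \<le> 8 / K\<^sup>2"
    by (rule cosh_sum_tail[where u = "\<lambda>_. 0", OF order_refl p K0 b(1,2)], simp)+
  note E2 = sum_tail[OF K0 p]
  show ?thesis
  proof (rule obs_law_le'[where E = "?E1 \<union> ?E2"])
    have "measure (gauss_vec p) (?E1 \<union> ?E2) \<le> 8 / K\<^sup>2 + 1 / K\<^sup>2"
      by (intro order_trans[OF measure_Un_le] add_mono E1 E2)
    then show "measure (gauss_vec p) (?E1 \<union> ?E2) \<le> 9 / K\<^sup>2" by simp
  next
    fix w z assume z: "z \<in> space (gauss_vec p)" "z \<notin> ?E1 \<union> ?E2"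
    define x where "x = obs_map p \<gamma> (\<lambda>i\<in>{..<p}. 0) (w, z)"
    have m0: "vec_mean p (\<lambda>i\<in>{..<p}. 0) = 0" by (simp add: vec_mean_def)
    have z1: "(\<Sum>i<p. cosh (l * z i)) \<le> p * sqrt (1 + L) + K * (sqrt p * L)" using z by auto
    have z2: "\<bar>\<Sum>i<p. z i\<bar> \<le> K * sqrt p" using z by auto
    note h = tilt_mean_le[OF p k K0 z2, folded l_def]
    \<comment> \<open>Centering changes each cosh by a factor between \<open>exp (- h)\<close> and \<open>exp h\<close>, where \<open>h \<le> K l / sqrt p\<close>.\<close>
    define h where "h = \<bar>l * vec_mean p z\<bar>"
    have h0: "0 \<le> h" "h \<le> K" using h by (auto simp: h_def)
    have hp: "h * sqrt p \<le> K * l"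
    proof -
      have "h * sqrt p = l * (sqrt p * \<bar>vec_mean p z\<bar>)" using b(4) by (simp add: h_def abs_mult)
      also have "\<dots> \<le> l * K" using h b(4) by (intro mult_left_mono) auto
      finally show ?thesis by (simp add: mult.commute)
    qed
    have eh: "exp h \<le> 1 + h * exp K"
    proof -
      have "1 - h \<le> exp (- h)" using exp_ge_add_one_self[of "- h"] by simp
      then have "exp h * (1 - h) \<le> exp h * exp (- h)" by (intro mult_left_mono) auto
      then have "exp h \<le> 1 + h * exp h" by (simp add: exp_minus algebra_simps)
      moreover have "h * exp h \<le> h * exp K" using h0 by (intro mult_left_mono) auto
      ultimately show ?thesis by linarith
    qed
    define N where "N = sqrt p * L"
    have N0: "0 \<le> N" using b(1) by (simp add: N_def)
    have hr: "h * (p * sqrt (1 + L)) \<le> 2 * K * N"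
    proof -
      have "h * (p * sqrt (1 + L)) = (h * sqrt p) * sqrt (1 + L) * sqrt p" by (simp add: mult_ac)
      also have "\<dots> \<le> (K * l) * sqrt (1 + L) * sqrt p" using hp b(1) by (intro mult_right_mono) auto
      also have "\<dots> = K * (l * sqrt (1 + L)) * sqrt p" by simp
      also have "\<dots> \<le> K * (2 * L) * sqrt p" using b(7) K0 by (intro mult_right_mono mult_left_mono) auto
      finally show ?thesis by (simp add: N_def mult_ac)
    qed
    have "(\<Sum>i<p. cosh (l * ((x i - vec_mean p x) / sqrt (1 - \<gamma>)))) = (\<Sum>i<p. cosh (l * z i - l * vec_mean p z))"
    proof (intro sum.cong refl)
      fix i assume "i \<in> {..<p}"
      then have "(x i - vec_mean p x) / sqrt (1 - \<gamma>) = z i - vec_mean p z"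
        using \<gamma> by (simp add: x_def obs_map_centered[OF p] m0)
      then show "cosh (l * ((x i - vec_mean p x) / sqrt (1 - \<gamma>))) = cosh (l * z i - l * vec_mean p z)"
        by (simp only: right_diff_distrib)
    qed
    also have "\<dots> \<le> (\<Sum>i<p. exp h * cosh (l * z i))"
      by (intro sum_mono cosh_shift_bounds) (simp add: h_def)
    also have "\<dots> = exp h * (\<Sum>i<p. cosh (l * z i))" by (simp add: sum_distrib_left)
    also have "\<dots> \<le> (1 + h * exp K) * (p * sqrt (1 + L) + K * N)"
      using eh z1 by (intro mult_mono) (auto simp: N_def h0 intro!: sum_nonneg)
    also have "\<dots> = p * sqrt (1 + L) + K * N + exp K * (h * (p * sqrt (1 + L))) + (exp K * K * N) * h"
      by (simp add: algebra_simps)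
    also have "\<dots> \<le> p * sqrt (1 + L) + K * N + exp K * (2 * K * N) + (exp K * K * N) * K"
      using hr h0 K0 N0 by (intro add_mono mult_left_mono) auto
    also have "\<dots> \<le> p * sqrt (1 + L) + cosh_level K * N"
    proof -
      have e1: "1 \<le> exp K" using K0 by simp
      have KK: "K * 1 \<le> K * K" using K by (intro mult_left_mono) auto
      have "K * 1 \<le> (K * K) * exp K" using KK e1 K0 by (intro mult_mono) auto
      then have "K * N \<le> (K * K) * exp K * N" using N0 by (intro mult_right_mono) auto
      moreover have "exp K * (2 * K * N) \<le> exp K * (2 * (K * K) * N)"
        using KK N0 by (intro mult_left_mono mult_right_mono) auto
      ultimately show ?thesis by (simp add: cosh_level_def power2_eq_square algebra_simps)
    qed
    finally show "x \<notin> cosh_region p \<gamma> k K"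
      by (simp add: cosh_region_def l_def[symmetric] L_def[symmetric] N_def mult.assoc)
  qed (use E1 E2 in auto)
qed

lemma exp_abs_le_cosh:
  fixes x :: real
  shows "exp \<bar>x\<bar> / 2 \<le> cosh x"
  by (cases "0 \<le> x") (simp_all add: cosh_field_def)

text \<open>The set \<open>B\<close> of coordinates with at least half of the energy \<open>C\<^sup>2 l\<^sup>2\<close> that is guaranteed on average carries half
  of the guaranteed total. On it
  the weights \<open>exp (l \<bar>u\<^sub>i\<bar> / 2) / 2\<close>, which bound the cosh terms from below when the noise is moderate, beat
  any prescribed multiple of the null fluctuation \<open>sqrt p * L\<close> if \<open>C\<close> is large.\<close>

lemma signal_weight_sum:
  fixes u :: "nat \<Rightarrow> real" and C L l :: real
  assumes k: "1 \<le> k" "k\<^sup>2 \<le> p" and S: "finite S" "card S \<le> k" and C: "16 \<le> C"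
  defines "L \<equiv> sparsity_ratio p k" and "l \<equiv> tilt p k"
  defines "B \<equiv> {i \<in> S. C\<^sup>2 * l\<^sup>2 / 2 \<le> (u i)\<^sup>2}"
  assumes u: "C\<^sup>2 * k * l\<^sup>2 \<le> (\<Sum>i\<in>S. (u i)\<^sup>2)"
  shows "i \<in> B \<Longrightarrow> C / 4 \<le> \<bar>u i\<bar>"
    and "C\<^sup>2 / 512 * (sqrt p * L) \<le> (\<Sum>i\<in>B. exp (l * \<bar>u i\<bar> / 2) / 2)"
proof -
  note b = tilt_bounds[OF k, folded L_def l_def]
  have Cl: "C * l / 2 \<le> \<bar>u i\<bar>" if "i \<in> B" for i
  proof (rule power2_le_imp_le)
    have "0 \<le> C\<^sup>2 * l\<^sup>2" by simp
    moreover have "C\<^sup>2 * l\<^sup>2 / 2 \<le> (u i)\<^sup>2" using that by (simp add: B_def)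
    moreover have "(C * l / 2)\<^sup>2 = C\<^sup>2 * l\<^sup>2 / 4" by (simp add: power_mult_distrib power_divide)
    ultimately show "(C * l / 2)\<^sup>2 \<le> \<bar>u i\<bar>\<^sup>2" unfolding power2_abs by linarith
  qed simp
  have "C * (1 / 2) \<le> C * l" using b(4) C by (intro mult_left_mono) auto
  then show "C / 4 \<le> \<bar>u i\<bar>" if "i \<in> B" for i using Cl[OF that] by simp
  have energy: "C\<^sup>2 * k * l\<^sup>2 / 2 \<le> (\<Sum>i\<in>B. (u i)\<^sup>2)"
  proof -
    have "(\<Sum>i\<in>S. (u i)\<^sup>2) = (\<Sum>i\<in>B. (u i)\<^sup>2) + (\<Sum>i\<in>S - B. (u i)\<^sup>2)"
      using S by (subst sum.subset_diff[of B S]) (auto simp: B_def)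
    moreover have "(\<Sum>i\<in>S - B. (u i)\<^sup>2) \<le> (\<Sum>i\<in>S - B. C\<^sup>2 * l\<^sup>2 / 2)"
      by (intro sum_mono) (auto simp: B_def)
    moreover have "(\<Sum>i\<in>S - B. C\<^sup>2 * l\<^sup>2 / 2) \<le> k * (C\<^sup>2 * l\<^sup>2 / 2)"
    proof -
      have "card (S - B) \<le> k" using S card_mono[of S "S - B"] by auto
      then show ?thesis by (simp only: sum_constant) (intro mult_right_mono, auto)
    qed
    ultimately show ?thesis using u by (simp add: mult_ac)
  qed
  have w: "(1 + L)\<^sup>2 * l\<^sup>2 / 64 * (u i)\<^sup>2 \<le> exp (l * \<bar>u i\<bar> / 2) / 2" if "i \<in> B" for i
  proof -
    define y where "y = l * \<bar>u i\<bar> / 2"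
    have y0: "0 \<le> y" using b(4) by (simp add: y_def)
    have "l * (C * l / 2) / 2 \<le> y"
      unfolding y_def using Cl[OF that] b(4) by (intro divide_right_mono mult_left_mono) auto
    moreover have "16 * l\<^sup>2 \<le> C * l\<^sup>2" using C by (intro mult_right_mono) auto
    moreover have "l * (C * l / 2) / 2 = C * l\<^sup>2 / 4" by (simp add: power2_eq_square)
    ultimately have "2 * l\<^sup>2 \<le> y / 2" by linarith
    \<comment> \<open>One half of the exponent gives the power of \<open>1 + L\<close>, the other half is linear in the energy.\<close>
    then have "exp (2 * l\<^sup>2) \<le> exp (y / 2)" by simp
    then have 1: "(1 + L)\<^sup>2 \<le> exp (y / 2)" by (simp add: exp_double b(2))
    have "(y / 2)\<^sup>2 / 2 \<le> exp (y / 2)"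
      using exp_lower_Taylor_quadratic[of "y / 2"] y0 by linarith
    then have 2: "l\<^sup>2 * (u i)\<^sup>2 / 32 \<le> exp (y / 2)"
      by (simp add: y_def power_mult_distrib power_divide)
    have "(1 + L)\<^sup>2 * (l\<^sup>2 * (u i)\<^sup>2 / 32) \<le> exp (y / 2) * exp (y / 2)"
      using 1 2 by (intro mult_mono) auto
    also have "\<dots> = exp y" by (simp add: exp_add[symmetric])
    finally show ?thesis by (simp add: y_def mult_ac)
  qed
  have "C\<^sup>2 / 512 * (sqrt p * L) = C\<^sup>2 * k / 512 * (sqrt L * L)" unfolding b(9) by simp
  also have "\<dots> \<le> C\<^sup>2 * k / 512 * ((1 + L) * (1 + L))"
  proof (intro mult_left_mono mult_mono)
    show "sqrt L \<le> 1 + L"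
      using b(1) by (intro real_le_lsqrt) (auto simp: power2_eq_square algebra_simps)
  qed (use b(1) in auto)
  also have "\<dots> = (1 + L)\<^sup>2 * (1 / 2) / 64 * (C\<^sup>2 * k * (1 / 2) / 2)" by (simp add: power2_eq_square)
  also have "\<dots> \<le> (1 + L)\<^sup>2 * l\<^sup>2 / 64 * (C\<^sup>2 * k * l\<^sup>2 / 2)"
    using b(3) by (intro mult_mono divide_right_mono mult_left_mono) auto
  also have "\<dots> \<le> (1 + L)\<^sup>2 * l\<^sup>2 / 64 * (\<Sum>i\<in>B. (u i)\<^sup>2)"
    using energy by (intro mult_left_mono) auto
  also have "\<dots> \<le> (\<Sum>i\<in>B. exp (l * \<bar>u i\<bar> / 2) / 2)"
    unfolding sum_distrib_left using w by (intro sum_mono)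
  finally show "C\<^sup>2 / 512 * (sqrt p * L) \<le> (\<Sum>i\<in>B. exp (l * \<bar>u i\<bar> / 2) / 2)" .
qed

text \<open>Dropping \<open>S\<close> and the coordinates with \<open>\<bar>l u\<^sub>i\<bar> > 1\<close> costs at most
  \<open>card S + l\<^sup>2 \<parallel>u\<parallel>\<^sup>2\<close> of the \<open>p\<close> coordinates.\<close>

lemma card_small_coords:
  fixes u :: "nat \<Rightarrow> real" and l :: real
  assumes S: "S \<subseteq> {..<p}"
  defines "G \<equiv> {i \<in> {..<p} - S. \<bar>l * u i\<bar> \<le> 1}"
  shows "real p - card S - l\<^sup>2 * (\<Sum>i<p. (u i)\<^sup>2) \<le> card G"
proof -
  define H where "H = {i \<in> {..<p}. 1 < \<bar>l * u i\<bar>}"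
  have "{..<p} \<subseteq> G \<union> (S \<union> H)" using S by (auto simp: G_def H_def)
  then have "card {..<p} \<le> card (G \<union> (S \<union> H))"
    using S by (intro card_mono) (auto simp: G_def H_def intro: finite_subset)
  also have "\<dots> \<le> card G + (card S + card H)"
    by (intro order_trans[OF card_Un_le] add_left_mono card_Un_le)
  finally have "real p \<le> card G + card S + card H" by simp
  moreover have "real (card H) \<le> l\<^sup>2 * (\<Sum>i<p. (u i)\<^sup>2)"
  proof -
    have "real (card H) = (\<Sum>i\<in>H. 1)" by simp
    also have "\<dots> \<le> (\<Sum>i\<in>H. (l * u i)\<^sup>2)"
    proof (intro sum_mono)
      fix i assume "i \<in> H"
      then have "1 \<le> \<bar>l * u i\<bar>" by (simp add: H_def)
      then have "1\<^sup>2 \<le> \<bar>l * u i\<bar>\<^sup>2" by (intro power_mono) auto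
      then show "1 \<le> (l * u i)\<^sup>2" by simp
    qed
    also have "\<dots> \<le> (\<Sum>i<p. (l * u i)\<^sup>2)" by (intro sum_mono2) (auto simp: H_def)
    finally show ?thesis by (simp add: power_mult_distrib sum_distrib_left)
  qed
  ultimately show ?thesis by simp
qed

text \<open>The bound on \<open>\<parallel>v\<parallel>\<^sup>2\<close> is no loss, as larger deviations are detected by the sum of squares; it ensures that
  dropping the coordinates of intermediate size lowers the statistic by at most a multiple of its null fluctuation.\<close>

lemma cosh_alt:
  fixes p k :: nat and \<gamma> K M C :: real and \<theta> :: "nat \<Rightarrow> real"
  assumes k: "1 \<le> k" "k\<^sup>2 \<le> p" and \<gamma>: "0 \<le> \<gamma>" "\<gamma> < 1" and K: "1 \<le> K" and M: "0 \<le> M"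
    and C: "16 \<le> C" "8 * K \<le> C" "1024 * (exp K * (cosh_level K + 3 * K + 2 + 2 * M) + 1) \<le> C\<^sup>2"
    and S: "S \<subseteq> {..<p}" "card S \<le> k"
    and bulk: "(\<Sum>i<p. (\<theta> i - vec_mean p \<theta>)\<^sup>2) \<le> M * ((1 - \<gamma>) * sqrt p)"
    and signal: "C\<^sup>2 * ((1 - \<gamma>) * k * (tilt p k)\<^sup>2) \<le> (\<Sum>i\<in>S. (\<theta> i - vec_mean p \<theta>)\<^sup>2)"
  shows "measure (obs_law p \<gamma> \<theta>) (space (Rvec p) - cosh_region p \<gamma> k K) \<le> 11 / K\<^sup>2"
proof -
  have "1 \<le> k\<^sup>2" using k by simp
  then have p: "1 \<le> p" using k by linarith
  define L where "L = sparsity_ratio p k"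
  define l where "l = tilt p k"
  note b = tilt_bounds[OF k, folded L_def l_def]
  have K0: "0 < K" using K by simp
  define N where "N = sqrt p * L"
  have N0: "0 < N" using b(1) p by (simp add: N_def)
  define r where "r = sqrt (1 + L)"
  have r: "1 \<le> r" "r \<le> 2 * L" "l\<^sup>2 * r \<le> 2 * L" "l * r \<le> 2 * L" using b(1,6,7,8) by (auto simp: r_def)
  define u where "u i = (\<theta> i - vec_mean p \<theta>) / sqrt (1 - \<gamma>)" for i
  have u2: "(\<Sum>i\<in>A. (u i)\<^sup>2) = (\<Sum>i\<in>A. (\<theta> i - vec_mean p \<theta>)\<^sup>2) / (1 - \<gamma>)" for A
    using \<gamma> by (simp add: u_def power_divide sum_divide_distrib)
  have u_all: "(\<Sum>i<p. (u i)\<^sup>2) \<le> M * sqrt p"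
    using bulk \<gamma> unfolding u2 by (simp add: divide_le_eq mult_ac)
  have u_S: "C\<^sup>2 * k * l\<^sup>2 \<le> (\<Sum>i\<in>S. (u i)\<^sup>2)"
    using signal \<gamma> unfolding u2 by (simp add: le_divide_eq mult_ac l_def)
  have finS: "finite S" using S finite_subset by blast
  define B where "B = {i \<in> S. C\<^sup>2 * l\<^sup>2 / 2 \<le> (u i)\<^sup>2}"
  define w where "w i = exp (l * \<bar>u i\<bar> / 2) / 2" for i
  have w0: "0 \<le> w i" for i by (simp add: w_def)
  have B_large: "C / 4 \<le> \<bar>u i\<bar>" if "i \<in> B" for i
    using signal_weight_sum(1)[OF k finS S(2) C(1) u_S[unfolded l_def]] that by (simp add: B_def l_def)
  have w_sum: "C\<^sup>2 / 512 * N \<le> sum w B"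
    using signal_weight_sum(2)[OF k finS S(2) C(1) u_S[unfolded l_def]]
    by (simp add: B_def l_def N_def L_def w_def)
  define R where "R = exp K * (cosh_level K + 3 * K + 2 + 2 * M)"
  have RC: "2 * (R + 1) \<le> C\<^sup>2 / 512" using C(3) by (simp add: R_def)
  have R0: "0 \<le> R" using K0 M by (simp add: R_def cosh_level_def)
  have "2 * (R + 1) * N \<le> C\<^sup>2 / 512 * N" using RC N0 by (intro mult_right_mono) auto
  then have w_half: "(R + 1) * N \<le> sum w B / 2" using w_sum by linarith
  have "0 < (R + 1) * N" using R0 N0 by simp
  then have w_pos: "0 < sum w B" using w_half by linarith
  have Bp: "B \<subseteq> {..<p}" using S by (auto simp: B_def)
  define G where "G = {i \<in> {..<p} - S. \<bar>l * u i\<bar> \<le> 1}"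
  have Gp: "G \<subseteq> {..<p}" by (auto simp: G_def)
  have Gl: "\<bar>l * u i\<bar> \<le> 1" if "i \<in> G" for i using that by (simp add: G_def)
  let ?E1 = "{z \<in> space (gauss_vec p). K * sqrt p * L \<le>
    \<bar>(\<Sum>i\<in>G. cosh (l * (u i + z i))) - (\<Sum>i\<in>G. cosh (l * u i) * sqrt (1 + L))\<bar>}"
  let ?E2 = "{z \<in> space (gauss_vec p). K * sqrt p \<le> \<bar>\<Sum>i<p. z i\<bar>}"
  let ?E3 = "{z \<in> space (gauss_vec p). sum w B / 2 \<le> (\<Sum>i\<in>B. w i * of_bool (K \<le> \<bar>z i\<bar>))}"
  note E1 = cosh_sum_tail[OF Gp p K0 b(1,2) Gl]
  note E2 = sum_tail[OF K0 p]
  note E3 = weight_tail[OF Bp w0 w_pos K0]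
  show ?thesis
  proof (rule obs_law_le'[where E = "?E1 \<union> (?E2 \<union> ?E3)"])
    show "space (Rvec p) - cosh_region p \<gamma> k K \<in> sets (Rvec p)" by measurable
    show "?E1 \<union> (?E2 \<union> ?E3) \<in> sets (gauss_vec p)" by (intro sets.Un E1(1) E2(1) E3(1))
    have "measure (gauss_vec p) (?E1 \<union> (?E2 \<union> ?E3)) \<le>
        measure (gauss_vec p) ?E1 + (measure (gauss_vec p) ?E2 + measure (gauss_vec p) ?E3)"
      by (intro order_trans[OF measure_Un_le] add_left_mono measure_Un_le sets.Un E1(1) E2(1) E3(1))
    also have "\<dots> \<le> 8 / K\<^sup>2 + (1 / K\<^sup>2 + 2 / K\<^sup>2)"
      by (intro add_mono E1(2) E2(2) E3(2))
    finally show "measure (gauss_vec p) (?E1 \<union> (?E2 \<union> ?E3)) \<le> 11 / K\<^sup>2" by simp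
  next
    fix w' z assume z: "z \<in> space (gauss_vec p)" "z \<notin> ?E1 \<union> (?E2 \<union> ?E3)"
    define x where "x = obs_map p \<gamma> \<theta> (w', z)"
    have z2: "\<bar>\<Sum>i<p. z i\<bar> \<le> K * sqrt p" using z by auto
    note hh = tilt_mean_le[OF p k K0 z2, folded l_def]
    \<comment> \<open>As under the null, centering costs at most a factor \<open>exp (- h)\<close>. For the bulk \<open>G\<close> this is bounded below by
      \<open>1 - h\<close>, for the signal \<open>B\<close> by \<open>exp (- K)\<close>.\<close>
    define h where "h = \<bar>l * vec_mean p z\<bar>"
    have h0: "0 \<le> h" "h \<le> K" using hh by (auto simp: h_def)
    have hp: "h * sqrt p \<le> K * l"
    proof -
      have "h * sqrt p = l * (sqrt p * \<bar>vec_mean p z\<bar>)" using b(4) by (simp add: h_def abs_mult)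
      also have "\<dots> \<le> l * K" using hh b(4) by (intro mult_left_mono) auto
      finally show ?thesis by (simp add: mult.commute)
    qed
    have hr: "h * (p * r) \<le> 2 * K * N"
    proof -
      have "h * (p * r) = (h * sqrt p) * r * sqrt p" by (simp add: mult_ac)
      also have "\<dots> \<le> (K * l) * r * sqrt p" using hp r(1) by (intro mult_right_mono) auto
      also have "\<dots> = K * (l * r) * sqrt p" by simp
      also have "\<dots> \<le> K * (2 * L) * sqrt p" using r(4) K0 by (intro mult_right_mono mult_left_mono) auto
      finally show ?thesis by (simp add: N_def mult_ac)
    qed
    let ?SG = "\<Sum>i\<in>G. cosh (l * (u i + z i))" and ?SB = "\<Sum>i\<in>B. cosh (l * (u i + z i))"
    have SG: "p * r - (2 + 2 * M + K) * N \<le> ?SG"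
    proof -
      have "(\<Sum>i\<in>G. cosh (l * u i) * r) - K * N \<le> ?SG"
        using z by (auto simp: r_def N_def mult.assoc)
      moreover have "(\<Sum>i\<in>G. 1 * r) \<le> (\<Sum>i\<in>G. cosh (l * u i) * r)"
        using r(1) by (intro sum_mono mult_right_mono cosh_real_ge_1) auto
      moreover have "p * r - (2 + 2 * M) * N \<le> (\<Sum>i\<in>G. 1 * r)"
      proof -
        have "(real k)\<^sup>2 \<le> p" using k by (metis of_nat_le_iff of_nat_power)
        then have kp: "real k \<le> sqrt p" by (rule real_le_rsqrt)
        have "l\<^sup>2 * (\<Sum>i<p. (u i)\<^sup>2) \<le> l\<^sup>2 * (M * sqrt p)" using u_all by (intro mult_left_mono) auto
        then have "p - sqrt p - l\<^sup>2 * (M * sqrt p) \<le> card G"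
          using card_small_coords[OF S(1), of l u] S(2) kp unfolding G_def by linarith
        then have "(p - sqrt p - l\<^sup>2 * (M * sqrt p)) * r \<le> card G * r"
          using r(1) by (intro mult_right_mono) auto
        moreover have "sqrt p * r \<le> sqrt p * (2 * L)" using r(2) by (intro mult_left_mono) auto
        moreover have "(M * sqrt p) * (l\<^sup>2 * r) \<le> (M * sqrt p) * (2 * L)"
          using r(3) M by (intro mult_left_mono) auto
        ultimately show ?thesis by (simp add: N_def algebra_simps)
      qed
      ultimately show ?thesis by (simp add: algebra_simps)
    qed
    have SB: "(R + 1) * N \<le> ?SB"
    proof -
      have "(\<Sum>i\<in>B. w i * of_bool (K \<le> \<bar>z i\<bar>)) < sum w B / 2" using z by auto
      moreover have "sum w B = (\<Sum>i\<in>B. w i * of_bool (K \<le> \<bar>z i\<bar>)) + (\<Sum>i\<in>B. w i * of_bool (\<not> K \<le> \<bar>z i\<bar>))"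
        unfolding sum.distrib[symmetric] by (intro sum.cong) auto
      moreover have "(\<Sum>i\<in>B. w i * of_bool (\<not> K \<le> \<bar>z i\<bar>)) \<le> ?SB"
      proof (intro sum_mono)
        fix i assume i: "i \<in> B"
        show "w i * of_bool (\<not> K \<le> \<bar>z i\<bar>) \<le> cosh (l * (u i + z i))"
        proof (cases "K \<le> \<bar>z i\<bar>")
          case False
          then have "\<bar>u i\<bar> / 2 \<le> \<bar>u i + z i\<bar>"
            using B_large[OF i] C(2) by linarith
          then have "l * (\<bar>u i\<bar> / 2) \<le> l * \<bar>u i + z i\<bar>" using b(4) by (intro mult_left_mono) auto
          then have "exp (l * \<bar>u i\<bar> / 2) \<le> exp \<bar>l * (u i + z i)\<bar>" using b(4) by (simp add: abs_mult)
          then have "w i \<le> cosh (l * (u i + z i))"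
            using exp_abs_le_cosh[of "l * (u i + z i)"] unfolding w_def by linarith
          then show ?thesis by simp
        qed simp
      qed
      ultimately show ?thesis using w_half by linarith
    qed
    have sumeq: "(\<Sum>i<p. cosh (l * ((x i - vec_mean p x) / sqrt (1 - \<gamma>)))) = (\<Sum>i<p. cosh (l * (u i + z i) - l * vec_mean p z))"
    proof (intro sum.cong refl)
      fix i assume "i \<in> {..<p}"
      then have "(x i - vec_mean p x) / sqrt (1 - \<gamma>) = u i + z i - vec_mean p z"
        using \<gamma> by (simp add: x_def obs_map_centered[OF p] u_def add_divide_distrib)
      then show "cosh (l * ((x i - vec_mean p x) / sqrt (1 - \<gamma>))) = cosh (l * (u i + z i) - l * vec_mean p z)"
        by (simp only: right_diff_distrib)
    qed
    have "p * r + cosh_level K * N < exp (- h) * (p * r - (2 + 2 * M + K) * N) + exp (- K) * ((R + 1) * N)"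
    proof -
      have eh: "1 - h \<le> exp (- h)" "exp (- h) \<le> 1" using exp_ge_add_one_self[of "- h"] h0 by auto
      have "(1 - h) * (p * r) \<le> exp (- h) * (p * r)" using eh r(1) by (intro mult_right_mono) auto
      moreover have "exp (- h) * ((2 + 2 * M + K) * N) \<le> 1 * ((2 + 2 * M + K) * N)"
        using eh M K0 N0 by (intro mult_right_mono) auto
      moreover have "exp (- K) * ((R + 1) * N) = (cosh_level K + 3 * K + 2 + 2 * M) * N + exp (- K) * N"
        by (simp add: R_def exp_minus field_simps)
      moreover have "0 < exp (- K) * N" using N0 by simp
      ultimately show ?thesis using hr by (simp add: algebra_simps)
    qed
    also have "\<dots> \<le> exp (- h) * ?SG + exp (- h) * ?SB"
    proof (rule add_mono)
      show "exp (- h) * (p * r - (2 + 2 * M + K) * N) \<le> exp (- h) * ?SG"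
        using SG by (intro mult_left_mono) auto
      have "0 \<le> (R + 1) * N" using R0 N0 by simp
      then show "exp (- K) * ((R + 1) * N) \<le> exp (- h) * ?SB"
        using h0 SB by (intro mult_mono) auto
    qed
    also have "\<dots> = exp (- h) * (\<Sum>i\<in>G \<union> B. cosh (l * (u i + z i)))"
      using Gp Bp by (subst sum.union_disjoint) (auto simp: G_def B_def distrib_left intro: finite_subset)
    also have "\<dots> \<le> exp (- h) * (\<Sum>i<p. cosh (l * (u i + z i)))"
      using Gp Bp by (intro mult_left_mono sum_mono2) auto
    also have "\<dots> = (\<Sum>i<p. exp (- h) * cosh (l * (u i + z i)))" by (rule sum_distrib_left)
    also have "\<dots> \<le> (\<Sum>i<p. cosh (l * (u i + z i) - l * vec_mean p z))"
      by (intro sum_mono cosh_shift_bounds) (simp add: h_def)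
    finally have "p * r + cosh_level K * N < (\<Sum>i<p. cosh (l * ((x i - vec_mean p x) / sqrt (1 - \<gamma>))))"
      by (simp only: sumeq)
    moreover have "x \<in> space (Rvec p)" by (simp add: x_def obs_map_def space_PiM)
    ultimately show "x \<notin> space (Rvec p) - cosh_region p \<gamma> k K"
      by (simp add: cosh_region_def l_def[symmetric] L_def[symmetric] N_def r_def mult.assoc)
  qed
qed

section \<open>Upper bounds and the separation rate\<close>

lemma sparse_alt_nonempty:
  assumes "1 \<le> s" "s \<le> p"
  shows "sparse_alt p s \<epsilon> \<noteq> {}"
proof -
  let ?\<theta> = "\<lambda>i. if i = 0 then \<epsilon> else 0"
  have "(\<lambda>i\<in>{..<p}. ?\<theta> i) \<in> sparse_alt p s \<epsilon>"
  proof (rule sparse_altI)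
    have "(\<Sum>i<p. (?\<theta> i)\<^sup>2) = (\<Sum>i<p. if i = 0 then \<epsilon>\<^sup>2 else 0)"
      by (intro sum.cong) auto
    then show "\<epsilon>\<^sup>2 \<le> (\<Sum>i<p. (?\<theta> i)\<^sup>2)" using assms by simp
    have "card {i \<in> {..<p}. ?\<theta> i \<noteq> 0} \<le> card {0::nat}"
      by (intro card_mono) auto
    then show "card {i \<in> {..<p}. ?\<theta> i \<noteq> 0} \<le> s" using assms by simp
  qed
  then show ?thesis by blast
qed

lemma risk_SUP_nonneg:
  assumes "1 \<le> s" "s \<le> p"
  shows "0 \<le> (SUP \<theta>\<in>sparse_alt p s \<epsilon>. measure (obs_law p \<gamma> \<theta>) A)"
proof -
  interpret P: prob_space "obs_law p \<gamma> \<theta>" for \<theta> by (rule prob_space_obs_law)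
  obtain \<theta> where \<theta>: "\<theta> \<in> sparse_alt p s \<epsilon>" using sparse_alt_nonempty[OF assms] by blast
  have "0 \<le> measure (obs_law p \<gamma> \<theta>) A" by simp
  also have "\<dots> \<le> (SUP \<theta>\<in>sparse_alt p s \<epsilon>. measure (obs_law p \<gamma> \<theta>) A)"
    by (intro cSUP_upper \<theta> bdd_aboveI[of _ 1]) auto
  finally show ?thesis .
qed

lemma minimax_risk_nonneg:
  assumes "1 \<le> s" "s \<le> p"
  shows "0 \<le> minimax_risk p s \<gamma> \<epsilon>"
  unfolding minimax_risk_def
proof (rule cINF_greatest)
  have "(\<lambda>_. 0) \<in> tests p" by (simp add: tests_def)
  then show "tests p \<noteq> {}" by blast
qed (intro add_nonneg_nonneg measure_nonneg risk_SUP_nonneg assms)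

lemma minimax_risk_le:
  assumes ps: "1 \<le> s" "s \<le> p" and R [measurable]: "R \<in> sets (Rvec p)"
    and null: "measure (obs_law p \<gamma> (\<lambda>i\<in>{..<p}. 0)) R \<le> a"
    and alt: "\<And>\<theta>. \<theta> \<in> sparse_alt p s \<epsilon> \<Longrightarrow> measure (obs_law p \<gamma> \<theta>) (space (Rvec p) - R) \<le> b"
  shows "minimax_risk p s \<gamma> \<epsilon> \<le> a + b"
proof -
  define \<phi> where "\<phi> x = (if x \<in> R then 1 else 0 :: nat)" for x
  have \<phi>: "\<phi> \<in> tests p" unfolding tests_def \<phi>_def by measurable
  have sp: "R \<subseteq> space (Rvec p)" using R by (rule sets.sets_into_space)
  have 1: "{x \<in> space (Rvec p). \<phi> x = 1} = R" and 0: "{x \<in> space (Rvec p). \<phi> x = 0} = space (Rvec p) - R"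
    using sp by (auto simp: \<phi>_def)
  let ?v = "\<lambda>\<phi>. measure (obs_law p \<gamma> (\<lambda>i\<in>{..<p}. 0)) {x \<in> space (Rvec p). \<phi> x = 1}
        + (SUP \<theta>\<in>sparse_alt p s \<epsilon>. measure (obs_law p \<gamma> \<theta>) {x \<in> space (Rvec p). \<phi> x = (0::nat)})"
  have "minimax_risk p s \<gamma> \<epsilon> \<le> ?v \<phi>"
    unfolding minimax_risk_def
    by (intro cINF_lower \<phi> bdd_belowI2[where m = 0] add_nonneg_nonneg measure_nonneg risk_SUP_nonneg ps)
  also have "\<dots> \<le> a + b"
    unfolding 0 1 by (intro add_mono null cSUP_least sparse_alt_nonempty ps alt)
  finally show ?thesis .
qed

lemma measure_obs_law_Diff_Un:
  assumes "A \<in> sets (Rvec p)" "B \<in> sets (Rvec p)"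
    and "measure (obs_law p \<gamma> \<theta>) (space (Rvec p) - A) \<le> b \<or> measure (obs_law p \<gamma> \<theta>) (space (Rvec p) - B) \<le> b"
  shows "measure (obs_law p \<gamma> \<theta>) (space (Rvec p) - (A \<union> B)) \<le> b"
proof -
  interpret P: prob_space "obs_law p \<gamma> \<theta>" by (rule prob_space_obs_law)
  have s: "sets (obs_law p \<gamma> \<theta>) = sets (Rvec p)" by (simp add: obs_law_def)
  have "measure (obs_law p \<gamma> \<theta>) (space (Rvec p) - (A \<union> B)) \<le> measure (obs_law p \<gamma> \<theta>) (space (Rvec p) - A)"
    using assms s by (intro P.finite_measure_mono) auto
  moreover have "measure (obs_law p \<gamma> \<theta>) (space (Rvec p) - (A \<union> B)) \<le> measure (obs_law p \<gamma> \<theta>) (space (Rvec p) - B)"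
    using assms s by (intro P.finite_measure_mono) auto
  ultimately show ?thesis using assms(3) by linarith
qed

lemma measure_obs_law_Un:
  assumes "A \<in> sets (Rvec p)" "B \<in> sets (Rvec p)"
    and "measure (obs_law p \<gamma> \<theta>) A \<le> a" "measure (obs_law p \<gamma> \<theta>) B \<le> b"
  shows "measure (obs_law p \<gamma> \<theta>) (A \<union> B) \<le> a + b"
  using assms by (intro order_trans[OF measure_Un_le add_mono]) (auto simp: obs_law_def)

lemma sparse_altD:
  assumes "\<theta> \<in> sparse_alt p s \<epsilon>" "0 \<le> \<epsilon>"
  shows "\<epsilon>\<^sup>2 \<le> (\<Sum>i<p. (\<theta> i)\<^sup>2)" "card {i \<in> {..<p}. \<theta> i \<noteq> 0} \<le> s"
proof -
  have "\<epsilon> \<le> sqrt (\<Sum>i<p. (\<theta> i)\<^sup>2)" using assms(1) by (simp add: sparse_alt_def L2_set_def)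
  then have "\<epsilon>\<^sup>2 \<le> (sqrt (\<Sum>i<p. (\<theta> i)\<^sup>2))\<^sup>2" using assms(2) by (intro power_mono)
  then show "\<epsilon>\<^sup>2 \<le> (\<Sum>i<p. (\<theta> i)\<^sup>2)" by (simp add: sum_nonneg)
  show "card {i \<in> {..<p}. \<theta> i \<noteq> 0} \<le> s" using assms(1) by (simp add: sparse_alt_def l0_norm_def)
qed

lemma mean_sq_le_sparse:
  fixes \<theta> :: "nat \<Rightarrow> real"
  assumes "card {i \<in> {..<p}. \<theta> i \<noteq> 0} = a" "1 \<le> p"
  shows "(real p)\<^sup>2 * (vec_mean p \<theta>)\<^sup>2 \<le> a * (\<Sum>i<p. (\<theta> i)\<^sup>2)"
proof -
  let ?S = "{i \<in> {..<p}. \<theta> i \<noteq> 0}"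
  have "(real p)\<^sup>2 * (vec_mean p \<theta>)\<^sup>2 = (\<Sum>i<p. \<theta> i)\<^sup>2"
    using assms by (simp add: vec_mean_def power_divide)
  also have "(\<Sum>i<p. \<theta> i) = (\<Sum>i\<in>?S. \<theta> i)" by (intro sum.mono_neutral_right) auto
  also have "(\<Sum>i\<in>?S. \<theta> i)\<^sup>2 \<le> (\<Sum>i\<in>?S. (\<theta> i)\<^sup>2) * card ?S"
    by (rule sum_squared_le_sum_of_squares)
  also have "(\<Sum>i\<in>?S. (\<theta> i)\<^sup>2) = (\<Sum>i<p. (\<theta> i)\<^sup>2)" by (intro sum.mono_neutral_left) auto
  finally show ?thesis using assms by (simp add: mult.commute)
qed

text \<open>By Cauchy-Schwarz, a nonzero \<open>s\<close>-sparse vector with \<open>s < p\<close> is not close to a constant one.\<close>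

lemma centered_energy_ge:
  fixes \<theta> :: "nat \<Rightarrow> real"
  assumes "card {i \<in> {..<p}. \<theta> i \<noteq> 0} \<le> s" "1 \<le> p"
  shows "(real p - s) / p * (\<Sum>i<p. (\<theta> i)\<^sup>2) \<le> (\<Sum>i<p. (\<theta> i - vec_mean p \<theta>)\<^sup>2)"
proof -
  have "(real p)\<^sup>2 * (vec_mean p \<theta>)\<^sup>2 \<le> card {i \<in> {..<p}. \<theta> i \<noteq> 0} * (\<Sum>i<p. (\<theta> i)\<^sup>2)"
    using mean_sq_le_sparse[OF refl assms(2)] .
  also have "\<dots> \<le> s * (\<Sum>i<p. (\<theta> i)\<^sup>2)" using assms by (intro mult_right_mono) (auto intro: sum_nonneg)
  finally have "p * (vec_mean p \<theta>)\<^sup>2 \<le> s / p * (\<Sum>i<p. (\<theta> i)\<^sup>2)"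
    using assms(2) by (simp add: field_simps power2_eq_square)
  then show ?thesis
    unfolding sum_sq_centered using assms(2) by (simp add: diff_divide_distrib algebra_simps)
qed

lemma centered_energy_support_ge:
  fixes \<theta> :: "nat \<Rightarrow> real" and p :: nat
  defines "S \<equiv> {i \<in> {..<p}. \<theta> i \<noteq> 0}"
  assumes "2 * card S \<le> p" "1 \<le> p"
  shows "(\<Sum>i<p. (\<theta> i)\<^sup>2) / 4 \<le> (\<Sum>i\<in>S. (\<theta> i - vec_mean p \<theta>)\<^sup>2)"
proof -
  define a where "a = card S"
  define m where "m = vec_mean p \<theta>"
  let ?T = "\<Sum>i<p. (\<theta> i)\<^sup>2"
  have T: "0 \<le> ?T" by (intro sum_nonneg) auto
  have ap: "2 * real a \<le> p" using assms(2) by (simp add: a_def)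
  have m2: "(real p)\<^sup>2 * m\<^sup>2 \<le> a * ?T"
    using mean_sq_le_sparse[OF refl assms(3), of \<theta>] by (simp add: a_def m_def S_def)
  have Sp: "S \<subseteq> {..<p}" by (auto simp: S_def)
  have "(\<Sum>i<p. (\<theta> i - m)\<^sup>2) = (\<Sum>i\<in>{..<p} - S. (\<theta> i - m)\<^sup>2) + (\<Sum>i\<in>S. (\<theta> i - m)\<^sup>2)"
    using Sp by (intro sum.subset_diff) auto
  also have "(\<Sum>i\<in>{..<p} - S. (\<theta> i - m)\<^sup>2) = (\<Sum>i\<in>{..<p} - S. m\<^sup>2)"
    by (intro sum.cong) (auto simp: S_def)
  also have "\<dots> = (real p - a) * m\<^sup>2"
    using Sp ap by (simp add: card_Diff_subset finite_subset a_def of_nat_diff)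
  finally have eq: "(\<Sum>i\<in>S. (\<theta> i - m)\<^sup>2) = ?T - (2 * real p - a) * m\<^sup>2"
    unfolding m_def sum_sq_centered by (simp add: algebra_simps)
  have "(real p)\<^sup>2 * ((2 * real p - a) * m\<^sup>2) = (2 * real p - a) * ((real p)\<^sup>2 * m\<^sup>2)" by simp
  also have "\<dots> \<le> (2 * real p - a) * (a * ?T)" using m2 ap by (intro mult_left_mono) auto
  also have "\<dots> = ((2 * real p - a) * a) * ?T" by simp
  also have "\<dots> \<le> (3 / 4 * (real p)\<^sup>2) * ?T"
  proof (rule mult_right_mono[OF _ T])
    have "0 \<le> (real p / 2 - a) * (3 * real p / 2 - a)" using ap by (intro mult_nonneg_nonneg) auto
    also have "\<dots> = 3 / 4 * (real p)\<^sup>2 - (2 * real p - a) * a" by (simp add: power2_eq_square field_simps)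
    finally show "(2 * real p - a) * a \<le> 3 / 4 * (real p)\<^sup>2" by simp
  qed
  finally have "(real p)\<^sup>2 * ((2 * real p - a) * m\<^sup>2) \<le> (real p)\<^sup>2 * (3 / 4 * ?T)" by simp
  then have "(2 * real p - a) * m\<^sup>2 \<le> 3 / 4 * ?T" using assms(3) by (subst (asm) mult_le_cancel_left_pos) auto
  then show ?thesis unfolding eq[unfolded m_def] m_def by simp
qed

text \<open>The cases of the rate. The conditions on \<open>s\<close> are consequences of the defining ones, in the form in which
  the tests use them; only \<open>s < p\<close> is needed in the moderate case.\<close>

lemma rate_sq_cases:
  fixes p s :: nat and \<gamma> :: real
  assumes ps: "1 \<le> s" "s \<le> p"
  obtains (sparse) "s\<^sup>2 \<le> p" "2 * s \<le> p" "rate_sq p s \<gamma> = (1 - \<gamma>) * (s * ln (1 + p / (real s)\<^sup>2))"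
  | (full) "s = p" "rate_sq p s \<gamma> = (1 - \<gamma>) * sqrt p + (1 - \<gamma> + \<gamma> * p)"
  | (moderate) "s < p" "rate_sq p s \<gamma> = (1 - \<gamma>) * sqrt p + min ((1 - \<gamma>) * (p * sqrt p / (real p - s))) (1 - \<gamma> + \<gamma> * p)"
  | (dense) "s < p" "(p - s)\<^sup>2 \<le> p" 
     "rate_sq p s \<gamma> = (1 - \<gamma>) * sqrt p + min ((1 - \<gamma>) * (p * ln (1 + p / (real (p - s))\<^sup>2))) (1 - \<gamma> + \<gamma> * p)"
proof -
  have p1: "1 \<le> p" using ps by simp
  have pow: "real p powr (3/2) = p * sqrt p"
    using p1 by (simp add: powr_half_sqrt[symmetric] powr_mult_base)
  have sqle: "n\<^sup>2 \<le> p" if "real n < sqrt p" for n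
  proof -
    have "(real n)\<^sup>2 \<le> p" using that power_mono[of "real n" "sqrt p" 2] by simp
    then show ?thesis by (metis of_nat_le_iff of_nat_power)
  qed
  show ?thesis
  proof (cases "real s < sqrt p")
    case True
    have "2 * s \<le> p"
    proof (cases "s = 1")
      case True
      then have "p \<noteq> 1" using \<open>real s < sqrt p\<close> by auto
      then show ?thesis using True p1 by simp
    next
      case False
      have "2 * s \<le> s * s" using False ps by (intro mult_le_mono1) simp
      also have "\<dots> \<le> p" using sqle[OF True] by (simp add: power2_eq_square)
      finally show ?thesis .
    qed
    then show ?thesis using True sqle[OF True] by (intro sparse) (auto simp: rate_sq_def)
  next
    case False
    show ?thesis
    proof (cases "s = p")
      case True
      have "0 < sqrt p" using p1 by simp
      then have "\<not> real s \<le> real p - sqrt p" using True by simp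
      then show ?thesis using True False by (intro full) (auto simp: rate_sq_def)
    next
      case neq: False
      then have sp: "s < p" using ps by simp
      show ?thesis
      proof (cases "real s \<le> real p - sqrt p")
        case True
        then show ?thesis using False sp by (intro moderate) (auto simp: rate_sq_def pow)
      next
        case dense': False
        then have "real (p - s) < sqrt p" using sp by (simp add: of_nat_diff)
        from sqle[OF this] show ?thesis using False sp dense'
          by (intro dense) (auto simp: rate_sq_def of_nat_diff)
      qed
    qed
  qed
qed

lemma rate_sq_nonneg:
  fixes p s :: nat and \<gamma> :: real
  assumes ps: "1 \<le> s" "s \<le> p" and \<gamma>: "0 \<le> \<gamma>" "\<gamma> \<le> 1"
  shows "0 \<le> rate_sq p s \<gamma>"
    and "\<gamma> < 1 \<or> s = p \<Longrightarrow> 0 < rate_sq p s \<gamma>"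
    and "\<gamma> = 1 \<Longrightarrow> s < p \<Longrightarrow> rate_sq p s \<gamma> = 0"
proof -
  have B: "0 \<le> 1 - \<gamma> + \<gamma> * p" using \<gamma> by simp
  have sq: "0 < sqrt p" using ps by simp
  have pos: "0 < rate_sq p s \<gamma>" if "\<gamma> < 1 \<or> s = p"
    using ps
  proof (cases rule: rate_sq_cases[where \<gamma> = \<gamma>])
    case sparse
    then have "\<gamma> < 1" using that ps by auto
    have "0 < real p / (real s)\<^sup>2" using ps by simp
    then have "0 < ln (1 + p / (real s)\<^sup>2)" by (intro ln_gt_zero) linarith
    then show ?thesis using sparse \<open>\<gamma> < 1\<close> ps by simp
  next
    case full
    show ?thesis
    proof (cases "\<gamma> = 1")
      case True
      then show ?thesis using full ps by simp
    next
      case False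
      then have "0 < (1 - \<gamma>) * sqrt p" using \<gamma> sq by (intro mult_pos_pos) auto
      then show ?thesis using full B by simp
    qed
  next
    case moderate
    then have "0 < (1 - \<gamma>) * sqrt p" using that \<gamma> sq by (intro mult_pos_pos) auto
    moreover have "0 \<le> (1 - \<gamma>) * (p * sqrt p / (real p - s))" using \<gamma> ps by simp
    ultimately show ?thesis using moderate B by simp
  next
    case dense
    then have "0 < (1 - \<gamma>) * sqrt p" using that \<gamma> sq by (intro mult_pos_pos) auto
    moreover have "0 \<le> (1 - \<gamma>) * (p * ln (1 + p / (real (p - s))\<^sup>2))"
      using \<gamma> ps by (intro mult_nonneg_nonneg ln_ge_zero) auto
    ultimately show ?thesis using dense B by simp
  qed
  have zero: "rate_sq p s \<gamma> = 0" if "\<gamma> = 1" "s < p"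
    using ps that by (cases rule: rate_sq_cases[where \<gamma> = \<gamma>]) auto
  show "\<gamma> < 1 \<or> s = p \<Longrightarrow> 0 < rate_sq p s \<gamma>" by (rule pos)
  show "\<gamma> = 1 \<Longrightarrow> s < p \<Longrightarrow> rate_sq p s \<gamma> = 0" by (rule zero)
  show "0 \<le> rate_sq p s \<gamma>"
  proof (cases "\<gamma> < 1 \<or> s = p")
    case True
    then show ?thesis using pos by simp
  next
    case False
    then show ?thesis using zero \<gamma> ps by simp
  qed
qed

text \<open>For \<open>\<gamma> = 1\<close> all noise is common, and the region of the nonconstant vectors has no error at all: it is
  \<open>chisq_region p 1 K\<close> for every \<open>K\<close>.\<close>

lemma minimax_risk_degenerate:
  assumes ps: "1 \<le> s" "s < p" and \<epsilon>: "0 < \<epsilon>"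
  shows "minimax_risk p s 1 \<epsilon> = 0"
proof (rule antisym[OF field_le_epsilon])
  show "0 \<le> minimax_risk p s 1 \<epsilon>" using ps by (intro minimax_risk_nonneg) auto
next
  fix e :: real assume e: "0 < e"
  define K where "K = 1 + sqrt (6 / e)"
  have K: "1 \<le> K" using e by (simp add: K_def)
  have p: "1 \<le> p" using ps by simp
  have "6 / e = (sqrt (6 / e))\<^sup>2" using e by simp
  also have "\<dots> \<le> K\<^sup>2" using e by (intro power_mono) (auto simp: K_def)
  finally have eK: "6 / K\<^sup>2 \<le> e" using e K by (simp add: field_simps)
  have "minimax_risk p s 1 \<epsilon> \<le> 2 / K\<^sup>2 + 4 / K\<^sup>2"
  proof (rule minimax_risk_le[where R = "chisq_region p 1 K"])
    show "measure (obs_law p 1 (\<lambda>i\<in>{..<p}. 0)) (chisq_region p 1 K) \<le> 2 / K\<^sup>2"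
      using p K by (intro chisq_null) auto
    fix \<theta> assume "\<theta> \<in> sparse_alt p s \<epsilon>"
    note \<theta> = sparse_altD[OF this less_imp_le[OF \<epsilon>]]
    have "0 < (real p - s) / p * \<epsilon>\<^sup>2" using ps \<epsilon> by simp
    also have "\<dots> \<le> (real p - s) / p * (\<Sum>i<p. (\<theta> i)\<^sup>2)" using \<theta>(1) ps by (intro mult_left_mono) auto
    also have "\<dots> \<le> (\<Sum>i<p. (\<theta> i - vec_mean p \<theta>)\<^sup>2)" by (rule centered_energy_ge[OF \<theta>(2) p])
    finally have V: "0 < (\<Sum>i<p. (\<theta> i - vec_mean p \<theta>)\<^sup>2)" .
    then show "measure (obs_law p 1 \<theta>) (space (Rvec p) - chisq_region p 1 K) \<le> 4 / K\<^sup>2"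
      using p K by (intro chisq_alt) auto
  qed (use ps in auto)
  then show "minimax_risk p s 1 \<epsilon> \<le> 0 + e" using eK by simp
qed

lemma chisq_or_mean_region:
  fixes p :: nat and \<gamma> K C :: real and \<theta> :: "nat \<Rightarrow> real"
  assumes p: "1 \<le> p" and \<gamma>: "0 \<le> \<gamma>" "\<gamma> \<le> 1" and K: "1 \<le> K" and C: "5 * K \<le> C"
    and \<theta>: "C\<^sup>2 * ((1 - \<gamma>) * sqrt p + (1 - \<gamma> + \<gamma> * p)) \<le> (\<Sum>i<p. (\<theta> i)\<^sup>2)"
  shows "measure (obs_law p \<gamma> \<theta>) (space (Rvec p) - (chisq_region p \<gamma> K \<union> mean_region p \<gamma> (2 * K))) \<le> 11 / K\<^sup>2"
proof -
  let ?V = "\<Sum>i<p. (\<theta> i - vec_mean p \<theta>)\<^sup>2" and ?B = "1 - \<gamma> + \<gamma> * p"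
  have K0: "0 < K" using K by simp
  have V0: "0 \<le> ?V" by (intro sum_nonneg) auto
  have B: "0 \<le> ?B" using \<gamma> by simp
  have q: "0 \<le> (1 - \<gamma>) * sqrt p" using \<gamma> by simp
  have C2: "25 * K\<^sup>2 \<le> C\<^sup>2" using power_mono[OF C, of 2] K by (simp add: power_mult_distrib)
  show ?thesis
  proof (rule measure_obs_law_Diff_Un)
    show "measure (obs_law p \<gamma> \<theta>) (space (Rvec p) - chisq_region p \<gamma> K) \<le> 11 / K\<^sup>2 \<or>
      measure (obs_law p \<gamma> \<theta>) (space (Rvec p) - mean_region p \<gamma> (2 * K)) \<le> 11 / K\<^sup>2"
    proof (cases "0 < ?V \<and> 16 * K\<^sup>2 * ((1 - \<gamma>) * sqrt p) \<le> ?V")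
      case True
      then have "measure (obs_law p \<gamma> \<theta>) (space (Rvec p) - chisq_region p \<gamma> K) \<le> 4 / K\<^sup>2"
        using p \<gamma> K by (intro chisq_alt) auto
      also have "\<dots> \<le> 11 / K\<^sup>2" by (intro divide_right_mono) auto
      finally show ?thesis by simp
    next
      case False
      have "0 \<le> 16 * K\<^sup>2 * ((1 - \<gamma>) * sqrt p)" by (rule mult_nonneg_nonneg[OF _ q]) simp
      then have "?V \<le> 16 * K\<^sup>2 * ((1 - \<gamma>) * sqrt p)" using False V0 by linarith
      also have "\<dots> \<le> C\<^sup>2 * ((1 - \<gamma>) * sqrt p)"
      proof (rule mult_right_mono[OF _ q])
        have "0 \<le> K\<^sup>2" by simp
        then show "16 * K\<^sup>2 \<le> C\<^sup>2" using C2 by linarith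
      qed
      finally have "C\<^sup>2 * ?B \<le> p * (vec_mean p \<theta>)\<^sup>2"
        using \<theta> unfolding sum_sq_centered by (simp add: distrib_left)
      moreover have "25 * K\<^sup>2 * ?B \<le> C\<^sup>2 * ?B" using C2 B by (rule mult_right_mono)
      ultimately have "measure (obs_law p \<gamma> \<theta>) (space (Rvec p) - mean_region p \<gamma> (2 * K)) \<le> 2 / K\<^sup>2"
        using p \<gamma> K0 by (intro mean_alt) auto
      also have "\<dots> \<le> 11 / K\<^sup>2" by (intro divide_right_mono) auto
      finally show ?thesis by simp
    qed
  qed measurable
qed

lemma chisq_or_cosh_region:
  fixes p k :: nat and \<gamma> K C :: real and \<theta> :: "nat \<Rightarrow> real"
  assumes k: "1 \<le> k" "k\<^sup>2 \<le> p" and \<gamma>: "0 \<le> \<gamma>" "\<gamma> < 1" and K: "1 \<le> K"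
    and C: "16 \<le> C" "8 * K \<le> C" "1024 * (exp K * (cosh_level K + 3 * K + 2 + 2 * (16 * K\<^sup>2)) + 1) \<le> C\<^sup>2"
    and S: "S \<subseteq> {..<p}" "card S \<le> k"
    and signal: "(\<Sum>i<p. (\<theta> i - vec_mean p \<theta>)\<^sup>2) < 16 * K\<^sup>2 * ((1 - \<gamma>) * sqrt p) \<Longrightarrow>
      C\<^sup>2 * ((1 - \<gamma>) * k * ln (1 + p / (real k)\<^sup>2)) \<le> (\<Sum>i\<in>S. (\<theta> i - vec_mean p \<theta>)\<^sup>2)"
  shows "measure (obs_law p \<gamma> \<theta>) (space (Rvec p) - (chisq_region p \<gamma> K \<union> cosh_region p \<gamma> k K)) \<le> 11 / K\<^sup>2"
proof (rule measure_obs_law_Diff_Un)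
  have "1 \<le> k\<^sup>2" using k by simp
  then have p: "1 \<le> p" using k by linarith
  let ?V = "\<Sum>i<p. (\<theta> i - vec_mean p \<theta>)\<^sup>2"
  show "measure (obs_law p \<gamma> \<theta>) (space (Rvec p) - chisq_region p \<gamma> K) \<le> 11 / K\<^sup>2 \<or>
    measure (obs_law p \<gamma> \<theta>) (space (Rvec p) - cosh_region p \<gamma> k K) \<le> 11 / K\<^sup>2"
  proof (cases "16 * K\<^sup>2 * ((1 - \<gamma>) * sqrt p) \<le> ?V")
    case True
    moreover have "0 < 16 * K\<^sup>2 * ((1 - \<gamma>) * sqrt p)" using K \<gamma> p by (intro mult_pos_pos) auto
    ultimately have "0 < ?V" by linarith
    then have "measure (obs_law p \<gamma> \<theta>) (space (Rvec p) - chisq_region p \<gamma> K) \<le> 4 / K\<^sup>2"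
      using p \<gamma> K True by (intro chisq_alt) auto
    also have "\<dots> \<le> 11 / K\<^sup>2" by (intro divide_right_mono) auto
    finally show ?thesis by simp
  next
    case False
    then have lt: "?V < 16 * K\<^sup>2 * ((1 - \<gamma>) * sqrt p)" by simp
    have "measure (obs_law p \<gamma> \<theta>) (space (Rvec p) - cosh_region p \<gamma> k K) \<le> 11 / K\<^sup>2"
      using signal[OF lt] lt tilt_bounds(10)[OF k]
      by (intro cosh_alt[where M = "16 * K\<^sup>2", OF k \<gamma> K _ C S]) auto
    then show ?thesis by simp
  qed
qed measurable

text \<open>In the sparse case at least one quarter of the energy of \<open>\<theta>\<close> stays on its support after centering, hence the constants
  are chosen such that \<open>C / 2\<close> satisfies the requirements of \<open>cosh_alt\<close>.\<close>

lemma minimax_risk_le_rate: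
  fixes p s :: nat and \<gamma> K C :: real
  assumes ps: "1 \<le> s" "s \<le> p" and \<gamma>: "0 \<le> \<gamma>" "\<gamma> \<le> 1" and K: "1 \<le> K"
    and C: "32 \<le> C" "16 * K \<le> C" "4096 * (exp K * (cosh_level K + 3 * K + 2 + 2 * (16 * K\<^sup>2)) + 1) \<le> C\<^sup>2"
    and r: "0 < rate_sq p s \<gamma>" and \<epsilon>: "0 \<le> \<epsilon>" "\<epsilon>\<^sup>2 = C\<^sup>2 * rate_sq p s \<gamma>"
  shows "minimax_risk p s \<gamma> \<epsilon> \<le> 22 / K\<^sup>2"
proof -
  have p: "1 \<le> p" using ps by simp
  have K0: "0 < K" using K by simp
  let ?B = "1 - \<gamma> + \<gamma> * p"
  have q: "0 \<le> (1 - \<gamma>) * sqrt p" using \<gamma> by simp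
  have B: "0 \<le> ?B" using \<gamma> by simp
  have C5: "5 * K \<le> C" using C(2) K by linarith
  have C2: "16 * K\<^sup>2 \<le> C\<^sup>2"
  proof -
    have "4 * K \<le> C" using C(2) K by linarith
    then have "(4 * K)\<^sup>2 \<le> C\<^sup>2" using K by (intro power_mono) auto
    then show ?thesis by (simp add: power_mult_distrib)
  qed
  have Ch: "16 \<le> C / 2" "8 * K \<le> C / 2"
    "1024 * (exp K * (cosh_level K + 3 * K + 2 + 2 * (16 * K\<^sup>2)) + 1) \<le> (C / 2)\<^sup>2"
    using C by (simp_all add: power_divide)
  have C': "16 \<le> C" "8 * K \<le> C"
    "1024 * (exp K * (cosh_level K + 3 * K + 2 + 2 * (16 * K\<^sup>2)) + 1) \<le> C\<^sup>2"
  proof -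
    show "16 \<le> C" "8 * K \<le> C" using C K0 by linarith+
    have "(C / 2)\<^sup>2 \<le> C\<^sup>2" by (simp add: power_divide)
    then show "1024 * (exp K * (cosh_level K + 3 * K + 2 + 2 * (16 * K\<^sup>2)) + 1) \<le> C\<^sup>2"
      using Ch(3) by linarith
  qed
  have small: "11 / K\<^sup>2 + 11 / K\<^sup>2 = 22 / K\<^sup>2" by simp
  have chisq_mean: ?thesis
    if "C\<^sup>2 * ((1 - \<gamma>) * sqrt p + ?B) \<le> \<epsilon>\<^sup>2"
  proof -
    have "minimax_risk p s \<gamma> \<epsilon> \<le> (2 / K\<^sup>2 + 2 / K\<^sup>2) + 11 / K\<^sup>2"
    proof (rule minimax_risk_le[OF ps])
      show "measure (obs_law p \<gamma> (\<lambda>i\<in>{..<p}. 0)) (chisq_region p \<gamma> K \<union> mean_region p \<gamma> (2 * K))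
          \<le> 2 / K\<^sup>2 + 2 / K\<^sup>2"
        by (intro measure_obs_law_Un chisq_null mean_null p \<gamma> K0) measurable
      fix \<theta> assume "\<theta> \<in> sparse_alt p s \<epsilon>"
      note \<theta> = sparse_altD[OF this \<epsilon>(1)]
      show "measure (obs_law p \<gamma> \<theta>) (space (Rvec p) - (chisq_region p \<gamma> K \<union> mean_region p \<gamma> (2 * K))) \<le> 11 / K\<^sup>2"
        using \<theta>(1) that by (intro chisq_or_mean_region[OF p \<gamma> K C5]) linarith
    qed measurable
    also have "\<dots> \<le> 22 / K\<^sup>2" by (simp add: add_divide_distrib[symmetric] divide_right_mono)
    finally show ?thesis .
  qed
  have chisq_cosh: ?thesis
    if k: "1 \<le> k" "k\<^sup>2 \<le> p" and \<gamma>': "\<gamma> < 1"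
      and alt: "\<And>\<theta>. \<theta> \<in> sparse_alt p s \<epsilon> \<Longrightarrow>
        measure (obs_law p \<gamma> \<theta>) (space (Rvec p) - (chisq_region p \<gamma> K \<union> cosh_region p \<gamma> k K)) \<le> 11 / K\<^sup>2"
    for k
  proof -
    have "minimax_risk p s \<gamma> \<epsilon> \<le> (2 / K\<^sup>2 + 9 / K\<^sup>2) + 11 / K\<^sup>2"
    proof (rule minimax_risk_le[OF ps _ _ alt])
      show "measure (obs_law p \<gamma> (\<lambda>i\<in>{..<p}. 0)) (chisq_region p \<gamma> K \<union> cosh_region p \<gamma> k K)
          \<le> 2 / K\<^sup>2 + 9 / K\<^sup>2"
        by (intro measure_obs_law_Un chisq_null cosh_null p \<gamma> \<gamma>' K K0 k) measurable
    qed measurable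
    then show ?thesis by simp
  qed
  from ps show ?thesis
  proof (cases rule: rate_sq_cases[where \<gamma> = \<gamma>])
    case sparse
    have \<gamma>': "\<gamma> < 1" using r sparse \<gamma> by (cases "\<gamma> = 1") auto
    show ?thesis
    proof (rule chisq_cosh[OF ps(1) sparse(1) \<gamma>'])
      fix \<theta> assume "\<theta> \<in> sparse_alt p s \<epsilon>"
      note \<theta> = sparse_altD[OF this \<epsilon>(1)]
      let ?S = "{i \<in> {..<p}. \<theta> i \<noteq> 0}"
      have "(C / 2)\<^sup>2 * ((1 - \<gamma>) * s * ln (1 + p / (real s)\<^sup>2)) = \<epsilon>\<^sup>2 / 4"
        unfolding \<epsilon>(2) sparse(3) by (simp add: power_divide)
      also have "\<dots> \<le> (\<Sum>i<p. (\<theta> i)\<^sup>2) / 4" using \<theta>(1) by simp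
      also have "\<dots> \<le> (\<Sum>i\<in>?S. (\<theta> i - vec_mean p \<theta>)\<^sup>2)"
        using \<theta>(2) sparse(2) p by (intro centered_energy_support_ge) auto
      finally show "measure (obs_law p \<gamma> \<theta>) (space (Rvec p) - (chisq_region p \<gamma> K \<union> cosh_region p \<gamma> s K)) \<le> 11 / K\<^sup>2"
        by (intro chisq_or_cosh_region[OF ps(1) sparse(1) \<gamma>(1) \<gamma>' K Ch _ \<theta>(2)]) auto
    qed
  next
    case full
    then show ?thesis using \<epsilon> by (intro chisq_mean) simp
  next
    case moderate
    show ?thesis
    proof (cases "(1 - \<gamma>) * (p * sqrt p / (real p - s)) \<le> ?B")
      case False
      then have "rate_sq p s \<gamma> = (1 - \<gamma>) * sqrt p + ?B" using moderate by simp
      then show ?thesis using \<epsilon> by (intro chisq_mean) simp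
    next
      case True
      have \<gamma>': "\<gamma> < 1" using r moderate \<gamma> by (cases "\<gamma> = 1") auto
      have "minimax_risk p s \<gamma> \<epsilon> \<le> 2 / K\<^sup>2 + 4 / K\<^sup>2"
      proof (rule minimax_risk_le[OF ps])
        show "measure (obs_law p \<gamma> (\<lambda>i\<in>{..<p}. 0)) (chisq_region p \<gamma> K) \<le> 2 / K\<^sup>2"
          by (intro chisq_null p \<gamma> K0)
        fix \<theta> assume "\<theta> \<in> sparse_alt p s \<epsilon>"
        note \<theta> = sparse_altD[OF this \<epsilon>(1)]
        have ps': "0 < real p - s" using moderate by simp
        have "C\<^sup>2 * ((1 - \<gamma>) * sqrt p) = (real p - s) / p * (C\<^sup>2 * ((1 - \<gamma>) * (p * sqrt p / (real p - s))))"
          using ps' p by (simp add: field_simps)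
        also have "\<dots> \<le> (real p - s) / p * \<epsilon>\<^sup>2"
          unfolding \<epsilon>(2) using ps' True moderate q by (intro mult_left_mono) auto
        also have "\<dots> \<le> (real p - s) / p * (\<Sum>i<p. (\<theta> i)\<^sup>2)"
          using \<theta>(1) ps' by (intro mult_left_mono) auto
        also have "\<dots> \<le> (\<Sum>i<p. (\<theta> i - vec_mean p \<theta>)\<^sup>2)" by (rule centered_energy_ge[OF \<theta>(2) p])
        finally have V: "C\<^sup>2 * ((1 - \<gamma>) * sqrt p) \<le> (\<Sum>i<p. (\<theta> i - vec_mean p \<theta>)\<^sup>2)" .
        have "16 * K\<^sup>2 * ((1 - \<gamma>) * sqrt p) \<le> C\<^sup>2 * ((1 - \<gamma>) * sqrt p)"
          using C2 q by (rule mult_right_mono)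
        moreover have "0 < C\<^sup>2 * ((1 - \<gamma>) * sqrt p)" using C(1) \<gamma>' p by (intro mult_pos_pos) auto
        ultimately show "measure (obs_law p \<gamma> \<theta>) (space (Rvec p) - chisq_region p \<gamma> K) \<le> 4 / K\<^sup>2"
          using V by (intro chisq_alt p \<gamma> K) linarith+
      qed measurable
      also have "\<dots> \<le> 22 / K\<^sup>2" by (simp add: add_divide_distrib[symmetric] divide_right_mono)
      finally show ?thesis .
    qed
  next
    case dense
    define k where "k = p - s"
    have k1: "1 \<le> k" using dense by (simp add: k_def)
    let ?ln = "ln (1 + p / (real k)\<^sup>2)"
    show ?thesis
    proof (cases "(1 - \<gamma>) * (p * ?ln) \<le> ?B")
      case False
      then have "rate_sq p s \<gamma> = (1 - \<gamma>) * sqrt p + ?B" using dense by (simp add: k_def)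
      then show ?thesis using \<epsilon> by (intro chisq_mean) simp
    next
      case True
      then have rr: "rate_sq p s \<gamma> = (1 - \<gamma>) * sqrt p + (1 - \<gamma>) * (p * ?ln)"
        using dense by (simp add: k_def)
      have \<gamma>': "\<gamma> < 1" using r rr \<gamma> by (cases "\<gamma> = 1") auto
      have k2: "k\<^sup>2 \<le> p" using dense by (simp add: k_def)
      show ?thesis
      proof (rule chisq_cosh[OF k1 k2 \<gamma>'])
        fix \<theta> assume "\<theta> \<in> sparse_alt p s \<epsilon>"
        note \<theta> = sparse_altD[OF this \<epsilon>(1)]
        let ?Z = "{i \<in> {..<p}. \<theta> i = 0}"
        have "card {..<p} = card ({i \<in> {..<p}. \<theta> i \<noteq> 0} \<union> ?Z)" by (rule arg_cong[where f = card]) auto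
        also have "\<dots> \<le> card {i \<in> {..<p}. \<theta> i \<noteq> 0} + card ?Z" by (rule card_Un_le)
        finally have "k \<le> card ?Z" using \<theta>(2) by (simp add: k_def)
        then obtain S where S: "S \<subseteq> ?Z" "card S = k" using obtain_subset_with_card_n by metis
        show "measure (obs_law p \<gamma> \<theta>) (space (Rvec p) - (chisq_region p \<gamma> K \<union> cosh_region p \<gamma> k K)) \<le> 11 / K\<^sup>2"
        proof (rule chisq_or_cosh_region[OF k1 k2 \<gamma>(1) \<gamma>' K C', of S])
          assume V: "(\<Sum>i<p. (\<theta> i - vec_mean p \<theta>)\<^sup>2) < 16 * K\<^sup>2 * ((1 - \<gamma>) * sqrt p)"
          have "16 * K\<^sup>2 * ((1 - \<gamma>) * sqrt p) \<le> C\<^sup>2 * ((1 - \<gamma>) * sqrt p)"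
            using C2 q by (rule mult_right_mono)
          then have "C\<^sup>2 * ((1 - \<gamma>) * (p * ?ln)) \<le> p * (vec_mean p \<theta>)\<^sup>2"
            using V \<theta>(1) unfolding \<epsilon>(2) rr sum_sq_centered distrib_left by linarith
          then have "p * (C\<^sup>2 * ((1 - \<gamma>) * ?ln)) \<le> p * (vec_mean p \<theta>)\<^sup>2" by (simp add: mult_ac)
          then have "C\<^sup>2 * ((1 - \<gamma>) * ?ln) \<le> (vec_mean p \<theta>)\<^sup>2" using p by (subst (asm) mult_le_cancel_left_pos) auto
          then have "k * (C\<^sup>2 * ((1 - \<gamma>) * ?ln)) \<le> k * (vec_mean p \<theta>)\<^sup>2" by (intro mult_left_mono) auto
          also have "\<dots> = (\<Sum>i\<in>S. (vec_mean p \<theta>)\<^sup>2)" using S(2) by simp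
          also have "\<dots> = (\<Sum>i\<in>S. (\<theta> i - vec_mean p \<theta>)\<^sup>2)"
            using S(1) by (intro sum.cong) auto
          finally show "C\<^sup>2 * ((1 - \<gamma>) * k * ?ln) \<le> (\<Sum>i\<in>S. (\<theta> i - vec_mean p \<theta>)\<^sup>2)"
            by (simp add: mult_ac)
        qed (use S in auto)
      qed
    qed
  qed
qed

theorem theorem3:
  shows "minimax_separation_rate
           {(p, s, \<gamma>). 1 \<le> s \<and> s \<le> p \<and> 0 \<le> \<gamma> \<and> \<gamma> \<le> 1}
           (\<lambda>p s \<gamma>. sqrt (rate_sq p s \<gamma>))"
  unfolding minimax_separation_rate_def
proof (intro conjI ballI)
  fix t :: "nat \<times> nat \<times> real" assume "t \<in> {(p, s, \<gamma>). 1 \<le> s \<and> s \<le> p \<and> 0 \<le> \<gamma> \<and> \<gamma> \<le> 1}"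
  then show "case t of (p, s, \<gamma>) \<Rightarrow> 0 \<le> sqrt (rate_sq p s \<gamma>)"
    by (auto intro: rate_sq_nonneg(1))
next
  fix \<eta> :: real assume \<eta>: "\<eta> \<in> {0<..<1}"
  \<comment> \<open>Both errors are at most \<open>11 / K\<^sup>2\<close>.\<close>
  define K where "K = sqrt (22 / \<eta>)"
  have K2: "22 / K\<^sup>2 = \<eta>" using \<eta> by (simp add: K_def)
  have K: "1 \<le> K" using \<eta> by (simp add: K_def)
  define D where "D = 4096 * (exp K * (cosh_level K + 3 * K + 2 + 2 * (16 * K\<^sup>2)) + 1)"
  have D: "0 \<le> D" using K by (simp add: D_def cosh_level_def)
  define C0 where "C0 = 32 + 16 * K + sqrt D"
  have "0 < C0" using K D by (simp add: C0_def add_pos_nonneg)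
  moreover have "minimax_risk p s \<gamma> (C * sqrt (rate_sq p s \<gamma>)) \<le> \<eta>"
    if "1 \<le> s" "s \<le> p" "0 \<le> \<gamma>" "\<gamma> \<le> 1" "0 < sqrt (rate_sq p s \<gamma>)" "C0 < C" for p s \<gamma> C
  proof -
    have C: "32 \<le> C" "16 * K \<le> C" "sqrt D \<le> C"
      using that(6) K D real_sqrt_ge_zero[OF D] unfolding C0_def by linarith+
    have "D \<le> C\<^sup>2" using power_mono[OF C(3), of 2] D by simp
    then show ?thesis
      using minimax_risk_le_rate[OF that(1-4) K C(1,2), of "C * sqrt (rate_sq p s \<gamma>)"] that C
      by (simp add: D_def K2 power_mult_distrib)
  qed
  ultimately show "\<exists>C\<^sub>\<eta>>0. \<forall>(p, s, \<gamma>)\<in>{(p, s, \<gamma>). 1 \<le> s \<and> s \<le> p \<and> 0 \<le> \<gamma> \<and> \<gamma> \<le> 1}.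
      0 < sqrt (rate_sq p s \<gamma>) \<longrightarrow> (\<forall>C>C\<^sub>\<eta>. minimax_risk p s \<gamma> (C * sqrt (rate_sq p s \<gamma>)) \<le> \<eta>)"
    by (intro exI[of _ C0]) auto
next
  fix \<eta> :: real assume \<eta>: "\<eta> \<in> {0<..<1}"
  \<comment> \<open>The largest value for which \<open>sqrt (exp (24 * c0\<^sup>2) - 1) \<le> \<eta>\<close>.\<close>
  define c0 where "c0 = sqrt (ln (1 + \<eta>\<^sup>2) / 24)"
  have \<eta>2: "0 < \<eta>\<^sup>2" "\<eta>\<^sup>2 \<le> 1" using \<eta> by (auto simp: power_le_one)
  have ln: "0 < ln (1 + \<eta>\<^sup>2)" "ln (1 + \<eta>\<^sup>2) \<le> 1"
  proof -
    show "0 < ln (1 + \<eta>\<^sup>2)" using \<eta>2 by (intro ln_gt_zero) simp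
    show "ln (1 + \<eta>\<^sup>2) \<le> 1" using \<eta>2 ln_add_one_self_le_self[of "\<eta>\<^sup>2"] by simp
  qed
  have c02: "24 * c0\<^sup>2 = ln (1 + \<eta>\<^sup>2)" using ln by (simp add: c0_def)
  have "0 < c0" using ln by (simp add: c0_def)
  moreover have "1 - \<eta> \<le> minimax_risk p s \<gamma> (c * sqrt (rate_sq p s \<gamma>))"
    if "1 \<le> s" "s \<le> p" "0 \<le> \<gamma>" "\<gamma> \<le> 1" "0 < sqrt (rate_sq p s \<gamma>)" "0 < c" "c < c0" for p s \<gamma> c
  proof -
    have "c\<^sup>2 \<le> c0\<^sup>2" using that by (intro power_mono) auto
    then have c2: "24 * c\<^sup>2 \<le> ln (1 + \<eta>\<^sup>2)" using c02 by linarith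
    have "exp (24 * c\<^sup>2) \<le> 1 + \<eta>\<^sup>2" using c2 \<eta>2 by (subst ln_ge_iff[symmetric]) linarith+
    then have "sqrt (exp (24 * c\<^sup>2) - 1) \<le> sqrt (\<eta>\<^sup>2)" by (intro real_sqrt_le_mono) simp
    also have "\<dots> = \<eta>" using \<eta> by simp
    finally have "1 - \<eta> \<le> 1 - sqrt (exp (24 * c\<^sup>2) - 1)" by simp
    also have "\<dots> \<le> minimax_risk p s \<gamma> (c * sqrt (rate_sq p s \<gamma>))"
      using that c2 ln by (intro minimax_risk_ge_rate) (auto simp: power_mult_distrib)
    finally show ?thesis .
  qed
  ultimately show "\<exists>c\<^sub>\<eta>>0. \<forall>(p, s, \<gamma>)\<in>{(p, s, \<gamma>). 1 \<le> s \<and> s \<le> p \<and> 0 \<le> \<gamma> \<and> \<gamma> \<le> 1}.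
      0 < sqrt (rate_sq p s \<gamma>) \<longrightarrow>
      (\<forall>c. 0 < c \<and> c < c\<^sub>\<eta> \<longrightarrow> 1 - \<eta> \<le> minimax_risk p s \<gamma> (c * sqrt (rate_sq p s \<gamma>)))"
    by (intro exI[of _ c0]) auto
next
  fix t :: "nat \<times> nat \<times> real" assume "t \<in> {(p, s, \<gamma>). 1 \<le> s \<and> s \<le> p \<and> 0 \<le> \<gamma> \<and> \<gamma> \<le> 1}"
  moreover obtain p s \<gamma> where t: "t = (p, s, \<gamma>)" by (cases t)
  ultimately have a: "1 \<le> s" "s \<le> p" "0 \<le> \<gamma>" "\<gamma> \<le> 1" by auto
  have "\<gamma> = 1 \<and> s < p" if "rate_sq p s \<gamma> = 0"
    using rate_sq_nonneg(2)[OF a] that a by force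
  then show "case t of (p, s, \<gamma>) \<Rightarrow> sqrt (rate_sq p s \<gamma>) = 0 \<longrightarrow> (\<forall>\<epsilon>>0. minimax_risk p s \<gamma> \<epsilon> = 0)"
    using a by (auto simp: t minimax_risk_degenerate)
qed

end
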